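(* Let $0\le\eta<\frac12$. The function $Y(x,t):=y_{v(x,t)}(t)$, $x\in[-1,1]$, $t\ge 0$, is the entropy solution of $$\frac{\partial Y}{\partial t}+ \frac{\partial }{\partial x}\Big(2\eta xY +\frac{xY|Y|}{2}-\frac{Y^2}{2}-\frac{x^2}{2}\Big)=0,\qquad Y(x,0)=0 \ \text{ for all } x\in[-1,1],$$ with shock curve $\gamma(t)=0$, $t>T_1(0+)$.
   Context: For $0\le\eta<\frac12$ and $v\in\mathbb{R}$, $y_v(\cdot)$ denotes the unique solution (on its maximal interval of existence in $t\ge 0$) of $$\frac{d^2}{dt^2}y + y-\frac{1}{2}y^3-3 \eta |y|y-4\eta^2y=0,\qquad y(0)=0,\quad \frac{d}{dt}y(0)=v,$$ and $x_v(t):=\frac12 y_v(t)|y_v(t)|+2\eta y_v(t)+\frac{d}{dt}y_v(t)$. Let $G(y)=\frac{1}{4}y^4+2\eta|y|^3+4\eta^2y^2-y^2$ and $v_0:=\sqrt{-G(\sqrt{\eta^2+2}-3\eta)}$. For $v\in(0,v_0)$ let $y(v)$ be the smallest positive root of $z\mapsto G(z)+v^2$, and set $T(v):=\int_0^{y(v)} \frac{dz}{\sqrt{G(z)+v^2}}$, $H(v):= \int_v^{y(v)} \frac{dz}{\sqrt{G(z)+v^2}}$, $T_1(v):=T(v)+H(v)$; put $T_1(v):=T_1(-v)$ for $v\in(-v_0,0)$, $T_1(v):=+\infty$ for $|v|\ge v_0$, and $T_1(0+):=\lim_{v\downarrow0}T_1(v)$. For $x\ne 0$ and $t\ge0$,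 $v(x,t)$ denotes the unique $v\in\mathbb{R}$ such that $y_v$ is finite on $[0,t]$, $x_v(t)=x$ and $t<T_1(v)$ (its existence and uniqueness may be taken as known); $v(0,t):=0$. Entropy solution: write $\mathfrak g(x,Y)=2\eta xY +\frac{xY|Y|}{2}-\frac{Y^2}{2}-\frac{x^2}{2}$. "Entropy solution" is understood in the usual (Kruzhkov) sense for scalar conservation laws: $Y$ is locally bounded, attains the initial datum, and for all $c\in\mathbb{R}$ and all nonnegative $\varphi\in C_c^\infty((-1,1)\times(0,\infty))$, $$\iint \Big(|Y-c|\,\varphi_t+\operatorname{sign}(Y-c)\big(\mathfrak g(x,Y)-\mathfrak g(x,c)\big)\varphi_x-\operatorname{sign}(Y-c)\,\partial_x\mathfrak g(x,c)\,\varphi\Big)\,dx\,dt\ge 0 .$$ For a function that is $C^1$ off a shock curve $\gamma$, with one-sided limits $Y_\pm(t)$ as $x\downarrow\gamma(t)$, $x\uparrow\gamma(t)$, and solves the equation classically there, the corresponding criterion is: the Rankine–Hugoniot condition $\dot\gamma(t)=\frac{\mathfrak g(\gamma(t),Y_+(t))-\mathfrak g(\gamma(t),Y_-(t))}{Y_+(t)-Y_-(t)}$, and the Lax condition $$\frac{\mathfrak g(\gamma(t),c)-\mathfrak g(\gamma(t),Y_+(t))}{c-Y_+(t)}<\dot\gamma(t)<\frac{\mathfrak g(\gamma(t),c)-\mathfrak g(\gamma(t),Y_-(t))}{c-Y_-(t)}$$ for every $c$ strictly between $Y_-(t)$ and $Y_+(t)$. "With shock curve $\gamma$" means that $Y$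 is $C^1$ off the (closed) curve and jumps across it. *)

theory Defs
  imports "HOL-Analysis.Analysis"
begin

section \<open>The characteristic equation\<close>

definition ode_solution_on :: "real \<Rightarrow> real \<Rightarrow> real \<Rightarrow> (real \<Rightarrow> real) \<Rightarrow> bool" where
  "ode_solution_on \<eta> v \<tau> y \<longleftrightarrow> y 0 = 0 \<and>
     (\<exists>y'. y' 0 = v \<and>
       (\<forall>t\<in>{0..\<tau>}.
          (y has_real_derivative y' t) (at t within {0..\<tau>}) \<and>
          (y' has_real_derivative
             - (y t - (1/2) * y t ^ 3 - 3 * \<eta> * \<bar>y t\<bar> * y t - 4 * \<eta>\<^sup>2 * y t))
            (at t within {0..\<tau>})))"

definition finite_until :: "real \<Rightarrow> real \<Rightarrow> real \<Rightarrow> bool" where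
  "finite_until \<eta> v t \<longleftrightarrow> (\<exists>y. ode_solution_on \<eta> v t y)"

text \<open>The maximal interval of existence is the set of all \<open>t \<ge> 0\<close> with
  \<open>finite_until \<eta> v t\<close>; the following two values are meaningful only there.\<close>

definition y_sol :: "real \<Rightarrow> real \<Rightarrow> real \<Rightarrow> real" where
  "y_sol \<eta> v t = (THE a. \<exists>y. ode_solution_on \<eta> v t y \<and> y t = a)"

definition x_sol :: "real \<Rightarrow> real \<Rightarrow> real \<Rightarrow> real" where
  "x_sol \<eta> v t = (1/2) * y_sol \<eta> v t * \<bar>y_sol \<eta> v t\<bar> + 2 * \<eta> * y_sol \<eta> v t
     + vector_derivative (y_sol \<eta> v) (at t within {0..})"

section \<open>The time \<open>T\<^sub>1\<close>\<close>

definition G :: "real \<Rightarrow> real \<Rightarrow> real" where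
  "G \<eta> y = (1/4) * y ^ 4 + 2 * \<eta> * \<bar>y\<bar> ^ 3 + 4 * \<eta>\<^sup>2 * y\<^sup>2 - y\<^sup>2"

definition v_crit :: "real \<Rightarrow> real" where
  "v_crit \<eta> = sqrt (- G \<eta> (sqrt (\<eta>\<^sup>2 + 2) - 3 * \<eta>))"

definition y_root :: "real \<Rightarrow> real \<Rightarrow> real" where
  "y_root \<eta> v = (LEAST z. 0 < z \<and> G \<eta> z + v\<^sup>2 = 0)"

definition T_int :: "real \<Rightarrow> real \<Rightarrow> real" where
  "T_int \<eta> v = (LBINT z=ereal 0..ereal (y_root \<eta> v). 1 / sqrt (G \<eta> z + v\<^sup>2))"

definition H_int :: "real \<Rightarrow> real \<Rightarrow> real" where
  "H_int \<eta> v = (LBINT z=ereal v..ereal (y_root \<eta> v). 1 / sqrt (G \<eta> z + v\<^sup>2))"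

text \<open>The value at \<open>v = 0\<close> carries no meaning and is never used: \<open>x_sol \<eta> 0 t = 0\<close>, and
  \<open>v_of\<close> consults \<open>T1\<close> only for \<open>x \<noteq> 0\<close>.\<close>

definition T1 :: "real \<Rightarrow> real \<Rightarrow> ereal" where
  "T1 \<eta> v = (if \<bar>v\<bar> \<ge> v_crit \<eta> then \<infinity> else ereal (T_int \<eta> \<bar>v\<bar> + H_int \<eta> \<bar>v\<bar>))"

definition T1_0plus :: "real \<Rightarrow> ereal" where
  "T1_0plus \<eta> = Lim (at_right 0) (T1 \<eta>)"

section \<open>The function \<open>Y\<close>\<close>

definition v_of :: "real \<Rightarrow> real \<Rightarrow> real \<Rightarrow> real" where
  "v_of \<eta> x t =
     (if x = 0 then 0
      else (THE v. finite_until \<eta> v t \<and> x_sol \<eta> v t = x \<and> ereal t < T1 \<eta> v))"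

definition Y_fun :: "real \<Rightarrow> real \<Rightarrow> real \<Rightarrow> real" where
  "Y_fun \<eta> x t = y_sol \<eta> (v_of \<eta> x t) t"

definition flux :: "real \<Rightarrow> real \<Rightarrow> real \<Rightarrow> real" where
  "flux \<eta> x Y = 2 * \<eta> * x * Y + x * Y * \<bar>Y\<bar> / 2 - Y\<^sup>2 / 2 - x\<^sup>2 / 2"

section \<open>Entropy solutions on \<open>[-1,1] \<times> [0,\<infinity>)\<close>\<close>

text \<open>\<open>C_diff k\<close> is the class of \<open>C\<^sup>k\<close> functions on the plane.\<close>

primrec C_diff :: "nat \<Rightarrow> (real \<times> real \<Rightarrow> real) \<Rightarrow> bool" where
  "C_diff 0 f \<longleftrightarrow> continuous_on UNIV f"
| "C_diff (Suc k) f \<longleftrightarrow>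
     (\<exists>fx ft. C_diff k fx \<and> C_diff k ft \<and>
        (\<forall>p. (f has_derivative (\<lambda>(h, s). fx p * h + ft p * s)) (at p)))"

text \<open>Elements of \<open>C\<^sub>c\<^sup>\<infinity>(\<Omega>)\<close>, extended by zero to the plane.\<close>

definition test_function :: "(real \<times> real) set \<Rightarrow> (real \<times> real \<Rightarrow> real) \<Rightarrow> bool" where
  "test_function \<Omega> \<phi> \<longleftrightarrow> (\<forall>k. C_diff k \<phi>) \<and>
     compact (closure {p. \<phi> p \<noteq> 0}) \<and> closure {p. \<phi> p \<noteq> 0} \<subseteq> \<Omega>"

text \<open>Kruzhkov's notion for \<open>Y\<^sub>t + (g(x,Y))\<^sub>x = 0\<close>, \<open>Y(x,0) = Y0(x)\<close>. Measurability makes the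
  Bochner integrals below genuine (a non-integrable integrand would have integral 0). The initial
  datum is attained pointwise and as the limit in \<open>L\<^sup>1\<close> as \<open>t\<close> tends to \<open>0\<close>. There is no boundary
  condition at \<open>x = \<plusminus>1\<close>.\<close>

definition entropy_solution ::
    "(real \<Rightarrow> real \<Rightarrow> real) \<Rightarrow> (real \<Rightarrow> real) \<Rightarrow> (real \<Rightarrow> real \<Rightarrow> real) \<Rightarrow> bool" where
  "entropy_solution g Y0 Y \<longleftrightarrow>
     set_borel_measurable borel ({-1..1} \<times> {0..}) (\<lambda>(x, t). Y x t) \<and>
     (\<forall>K. compact K \<and> K \<subseteq> {-1..1} \<times> {0..} \<longrightarrow> bounded ((\<lambda>(x, t). Y x t) ` K)) \<and>
     (\<forall>x\<in>{-1..1}. Y x 0 = Y0 x) \<and>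
     ((\<lambda>t. LBINT x:{-1..1}. \<bar>Y x t - Y0 x\<bar>) \<longlongrightarrow> 0) (at_right 0) \<and>
     (\<forall>c \<phi>. test_function ({-1<..<1} \<times> {0<..}) \<phi> \<and> (\<forall>p. 0 \<le> \<phi> p) \<longrightarrow>
        0 \<le> (LINT p:{-1<..<1} \<times> {0<..}|lborel.
               (case p of (x, t) \<Rightarrow>
                  \<bar>Y x t - c\<bar> * deriv (\<lambda>s. \<phi> (x, s)) t
                  + sgn (Y x t - c) * (g x (Y x t) - g x c) * deriv (\<lambda>\<xi>. \<phi> (\<xi>, t)) x
                  - sgn (Y x t - c) * deriv (\<lambda>\<xi>. g \<xi> c) x * \<phi> (x, t))))"

section \<open>Shock curves\<close>

text \<open>\<open>C\<^sup>1\<close> classical solution on \<open>D\<close>; at boundary points of \<open>[-1,1] \<times> [0,\<infinity>)\<close> belonging to \<open>D\<close>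
  the derivatives are one-sided. The last conjunct is the equation itself, \<open>Yt\<close> being the
  \<open>t\<close>-derivative of \<open>Y\<close>.\<close>

definition C1_classical_solution_on ::
    "(real \<times> real) set \<Rightarrow> (real \<Rightarrow> real \<Rightarrow> real) \<Rightarrow> (real \<Rightarrow> real \<Rightarrow> real) \<Rightarrow> bool" where
  "C1_classical_solution_on D g Y \<longleftrightarrow>
     (\<exists>Yx Yt. continuous_on D Yx \<and> continuous_on D Yt \<and>
        (\<forall>p\<in>D. ((\<lambda>(x, t). Y x t) has_derivative (\<lambda>(h, s). Yx p * h + Yt p * s))
                 (at p within D)) \<and>
        (\<forall>(x, t)\<in>D. ((\<lambda>\<xi>. g \<xi> (Y \<xi> t)) has_real_derivative - Yt (x, t))
                 (at x within {-1..1})))"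

text \<open>\<open>Yp\<close> and \<open>Ym\<close> are the limits from the right and from the left of the curve; the conditions
  are the jump, the Rankine--Hugoniot condition and the Lax condition.\<close>

definition admissible_shock_at ::
    "(real \<Rightarrow> real \<Rightarrow> real) \<Rightarrow> (real \<Rightarrow> real) \<Rightarrow> (real \<Rightarrow> real \<Rightarrow> real) \<Rightarrow> real \<Rightarrow> bool" where
  "admissible_shock_at g \<gamma> Y t \<longleftrightarrow>
     (\<exists>Yp Ym \<gamma>'.
        ((\<lambda>x. Y x t) \<longlongrightarrow> Yp) (at_right (\<gamma> t)) \<and>
        ((\<lambda>x. Y x t) \<longlongrightarrow> Ym) (at_left (\<gamma> t)) \<and>
        Yp \<noteq> Ym \<and>
        (\<gamma> has_real_derivative \<gamma>') (at t) \<and>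
        \<gamma>' = (g (\<gamma> t) Yp - g (\<gamma> t) Ym) / (Yp - Ym) \<and>
        (\<forall>c. min Ym Yp < c \<and> c < max Ym Yp \<longrightarrow>
           (g (\<gamma> t) c - g (\<gamma> t) Yp) / (c - Yp) < \<gamma>' \<and>
           \<gamma>' < (g (\<gamma> t) c - g (\<gamma> t) Ym) / (c - Ym)))"

text \<open>The shock is present for \<open>t > t0\<close>; the closed curve removed from the domain includes its
  starting point at \<open>t = t0\<close>.\<close>

definition has_shock_curve ::
    "(real \<Rightarrow> real \<Rightarrow> real) \<Rightarrow> (real \<Rightarrow> real \<Rightarrow> real) \<Rightarrow> (real \<Rightarrow> real) \<Rightarrow> ereal \<Rightarrow> bool" where
  "has_shock_curve g Y \<gamma> t0 \<longleftrightarrow>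
     C1_classical_solution_on
       (({-1..1} \<times> {0..}) - {(\<gamma> t, t) |t. t0 \<le> ereal t}) g Y \<and>
     (\<forall>t. t0 < ereal t \<longrightarrow> admissible_shock_at g \<gamma> Y t)"

end

theory Submission
  imports Defs
begin

text \<open>
  With \<open>P y = y \<bar>y\<bar> / 2 + 2 \<eta> y\<close> the characteristics \<open>x = P y + y'\<close> conserve \<open>y'^2 = G y + v^2\<close>, where
  \<open>G = P^2 - y^2\<close>, and the equation reads \<open>y'' = P P' - y\<close>, whose right-hand side is convex on
  \<open>y \<ge> 0\<close> and vanishes at \<open>0\<close>. Sturm comparison of two solutions with \<open>0 < v < w\<close> then gives
  \<open>x\<^sub>w \<ge> (w / v) x\<^sub>v\<close> as long as \<open>x\<^sub>v \<ge> 0\<close>. Hence \<open>x\<^sub>v(t)\<close> increases in \<open>v\<close> with positive derivative while the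
  characteristics have not returned to \<open>x = 0\<close>, which happens at time \<open>T\<^sub>1(v)\<close>, and \<open>T\<^sub>1\<close> increases.
  The implicit function theorem makes \<open>Y\<close> a classical solution off the shock; \<open>Y\<close> is odd in \<open>x\<close>, so
  its traces at \<open>x = 0\<close> are \<open>\<plusminus>a\<close> with \<open>a > 0\<close>, and the flux \<open>- y^2 / 2\<close> at \<open>x = 0\<close> makes this jump
  stationary and admissible. The entropy inequality follows by integrating the Kruzhkov
  balance law over \<open>\<bar>x\<bar> \<ge> d\<close> and letting \<open>d\<close> tend to \<open>0\<close>.
\<close>

section \<open>Second-order equations\<close>

text \<open>The factor \<open>w / v\<close> in the comparison does more than order the
  characteristics. It bounds the derivative of \<open>x\<close> in \<open>v\<close> below by
  \<open>x / v\<close>, and it pushes \<open>x\<close> past every prescribed value as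
  \<open>v\<close> grows, so that every point is reached. The derivative bound degenerates at
  \<open>v = 0\<close>; the segment \<open>x = 0\<close> before the onset therefore needs the
  linearised flow along the trivial solution.

  The sum \<open>T + H\<close> is a return time because energy conservation can be written
  \<open>P\<^sup>2 - y'\<^sup>2 = y\<^sup>2 - v\<^sup>2\<close>: on the way down
  \<open>x = 0\<close> means \<open>y' = - P\<close>, hence \<open>y = v\<close>. So
  \<open>T\<close> is the ascent to the turning point and \<open>H\<close> the descent from there to
  the level \<open>v\<close>.

  The definitions speak of solutions that may blow up. A solution on \<open>[0, t]\<close> is
  bounded, so it is a trajectory of the flow whose force is truncated at some level
  \<open>R\<close>. This level depends on the solution, which is why \<open>R\<close> stays a
  parameter. Trajectories that reach \<open>0 < x \<le> 1\<close> without an earlier return do not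
  depend on it.\<close>

lemma gronwall_pair:
  fixes a b c :: "real \<Rightarrow> real"
  assumes T: "0 \<le> T" and L: "0 \<le> L"
    and a: "\<And>t. t \<in> {0..T} \<Longrightarrow> (a has_real_derivative b t) (at t within {0..T})"
    and b: "\<And>t. t \<in> {0..T} \<Longrightarrow> (b has_real_derivative c t) (at t within {0..T})"
    and c: "\<And>t. t \<in> {0..T} \<Longrightarrow> \<bar>c t\<bar> \<le> L * \<bar>a t\<bar> + e"
  shows "(a T)\<^sup>2 + (b T)\<^sup>2 \<le> ((a 0)\<^sup>2 + (b 0)\<^sup>2 + e\<^sup>2 * T) * exp ((L + 2) * T)"
proof (cases "T = 0")
  case False
  then have "0 < T" using T by simp
  \<comment> \<open>The rate \<open>L + 2\<close> absorbs the cross terms \<open>2 a b\<close> and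
    \<open>2 b c\<close> by Young's inequality; the part of the source that is left over is at most
    \<open>e\<^sup>2\<close> and is removed by the linear correction.\<close>
  define h where "h t = ((a t)\<^sup>2 + (b t)\<^sup>2) * exp (- ((L + 2) * t)) - e\<^sup>2 * t" for t
  define h' where "h' t = (2 * a t * b t + 2 * b t * c t - (L + 2) * ((a t)\<^sup>2 + (b t)\<^sup>2))
       * exp (- ((L + 2) * t)) - e\<^sup>2" for t
  have d: "(h has_real_derivative h' t) (at t within {0..T})" if "t \<in> {0..T}" for t
    unfolding h_def h'_def
    by (rule derivative_eq_intros a[OF that] b[OF that] refl | simp)+ (simp add: algebra_simps)
  have "h T \<le> h 0"
  proof (rule DERIV_nonpos_imp_decreasing_open[OF less_imp_le[OF \<open>0 < T\<close>]])
    show "continuous_on {0..T} h"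
      using d by (meson DERIV_continuous_on)
    fix t assume t: "0 < t" "t < T"
    have "2 * b t * c t \<le> L * ((a t)\<^sup>2 + (b t)\<^sup>2) + (b t)\<^sup>2 + e\<^sup>2"
    proof -
      have "2 * b t * c t \<le> 2 * (\<bar>b t\<bar> * \<bar>c t\<bar>)"
        by (metis abs_ge_self abs_mult mult.assoc mult_left_mono zero_le_numeral)
      also have "\<dots> \<le> 2 * (\<bar>b t\<bar> * (L * \<bar>a t\<bar> + e))"
        using c[of t] t by (simp add: mult_left_mono)
      also have "\<dots> = L * (2 * \<bar>b t\<bar> * \<bar>a t\<bar>) + 2 * \<bar>b t\<bar> * e" by (simp add: algebra_simps)
      also have "\<dots> \<le> L * ((a t)\<^sup>2 + (b t)\<^sup>2) + ((b t)\<^sup>2 + e\<^sup>2)"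
      proof (rule add_mono)
        show "L * (2 * \<bar>b t\<bar> * \<bar>a t\<bar>) \<le> L * ((a t)\<^sup>2 + (b t)\<^sup>2)"
          using sum_squares_bound[of "\<bar>b t\<bar>" "\<bar>a t\<bar>"] L by (intro mult_left_mono) auto
        show "2 * \<bar>b t\<bar> * e \<le> (b t)\<^sup>2 + e\<^sup>2"
          using sum_squares_bound[of "\<bar>b t\<bar>" e] by auto
      qed
      finally show ?thesis by simp
    qed
    moreover have "2 * a t * b t \<le> (a t)\<^sup>2 + (b t)\<^sup>2"
      by (rule sum_squares_bound)
    ultimately have "2 * a t * b t + 2 * b t * c t - (L + 2) * ((a t)\<^sup>2 + (b t)\<^sup>2) \<le> e\<^sup>2"
      by (simp add: algebra_simps) (smt (verit) zero_le_power2)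
    then have "(2 * a t * b t + 2 * b t * c t - (L + 2) * ((a t)\<^sup>2 + (b t)\<^sup>2)) * exp (- ((L + 2) * t))
        \<le> e\<^sup>2 * exp (- ((L + 2) * t))"
      by (rule mult_right_mono) simp
    also have "\<dots> \<le> e\<^sup>2 * 1"
      using t L by (intro mult_left_mono) auto
    finally have "h' t \<le> 0" by (simp add: h'_def)
    moreover have "DERIV h t :> h' t"
      using d[of t] t at_within_Icc_at[of 0 t T] by simp
    ultimately show "\<exists>y. DERIV h t :> y \<and> y \<le> 0" by blast
  qed
  then have "((a T)\<^sup>2 + (b T)\<^sup>2) * exp (- ((L + 2) * T)) \<le> (a 0)\<^sup>2 + (b 0)\<^sup>2 + e\<^sup>2 * T"
    by (simp add: h_def)
  then show ?thesis
    by (simp add: exp_minus divide_simps)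
qed simp

text \<open>Integration against the weight \<open>exp (K r)\<close> gains a factor
  \<open>1 / K\<close>. Two integrations turn the Lipschitz constant \<open>L\<close> into
  \<open>L / K\<^sup>2\<close>, which is what makes the Picard operator contract.\<close>

lemma integral_exp_bound:
  fixes g :: "real \<Rightarrow> real"
  assumes "continuous_on {0..s} g" "0 < K" "0 \<le> s" "0 \<le> A"
    and "\<And>r. r \<in> {0..s} \<Longrightarrow> \<bar>g r\<bar> \<le> A * exp (K * r)"
  shows "\<bar>integral {0..s} g\<bar> \<le> A / K * exp (K * s)"
proof -
  have "((\<lambda>r. A * exp (K * r)) has_integral (A / K * exp (K * s) - A / K * exp (K * 0))) {0..s}"
    using assms(2,3)
    by (intro fundamental_theorem_of_calculus)
       (auto intro!: derivative_eq_intros simp flip: has_real_derivative_iff_has_vector_derivative)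
  moreover have "norm (integral {0..s} g) \<le> integral {0..s} (\<lambda>r. A * exp (K * r))"
    using assms calculation
    by (intro integral_norm_bound_integral integrable_continuous_real) (auto intro!: continuous_intros)
  ultimately have "\<bar>integral {0..s} g\<bar> \<le> A / K * exp (K * s) - A / K * exp (K * 0)"
    by (metis integral_unique real_norm_def)
  moreover have "0 \<le> A / K" using assms by simp
  ultimately show ?thesis by simp
qed

text \<open>Picard iteration in the space of continuous functions with the norm
  \<open>sup \<bar>u t\<bar> / exp (K t)\<close>, in which it contracts on the whole half line.\<close>

lemma ode2_exists:
  fixes f :: "real \<Rightarrow> real \<Rightarrow> real"
  assumes L: "0 \<le> L"
    and cont: "\<And>u. continuous_on {0..} u \<Longrightarrow> continuous_on {0..} (\<lambda>t. f t (u t))"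
    and zero: "\<And>t. 0 \<le> t \<Longrightarrow> f t 0 = 0"
    and lip: "\<And>t x y. 0 \<le> t \<Longrightarrow> \<bar>f t x - f t y\<bar> \<le> L * \<bar>x - y\<bar>"
  shows "\<exists>y y'. y 0 = 0 \<and> y' 0 = v \<and>
    (\<forall>t\<ge>0. (y has_real_derivative y' t) (at t within {0..}) \<and>
           (y' has_real_derivative f t (y t)) (at t within {0..}))"
proof -
  \<comment> \<open>This choice gives \<open>L / K\<^sup>2 \<le> 1/2\<close>, the contraction
    constant below.\<close>
  define K where "K = L + 1"
  have K: "0 < K" "L \<le> K * K / 2"
    using L by (auto simp: K_def algebra_simps)
  define g where "g w r = f r (exp (K * r) * apply_bcontfun w r)" for w :: "real \<Rightarrow>\<^sub>C real" and r
  define J where "J w s = v + integral {0..s} (g w)" for w s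
  \<comment> \<open>The unknown \<open>w\<close> stands for \<open>y t / exp (K t)\<close>. Bounded
    continuous functions live on the whole line, so \<open>max 0 t\<close> continues the operator to
    negative times by a constant.\<close>
  define Op where "Op w t = exp (- (K * max 0 t)) * integral {0..max 0 t} (J w)" for w t
  have g_cont: "continuous_on {0..} (g w)" for w
    unfolding g_def by (intro cont continuous_intros continuous_on_subset[OF continuous_on_apply_bcontfun]) auto
  have g_cont': "continuous_on {0..s} (g w)" for w s
    using g_cont by (rule continuous_on_subset) auto
  have FTC: "((\<lambda>u. integral {0..u} h) has_real_derivative h t) (at t within {0..})"
    if "continuous_on {0..} h" "0 \<le> t" for h :: "real \<Rightarrow> real" and t
  proof -
    have "((\<lambda>u. integral {0..u} h) has_real_derivative h t) (at t within {0..t+1})"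
      using that by (intro integral_has_real_derivative continuous_on_subset[OF that(1)]) auto
    moreover have "at t within {0..t+1} = at t within {0..}"
      by (rule at_within_nhd[where S = "{..<t+1}"]) auto
    ultimately show ?thesis by simp
  qed
  have J_deriv: "(J w has_real_derivative g w t) (at t within {0..})" if "0 \<le> t" for w t
    unfolding J_def using FTC[OF g_cont that] by (auto intro!: derivative_eq_intros)
  have J_cont: "continuous_on {0..} (J w)" for w
    using J_deriv by (metis DERIV_continuous_on atLeast_iff)
  have J_cont': "continuous_on {0..s} (J w)" for w s
    using J_cont by (rule continuous_on_subset) auto
  have I_deriv: "((\<lambda>u. integral {0..u} (J w)) has_real_derivative J w t) (at t within {0..})"
    if "0 \<le> t" for w t
    using FTC[OF J_cont that] .
  have I_cont: "continuous_on {0..} (\<lambda>u. integral {0..u} (J w))" for w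
    using I_deriv by (metis (no_types, lifting) DERIV_continuous_on atLeast_iff)
  have g_diff: "\<bar>g w1 r - g w2 r\<bar> \<le> L * dist w1 w2 * exp (K * r)" if "0 \<le> r" for w1 w2 r
  proof -
    have "\<bar>g w1 r - g w2 r\<bar> \<le> L * \<bar>exp (K * r) * apply_bcontfun w1 r - exp (K * r) * apply_bcontfun w2 r\<bar>"
      unfolding g_def by (rule lip[OF that])
    also have "\<dots> = L * (exp (K * r) * dist (apply_bcontfun w1 r) (apply_bcontfun w2 r))"
      by (simp add: dist_real_def abs_mult flip: right_diff_distrib)
    also have "\<dots> \<le> L * (exp (K * r) * dist w1 w2)"
      using L by (intro mult_left_mono dist_bounded) auto
    finally show ?thesis by (simp add: mult_ac)
  qed
  have J_diff: "\<bar>J w1 s - J w2 s\<bar> \<le> L * dist w1 w2 / K * exp (K * s)" if "0 \<le> s" for w1 w2 s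
  proof -
    have "J w1 s - J w2 s = integral {0..s} (\<lambda>r. g w1 r - g w2 r)"
      unfolding J_def by (subst integral_diff) (auto intro!: integrable_continuous_real g_cont')
    then show ?thesis
      using integral_exp_bound[of s "\<lambda>r. g w1 r - g w2 r" K "L * dist w1 w2"] that K L g_diff
      by (auto intro!: continuous_intros g_cont')
  qed
  have Op_diff: "\<bar>Op w1 t - Op w2 t\<bar> \<le> 1/2 * dist w1 w2" for w1 w2 t
  proof -
    let ?t = "max 0 t"
    have "integral {0..?t} (J w1) - integral {0..?t} (J w2) = integral {0..?t} (\<lambda>r. J w1 r - J w2 r)"
      by (subst integral_diff) (auto intro!: integrable_continuous_real J_cont')
    moreover have "\<bar>integral {0..?t} (\<lambda>r. J w1 r - J w2 r)\<bar> \<le> L * dist w1 w2 / K / K * exp (K * ?t)"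
      using K L J_diff by (intro integral_exp_bound) (auto intro!: continuous_intros J_cont')
    ultimately have "\<bar>Op w1 t - Op w2 t\<bar> \<le> exp (- (K * ?t)) * (L * dist w1 w2 / K / K * exp (K * ?t))"
      unfolding Op_def by (simp only: abs_mult abs_exp_cancel flip: right_diff_distrib) (rule mult_left_mono, auto)
    also have "\<dots> = L / (K * K) * dist w1 w2"
      by (simp add: exp_minus)
    also have "\<dots> \<le> 1/2 * dist w1 w2"
      using K by (intro mult_right_mono) (auto simp: divide_simps)
    finally show ?thesis .
  qed
  \<comment> \<open>Only the image of 0 is bounded directly, through
    \<open>K t \<le> exp (K t)\<close>; the contraction estimate then bounds the image of every
    other \<open>w\<close>.\<close>
  have Op0: "\<bar>Op 0 t\<bar> \<le> \<bar>v\<bar> / K" for t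
  proof -
    let ?t = "max 0 t"
    have "integral {0..s} (g 0) = 0" for s
    proof -
      have "integral {0..s} (g 0) = integral {0..s} (\<lambda>_. 0)"
        by (rule integral_cong) (simp add: g_def zero)
      then show ?thesis by simp
    qed
    then have "J 0 = (\<lambda>s. v)" by (simp add: J_def fun_eq_iff)
    then have "\<bar>Op 0 t\<bar> = exp (- (K * ?t)) * ?t * \<bar>v\<bar>"
      by (simp add: Op_def abs_mult)
    also have "\<dots> \<le> (1 / K) * \<bar>v\<bar>"
    proof (rule mult_right_mono)
      have "K * ?t \<le> exp (K * ?t)" using exp_ge_add_one_self[of "K * ?t"] by linarith
      then show "exp (- (K * ?t)) * ?t \<le> 1 / K"
        using K by (simp add: exp_minus divide_simps mult.commute)
    qed simp
    finally show ?thesis by simp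
  qed
  have Op_bcont: "Op w \<in> bcontfun" for w
  proof (rule bcontfun_normI)
    show "continuous_on UNIV (Op w)"
      unfolding Op_def
      by (intro continuous_intros continuous_on_compose2[OF I_cont]) auto
    fix t show "norm (Op w t) \<le> \<bar>v\<bar> / K + 1/2 * dist w 0"
      using Op_diff[of w t 0] Op0[of t] unfolding real_norm_def by linarith
  qed
  define T where "T w = Bcontfun (Op w)" for w
  have T_apply: "apply_bcontfun (T w) = Op w" for w
    unfolding T_def using Op_bcont by (simp add: Bcontfun_inverse)
  have "\<exists>!w. T w = w"
  proof (rule banach_fix_type)
    show "(0::real) \<le> 1/2" "(1/2::real) < 1" by auto
    show "\<forall>w1 w2. dist (T w1) (T w2) \<le> 1/2 * dist w1 w2"
      by (intro allI dist_bound) (use Op_diff in \<open>simp add: T_apply dist_real_def\<close>)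
  qed
  then obtain w where w: "T w = w" by blast
  define y where "y t = integral {0..t} (J w)" for t
  have y_w: "y t = exp (K * t) * apply_bcontfun w t" if "0 \<le> t" for t
  proof -
    have "apply_bcontfun w t = Op w t" using T_apply[of w] w by simp
    then show ?thesis using that by (simp add: Op_def y_def exp_minus)
  qed
  have "y 0 = 0" "J w 0 = v" by (simp_all add: y_def J_def)
  moreover have "(y has_real_derivative J w t) (at t within {0..})" if "0 \<le> t" for t
    unfolding y_def[abs_def] by (rule I_deriv[OF that])
  moreover have "(J w has_real_derivative f t (y t)) (at t within {0..})" if "0 \<le> t" for t
    using J_deriv[OF that, of w] y_w[OF that] by (simp add: g_def)
  ultimately show ?thesis by blast
qed

text \<open>Solution and derivative form a pair so that a single \<open>SOME\<close> chooses both
  consistently.\<close>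

definition ivp :: "(real \<Rightarrow> real \<Rightarrow> real) \<Rightarrow> real \<Rightarrow> (real \<Rightarrow> real) \<times> (real \<Rightarrow> real) \<Rightarrow> bool" where
  "ivp f v q \<longleftrightarrow> fst q 0 = 0 \<and> snd q 0 = v \<and>
    (\<forall>t\<ge>0. (fst q has_real_derivative snd q t) (at t within {0..}) \<and>
           (snd q has_real_derivative f t (fst q t)) (at t within {0..}))"

lemma continuous_on_locally_lipschitz_param:
  fixes a :: "real \<Rightarrow> real \<Rightarrow> real"
  assumes lip: "\<And>T v w t. 0 \<le> t \<Longrightarrow> t \<le> T \<Longrightarrow> \<bar>a v t - a w t\<bar> \<le> C T * \<bar>v - w\<bar>"
    and cont: "\<And>v. continuous_on {0..} (a v)"
  shows "continuous_on (UNIV \<times> {0..}) (\<lambda>(v, t). a v t)"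
proof (clarsimp simp: continuous_on_def)
  fix v t :: real assume t: "0 \<le> t"
  let ?F = "at (v, t) within UNIV \<times> {0..}"
  have c: "((\<lambda>q. a v (snd q)) \<longlongrightarrow> a v t) ?F"
  proof -
    have "continuous_on (UNIV \<times> {0..}) (\<lambda>q :: real \<times> real. a v (snd q))"
      by (rule continuous_on_compose2[OF cont]) (auto intro!: continuous_intros)
    then show ?thesis using t by (auto simp: continuous_on_def)
  qed
  have "((\<lambda>q. a (fst q) (snd q) - a v (snd q)) \<longlongrightarrow> 0) ?F"
  proof (rule Lim_null_comparison)
    have "eventually (\<lambda>q. q \<in> UNIV \<times> {..<t+1} \<and> q \<in> UNIV \<times> {0..}) ?F"
      by (intro eventually_conj eventually_at_topological[THEN iffD2] exI[of _ "UNIV \<times> {..<t+1}"])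
         (auto simp: open_Times eventually_at_filter)
    then show "eventually (\<lambda>q. norm (a (fst q) (snd q) - a v (snd q)) \<le> C (t+1) * \<bar>fst q - v\<bar>) ?F"
      by eventually_elim (auto intro!: lip)
    have "((\<lambda>q. C (t+1) * \<bar>fst q - v\<bar>) \<longlongrightarrow> C (t+1) * \<bar>fst (v, t) - v\<bar>) ?F"
      by (intro tendsto_intros)
    then show "((\<lambda>q. C (t+1) * \<bar>fst q - v\<bar>) \<longlongrightarrow> 0) ?F" by simp
  qed
  from tendsto_add[OF this c] show "((\<lambda>(v, t). a v t) \<longlongrightarrow> a v t) ?F"
    by (simp add: case_prod_unfold)
qed

text \<open>One jointly continuous partial derivative suffices for joint differentiability. It is
  the time derivative here, so the derivative in \<open>v\<close> has to exist only pointwise; the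
  boundary time 0 is included.\<close>

lemma has_derivative_param_time:
  fixes a :: "real \<Rightarrow> real \<Rightarrow> real"
  assumes dv: "\<And>v t. 0 \<le> t \<Longrightarrow> ((\<lambda>v. a v t) has_real_derivative av v t) (at v)"
    and dt: "\<And>v t. 0 \<le> t \<Longrightarrow> (a v has_real_derivative at' v t) (at t within {0..})"
    and c: "continuous_on (UNIV \<times> {0..}) (\<lambda>(v, t). at' v t)" and t: "0 \<le> t"
  shows "((\<lambda>(v, t). a v t) has_derivative (\<lambda>(h, s). av v t * h + at' v t * s))
     (at (v, t) within UNIV \<times> {0..})"
proof -
  have "((\<lambda>(v, t). a v t) has_derivative (\<lambda>(h, s). av v t * h + blinfun_mult_right (at' v t) s))
     (at (v, t) within UNIV \<times> {0..})"
  proof (rule has_derivative_partialsI)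
    show "((\<lambda>x. a x t) has_derivative (*) (av v t)) (at v)"
      using dv[OF t] by (simp add: has_field_derivative_def)
    fix v t :: real assume "t \<in> {0..}"
    then show "(a v has_derivative blinfun_apply (blinfun_mult_right (at' v t))) (at t within {0..})"
      using dt[of t v] by (simp add: has_field_derivative_def)
  next
    have "continuous_on (UNIV \<times> {0..}) (\<lambda>(v, t). blinfun_mult_right (at' v t))"
      using c unfolding case_prod_unfold
      by (intro bounded_linear.continuous_on[OF bounded_linear_blinfun_mult_right])
    then show "continuous (at (v, t) within UNIV \<times> {0..}) (\<lambda>(v, t). blinfun_mult_right (at' v t))"
      using t by (auto simp: continuous_on_eq_continuous_within)
  qed (use t in auto)
  then show ?thesis by simp
qed

lemma at_within_pos: "0 < (t::real) \<Longrightarrow> at t within {0..} = at t"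
  by (rule at_within_interior) auto

lemma quadratic_imp_deriv:
  fixes f :: "real \<Rightarrow> real"
  assumes "\<And>w. \<bar>f w - f v - d * (w - v)\<bar> \<le> B * (w - v)\<^sup>2"
  shows "(f has_real_derivative d) (at v)"
  unfolding has_field_derivative_iff LIM_zero_iff[of _ d, symmetric]
proof (rule Lim_null_comparison)
  show "eventually (\<lambda>w. norm ((f w - f v) / (w - v) - d) \<le> B * \<bar>w - v\<bar>) (at v)"
  proof (rule eventually_at_filter[THEN iffD2], rule always_eventually, clarsimp)
    fix w assume w: "w \<noteq> v"
    then have "\<bar>(f w - f v) / (w - v) - d\<bar> = \<bar>f w - f v - d * (w - v)\<bar> / \<bar>w - v\<bar>"
      by (simp add: field_simps flip: abs_divide)
    also have "\<dots> \<le> B * (w - v)\<^sup>2 / \<bar>w - v\<bar>"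
      using assms by (intro divide_right_mono) auto
    also have "\<dots> = B * \<bar>w - v\<bar>"
      using w by (simp add: power2_eq_square field_simps flip: abs_mult)
    finally show "\<bar>(f w - f v) / (w - v) - d\<bar> \<le> B * \<bar>w - v\<bar>" .
  qed
  have "((\<lambda>w. B * \<bar>w - v\<bar>) \<longlongrightarrow> B * \<bar>v - v\<bar>) (at v)" by (intro tendsto_intros)
  then show "((\<lambda>w. B * \<bar>w - v\<bar>) \<longlongrightarrow> 0) (at v)" by simp
qed

section \<open>The global flow of y'' = F(y) and its derivative in the initial velocity\<close>

text \<open>The bound on \<open>p\<close> makes the flow global, and its Lipschitz constant gives
  Taylor remainders that are explicitly quadratic, so that smooth dependence on \<open>v\<close>
  follows from Gronwall estimates alone.\<close>

locale ode_flow =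
  fixes F p :: "real \<Rightarrow> real" and L M :: real
  assumes F_deriv: "(F has_real_derivative p x) (at x)"
    and F_0: "F 0 = 0"
    and p_bound: "\<bar>p x\<bar> \<le> L"
    and p_lip: "\<bar>p x - p y\<bar> \<le> M * \<bar>x - y\<bar>"
begin

lemma L_nonneg: "0 \<le> L"
  using p_bound[of 0] by simp

lemma M_nonneg: "0 \<le> M"
  using p_lip[of 1 0] by (smt (verit) abs_ge_zero mult_cancel_left1)

lemma F_lip: "\<bar>F x - F y\<bar> \<le> L * \<bar>x - y\<bar>"
  using field_differentiable_bound[of UNIV F p L x y] F_deriv p_bound
  by (auto simp: has_field_derivative_at_within)

lemma F_quadratic: "\<bar>F x - F y - p y * (x - y)\<bar> \<le> M * (x - y)\<^sup>2"
proof (cases "x = y")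
  case False
  then obtain z where z: "\<bar>z - y\<bar> \<le> \<bar>x - y\<bar>" "F x - F y = (x - y) * p z"
  proof (cases "x < y")
    case True
    from MVT2[OF True, of F p] F_deriv obtain z where "x < z" "z < y" "F y - F x = (y - x) * p z" by blast
    then show ?thesis by (intro that[of z]) (auto simp: algebra_simps)
  next
    case f: False
    with False have "y < x" by simp
    from MVT2[OF this, of F p] F_deriv obtain z where "y < z" "z < x" "F x - F y = (x - y) * p z" by blast
    then show ?thesis by (intro that[of z]) (auto simp: algebra_simps)
  qed
  have "\<bar>F x - F y - p y * (x - y)\<bar> = \<bar>x - y\<bar> * \<bar>p z - p y\<bar>"
    by (simp add: z(2) algebra_simps flip: abs_mult)
  also have "\<dots> \<le> \<bar>x - y\<bar> * (M * \<bar>x - y\<bar>)"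
    using p_lip[of z y] z(1) M_nonneg by (intro mult_left_mono) (auto intro: order.trans mult_left_mono)
  finally show ?thesis by (simp add: power2_eq_square mult_ac flip: abs_mult)
qed simp

lemma p_cont: "continuous_on A p"
proof -
  have "M-lipschitz_on A p"
    using p_lip M_nonneg by (auto simp: lipschitz_on_def dist_real_def)
  then show ?thesis by (rule lipschitz_on_continuous_on)
qed

lemma F_cont: "continuous_on A F"
  using F_deriv by (meson DERIV_continuous_on has_field_derivative_at_within)

definition flow_pair where "flow_pair v = (SOME q. ivp (\<lambda>t. F) v q)"

definition y where "y v = fst (flow_pair v)"

definition dy where "dy v = snd (flow_pair v)"

lemma flow_pair: "ivp (\<lambda>t. F) v (flow_pair v)"
proof -
  have "\<exists>y y'. y 0 = 0 \<and> y' 0 = v \<and>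
    (\<forall>t\<ge>0. (y has_real_derivative y' t) (at t within {0..}) \<and>
           (y' has_real_derivative F (y t)) (at t within {0..}))"
    by (rule ode2_exists[OF L_nonneg]) (auto intro!: continuous_on_compose2[OF F_cont] simp: F_0 F_lip)
  then have "\<exists>q. ivp (\<lambda>t. F) v q" by (auto simp: ivp_def)
  then show ?thesis unfolding flow_pair_def by (rule someI_ex)
qed

lemma y_0 [simp]: "y v 0 = 0" and dy_0 [simp]: "dy v 0 = v"
  using flow_pair[of v] by (auto simp: ivp_def y_def dy_def)

lemma y_deriv: "0 \<le> t \<Longrightarrow> (y v has_real_derivative dy v t) (at t within {0..})"
  and dy_deriv: "0 \<le> t \<Longrightarrow> (dy v has_real_derivative F (y v t)) (at t within {0..})"
  using flow_pair[of v] by (auto simp: ivp_def y_def dy_def)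

lemma y_deriv': "0 \<le> t \<Longrightarrow> A \<subseteq> {0..} \<Longrightarrow> (y v has_real_derivative dy v t) (at t within A)"
  and dy_deriv': "0 \<le> t \<Longrightarrow> A \<subseteq> {0..} \<Longrightarrow> (dy v has_real_derivative F (y v t)) (at t within A)"
  by (rule has_field_derivative_subset[OF y_deriv] has_field_derivative_subset[OF dy_deriv]; assumption)+

lemma y_deriv_at: "0 < t \<Longrightarrow> (y v has_real_derivative dy v t) (at t)"
  and dy_deriv_at: "0 < t \<Longrightarrow> (dy v has_real_derivative F (y v t)) (at t)"
  using y_deriv[of t v] dy_deriv[of t v] by (auto simp: at_within_pos)

lemma y_cont: "A \<subseteq> {0..} \<Longrightarrow> continuous_on A (y v)"
  and dy_cont: "A \<subseteq> {0..} \<Longrightarrow> continuous_on A (dy v)"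
  by (rule DERIV_continuous_on, rule y_deriv' dy_deriv'; auto)+

text \<open>Stated on \<open>{0..t}\<close> with derivatives relative to that interval, so that it
  applies to solutions of the original equation that may not exist beyond \<open>t\<close>.\<close>

lemma y_unique:
  assumes "z 0 = 0" "z' 0 = v"
    and "\<And>s. s \<in> {0..t} \<Longrightarrow> (z has_real_derivative z' s) (at s within {0..t})"
    and "\<And>s. s \<in> {0..t} \<Longrightarrow> (z' has_real_derivative F (z s)) (at s within {0..t})"
    and "s \<in> {0..t}"
  shows "z s = y v s" "z' s = dy v s"
proof -
  have "(z s - y v s)\<^sup>2 + (z' s - dy v s)\<^sup>2 \<le> ((z 0 - y v 0)\<^sup>2 + (z' 0 - dy v 0)\<^sup>2 + 0\<^sup>2 * s) * exp ((L + 2) * s)"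
  proof (rule gronwall_pair[where c = "\<lambda>s. F (z s) - F (y v s)"])
    fix r assume r: "r \<in> {0..s}"
    have "(z has_real_derivative z' r) (at r within {0..s})"
      "(z' has_real_derivative F (z r)) (at r within {0..s})"
      using assms r by (auto intro: has_field_derivative_subset[of _ _ _ "{0..t}"])
    then show "((\<lambda>s. z s - y v s) has_real_derivative z' r - dy v r) (at r within {0..s})"
      "((\<lambda>s. z' s - dy v s) has_real_derivative F (z r) - F (y v r)) (at r within {0..s})"
      using r by (auto intro!: derivative_intros y_deriv' dy_deriv')
    show "\<bar>F (z r) - F (y v r)\<bar> \<le> L * \<bar>z r - y v r\<bar> + 0"
      using F_lip by simp
  qed (use assms L_nonneg in auto)
  then have "(z s - y v s)\<^sup>2 + (z' s - dy v s)\<^sup>2 \<le> 0" using assms by simp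
  then show "z s = y v s" "z' s = dy v s" by (simp_all add: sum_power2_le_zero_iff)
qed

definition C where "C T = exp ((L + 2) * T)"

lemma C_ge: "0 \<le> T \<Longrightarrow> 1 \<le> C T" "0 < C T"
  using L_nonneg by (auto simp: C_def)

lemma C_mono: "t \<le> T \<Longrightarrow> C t \<le> C T"
  using L_nonneg by (auto simp: C_def)

text \<open>Linear bounds are extracted from the quadratic one by coarse estimates that avoid square
  roots: \<open>t \<le> (1 + T)\<^sup>2\<close>, and \<open>C T \<le> (C T)\<^sup>2\<close> because
  \<open>C T \<ge> 1\<close>.\<close>

lemma gronwall_C:
  fixes a b c :: "real \<Rightarrow> real"
  assumes T: "0 \<le> t" "t \<le> T"
    and a: "\<And>t. 0 \<le> t \<Longrightarrow> (a has_real_derivative b t) (at t within {0..})"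
    and b: "\<And>t. 0 \<le> t \<Longrightarrow> (b has_real_derivative c t) (at t within {0..})"
    and c: "\<And>t. t \<in> {0..T} \<Longrightarrow> \<bar>c t\<bar> \<le> L * \<bar>a t\<bar> + e"
    and e: "\<bar>b 0\<bar> \<le> B" "0 \<le> e" "a 0 = 0"
  shows "\<bar>a t\<bar> \<le> C T * (B + e * (1 + T))" "\<bar>b t\<bar> \<le> C T * (B + e * (1 + T))"
proof -
  have "(a t)\<^sup>2 + (b t)\<^sup>2 \<le> ((a 0)\<^sup>2 + (b 0)\<^sup>2 + e\<^sup>2 * t) * exp ((L + 2) * t)"
    by (rule gronwall_pair[where c = c])
       (use assms L_nonneg in \<open>auto intro: has_field_derivative_subset[of _ _ _ "{0..}"]\<close>)
  also have "\<dots> \<le> (B\<^sup>2 + e\<^sup>2 * (1 + T)\<^sup>2) * C T"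
  proof (rule mult_mono)
    have "(b 0)\<^sup>2 \<le> B\<^sup>2" using e(1) by (simp add: power2_le_iff_abs_le)
    moreover have "t \<le> (1 + T)\<^sup>2" using T by (simp add: power2_eq_square algebra_simps) (smt (verit) mult_nonneg_nonneg)
    ultimately show "(a 0)\<^sup>2 + (b 0)\<^sup>2 + e\<^sup>2 * t \<le> B\<^sup>2 + e\<^sup>2 * (1 + T)\<^sup>2"
      using e by (auto intro!: add_mono mult_left_mono)
    show "exp ((L + 2) * t) \<le> C T" using C_mono[OF T(2)] by (simp add: C_def)
  qed auto
  also have "\<dots> \<le> (B + e * (1 + T))\<^sup>2 * (C T)\<^sup>2"
  proof (rule mult_mono)
    show "B\<^sup>2 + e\<^sup>2 * (1 + T)\<^sup>2 \<le> (B + e * (1 + T))\<^sup>2"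
      using e T by (simp add: power2_sum power_mult_distrib)
    show "C T \<le> (C T)\<^sup>2"
      using C_ge[of T] T by (simp add: power2_eq_square)
  qed (auto simp: C_def)
  finally have *: "(a t)\<^sup>2 + (b t)\<^sup>2 \<le> (C T * (B + e * (1 + T)))\<^sup>2"
    by (simp add: power_mult_distrib mult.commute)
  have "0 \<le> C T * (B + e * (1 + T))"
    using C_ge[of T] e T by (intro mult_nonneg_nonneg add_nonneg_nonneg) auto
  then show "\<bar>a t\<bar> \<le> C T * (B + e * (1 + T))" "\<bar>b t\<bar> \<le> C T * (B + e * (1 + T))"
    using * by (auto simp flip: power2_le_iff_abs_le
        intro: order.trans[OF _ *] simp del: abs_le_iff)
qed

lemma y_lip: "0 \<le> t \<Longrightarrow> t \<le> T \<Longrightarrow> \<bar>y v t - y w t\<bar> \<le> C T * \<bar>v - w\<bar>"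
  and dy_lip: "0 \<le> t \<Longrightarrow> t \<le> T \<Longrightarrow> \<bar>dy v t - dy w t\<bar> \<le> C T * \<bar>v - w\<bar>"
  using gronwall_C[of t T "\<lambda>t. y v t - y w t" "\<lambda>t. dy v t - dy w t" "\<lambda>t. F (y v t) - F (y w t)" 0 "\<bar>v - w\<bar>"]
  by (auto intro!: derivative_intros y_deriv dy_deriv simp: F_lip)

text \<open>\<open>z\<close> and \<open>dz\<close> turn out to be the derivatives of \<open>y\<close> and \<open>dy\<close> in \<open>v\<close>.\<close>

definition lin_pair where "lin_pair v = (SOME q. ivp (\<lambda>t u. p (y v t) * u) 1 q)"

definition z where "z v = fst (lin_pair v)"

definition dz where "dz v = snd (lin_pair v)"

lemma lin_pair: "ivp (\<lambda>t u. p (y v t) * u) 1 (lin_pair v)"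
proof -
  have "\<exists>z z'. z 0 = 0 \<and> z' 0 = 1 \<and>
    (\<forall>t\<ge>0. (z has_real_derivative z' t) (at t within {0..}) \<and>
           (z' has_real_derivative p (y v t) * z t) (at t within {0..}))"
  proof (rule ode2_exists[OF L_nonneg])
    fix u :: "real \<Rightarrow> real" assume "continuous_on {0..} u"
    then show "continuous_on {0..} (\<lambda>t. p (y v t) * u t)"
      by (intro continuous_intros continuous_on_compose2[OF p_cont[of UNIV]] y_cont) auto
  next
    fix t a b :: real
    show "\<bar>p (y v t) * a - p (y v t) * b\<bar> \<le> L * \<bar>a - b\<bar>"
      using p_bound by (simp add: abs_mult mult_right_mono flip: right_diff_distrib)
  qed simp
  then have "\<exists>q. ivp (\<lambda>t u. p (y v t) * u) 1 q" by (auto simp: ivp_def)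
  then show ?thesis unfolding lin_pair_def by (rule someI_ex)
qed

lemma z_0 [simp]: "z v 0 = 0" and dz_0 [simp]: "dz v 0 = 1"
  using lin_pair[of v] by (auto simp: ivp_def z_def dz_def)

lemma z_deriv: "0 \<le> t \<Longrightarrow> (z v has_real_derivative dz v t) (at t within {0..})"
  and dz_deriv: "0 \<le> t \<Longrightarrow> (dz v has_real_derivative p (y v t) * z v t) (at t within {0..})"
  using lin_pair[of v] by (auto simp: ivp_def z_def dz_def)

lemma z_bound: "0 \<le> t \<Longrightarrow> t \<le> T \<Longrightarrow> \<bar>z v t\<bar> \<le> C T"
  using gronwall_C(1)[OF _ _ z_deriv dz_deriv, of t T v 0 1] p_bound
  by (simp add: abs_mult mult_right_mono)

text \<open>The difference of two variational solutions solves the linear equation along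
  \<open>y v\<close> with source \<open>(p (y v) - p (y w)) * z w\<close>, whose size is controlled
  by the Lipschitz constant of \<open>p\<close>, by \<open>y_lip\<close> and by
  \<open>z_bound\<close>.\<close>

lemma z_lip: "0 \<le> t \<Longrightarrow> t \<le> T \<Longrightarrow> \<bar>z v t - z w t\<bar> \<le> (C T * (M * C T * C T) * (1 + T)) * \<bar>v - w\<bar>"
  and dz_lip: "0 \<le> t \<Longrightarrow> t \<le> T \<Longrightarrow> \<bar>dz v t - dz w t\<bar> \<le> (C T * (M * C T * C T) * (1 + T)) * \<bar>v - w\<bar>"
proof -
  assume t: "0 \<le> t" "t \<le> T"
  define e where "e = M * (C T * \<bar>v - w\<bar>) * C T"
  have e: "0 \<le> e" using M_nonneg C_ge[of T] by (auto simp: e_def intro!: mult_nonneg_nonneg)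
  have *: "\<bar>p (y v s) * z v s - p (y w s) * z w s\<bar> \<le> L * \<bar>z v s - z w s\<bar> + e" if "s \<in> {0..T}" for s
  proof -
    have "p (y v s) * z v s - p (y w s) * z w s
        = p (y v s) * (z v s - z w s) + (p (y v s) - p (y w s)) * z w s"
      by (simp add: algebra_simps)
    moreover have "\<bar>p (y v s) * (z v s - z w s)\<bar> \<le> L * \<bar>z v s - z w s\<bar>"
      using p_bound by (simp add: abs_mult mult_right_mono)
    moreover have "\<bar>(p (y v s) - p (y w s)) * z w s\<bar> \<le> e"
      unfolding e_def abs_mult using that M_nonneg C_ge[of T] t
      by (intro mult_mono order.trans[OF p_lip] mult_left_mono y_lip z_bound) auto
    ultimately show ?thesis by linarith
  qed
  from gronwall_C[of t T "\<lambda>t. z v t - z w t" "\<lambda>t. dz v t - dz w t"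
      "\<lambda>t. p (y v t) * z v t - p (y w t) * z w t" e 0] * t e
  have "\<bar>z v t - z w t\<bar> \<le> C T * (e * (1 + T))" "\<bar>dz v t - dz w t\<bar> \<le> C T * (e * (1 + T))"
    by (auto intro!: derivative_intros z_deriv dz_deriv)
  then show "\<bar>z v t - z w t\<bar> \<le> (C T * (M * C T * C T) * (1 + T)) * \<bar>v - w\<bar>"
    "\<bar>dz v t - dz w t\<bar> \<le> (C T * (M * C T * C T) * (1 + T)) * \<bar>v - w\<bar>"
    by (simp_all add: e_def mult_ac)
qed

text \<open>The Taylor remainder of the flow in \<open>v\<close> solves the variational equation
  with the Taylor remainder of \<open>F\<close> as source. That source is quadratic in
  \<open>y w - y v\<close>, hence in \<open>w - v\<close>.\<close>

lemma difference_quotient: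
  assumes t: "0 \<le> t"
  shows "\<bar>y w t - y v t - z v t * (w - v)\<bar> \<le> (C t * (M * (C t)\<^sup>2) * (1 + t)) * (w - v)\<^sup>2"
    and "\<bar>dy w t - dy v t - dz v t * (w - v)\<bar> \<le> (C t * (M * (C t)\<^sup>2) * (1 + t)) * (w - v)\<^sup>2"
proof -
  define e where "e = M * (C t * \<bar>w - v\<bar>)\<^sup>2"
  have e: "0 \<le> e" using M_nonneg by (auto simp: e_def)
  let ?d = "\<lambda>s. y w s - y v s - z v s * (w - v)"
  have *: "\<bar>F (y w s) - F (y v s) - p (y v s) * z v s * (w - v)\<bar> \<le> L * \<bar>?d s\<bar> + e" if s: "s \<in> {0..t}" for s
  proof -
    have "F (y w s) - F (y v s) - p (y v s) * z v s * (w - v)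
        = p (y v s) * ?d s + (F (y w s) - F (y v s) - p (y v s) * (y w s - y v s))"
      by (simp add: algebra_simps)
    moreover have "\<bar>p (y v s) * ?d s\<bar> \<le> L * \<bar>?d s\<bar>"
      using p_bound by (simp add: abs_mult mult_right_mono)
    moreover have "\<bar>F (y w s) - F (y v s) - p (y v s) * (y w s - y v s)\<bar> \<le> e"
    proof -
      have "(y w s - y v s)\<^sup>2 \<le> (C t * \<bar>w - v\<bar>)\<^sup>2"
        using y_lip[of s t w v] s by (simp add: power2_le_iff_abs_le C_ge(2) less_imp_le)
      then show ?thesis
        using F_quadratic[of "y w s" "y v s"] M_nonneg unfolding e_def
        by (smt (verit) mult_left_mono)
    qed
    ultimately show ?thesis by (smt (verit))
  qed
  have d1: "(?d has_real_derivative dy w s - dy v s - dz v s * (w - v)) (at s within {0..})" if "0 \<le> s" for s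
    by (intro DERIV_diff y_deriv that DERIV_cmult_right z_deriv)
  have d2: "((\<lambda>s. dy w s - dy v s - dz v s * (w - v)) has_real_derivative
      F (y w s) - F (y v s) - p (y v s) * z v s * (w - v)) (at s within {0..})" if "0 \<le> s" for s
    by (intro DERIV_diff dy_deriv that DERIV_cmult_right dz_deriv)
  have "\<bar>?d t\<bar> \<le> C t * (0 + e * (1 + t))" "\<bar>dy w t - dy v t - dz v t * (w - v)\<bar> \<le> C t * (0 + e * (1 + t))"
    by (rule gronwall_C[OF t order.refl d1 d2 *]; use e in simp)+
  then show "\<bar>y w t - y v t - z v t * (w - v)\<bar> \<le> (C t * (M * (C t)\<^sup>2) * (1 + t)) * (w - v)\<^sup>2"
    "\<bar>dy w t - dy v t - dz v t * (w - v)\<bar> \<le> (C t * (M * (C t)\<^sup>2) * (1 + t)) * (w - v)\<^sup>2"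
    by (simp_all add: e_def mult_ac power_mult_distrib)
qed

lemma y_deriv_v: "0 \<le> t \<Longrightarrow> ((\<lambda>v. y v t) has_real_derivative z v t) (at v)"
  and dy_deriv_v: "0 \<le> t \<Longrightarrow> ((\<lambda>v. dy v t) has_real_derivative dz v t) (at v)"
  by (rule quadratic_imp_deriv, erule difference_quotient)+

lemma y_cont2: "continuous_on (UNIV \<times> {0..}) (\<lambda>(v, t). y v t)"
  and dy_cont2: "continuous_on (UNIV \<times> {0..}) (\<lambda>(v, t). dy v t)"
  and z_cont2: "continuous_on (UNIV \<times> {0..}) (\<lambda>(v, t). z v t)"
  and dz_cont2: "continuous_on (UNIV \<times> {0..}) (\<lambda>(v, t). dz v t)"
     apply (rule continuous_on_locally_lipschitz_param, erule (1) y_lip, rule y_cont, simp)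
    apply (rule continuous_on_locally_lipschitz_param, erule (1) dy_lip, rule dy_cont, simp)
   apply (rule continuous_on_locally_lipschitz_param, erule (1) z_lip, rule DERIV_continuous_on, rule z_deriv, simp)
  apply (rule continuous_on_locally_lipschitz_param, erule (1) dz_lip, rule DERIV_continuous_on, rule dz_deriv, simp)
  done

lemma y_has_derivative: "0 \<le> t \<Longrightarrow> ((\<lambda>(v, t). y v t) has_derivative (\<lambda>(h, s). z v t * h + dy v t * s))
     (at (v, t) within UNIV \<times> {0..})"
  by (intro has_derivative_param_time y_deriv_v y_deriv dy_cont2)


end

section \<open>The characteristic flow\<close>

lemma first_zero:
  fixes f :: "real \<Rightarrow> real"
  assumes cont: "continuous_on {0..t} f" and "0 < f 0" and "f t \<le> 0" and "0 \<le> t"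
  obtains s where "0 < s" "s \<le> t" "f s = 0" "\<And>r. 0 \<le> r \<Longrightarrow> r < s \<Longrightarrow> 0 < f r"
proof -
  let ?S = "{s \<in> {0..t}. f s \<le> 0}"
  have "closed ?S" by (intro continuous_on_closed_Collect_le[OF cont continuous_on_const closed_atLeastAtMost])
  then have "compact ({0..t} \<inter> ?S)" by (rule compact_Int_closed[OF compact_Icc])
  moreover have "{0..t} \<inter> ?S \<noteq> {}" using assms by auto
  ultimately obtain s where s: "s \<in> {0..t} \<inter> ?S" "\<And>r. r \<in> {0..t} \<inter> ?S \<Longrightarrow> s \<le> r"
    using compact_attains_inf[of "{0..t} \<inter> ?S"] by blast
  have pos: "0 < f r" if "0 \<le> r" "r < s" for r
    using s(2)[of r] s(1) that by force
  have "0 < s" using s(1) assms(2) by (cases "s = 0") auto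
  have "f s = 0"
  proof (rule ccontr)
    assume "f s \<noteq> 0"
    then have "f s < 0" using s(1) by auto
    moreover have "continuous_on {0..s} f" using cont s(1) by (auto intro: continuous_on_subset)
    ultimately obtain r where "0 \<le> r" "r \<le> s" "f r = 0"
      using IVT2'[of f s 0 0] assms(2) \<open>0 < s\<close> by auto
    then show False using pos[of r] \<open>f s \<noteq> 0\<close> by force
  qed
  then show thesis using that \<open>0 < s\<close> s(1) pos by auto
qed

lemma nondecreasing_on_interval:
  fixes f :: "real \<Rightarrow> real"
  assumes "a \<le> b" "continuous_on {a..b} f"
    and "\<And>x. a < x \<Longrightarrow> x < b \<Longrightarrow> (f has_real_derivative f' x) (at x)"
    and "\<And>x. a < x \<Longrightarrow> x < b \<Longrightarrow> 0 \<le> f' x"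
  shows "f a \<le> f b"
  by (rule DERIV_nonneg_imp_increasing_open[OF assms(1) _ assms(2)]) (use assms in blast)

lemma has_real_derivative_mult_abs: "((\<lambda>x. x * \<bar>x\<bar>) has_real_derivative 2 * \<bar>x\<bar>) (at x)" for x :: real
proof (cases "x = 0")
  case True
  have "((\<lambda>h :: real. \<bar>h\<bar>) \<longlongrightarrow> 0) (at 0)"
    by (auto intro!: tendsto_eq_intros)
  then have "((\<lambda>h :: real. h * \<bar>h\<bar> / h) \<longlongrightarrow> 0) (at 0)"
    by (rule Lim_transform_eventually) (auto simp: eventually_at_filter)
  then show ?thesis using True by (simp add: DERIV_def)
next
  case False
  have "((\<lambda>x. sgn a * (x * x)) has_real_derivative 2 * \<bar>x\<bar>) (at x)" if "sgn a = sgn x" for a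
    using that by (auto intro!: derivative_eq_intros simp: abs_sgn[of x])
  then show ?thesis
    by (rule has_field_derivative_transform_within_open[where S = "if 0 < x then {0<..} else {..<0}" and f = "\<lambda>y. sgn x * (y * y)"])
       (use False in \<open>auto simp: sgn_if split: if_splits\<close>)
qed

section \<open>The force, its potential and the truncation\<close>

definition P :: "real \<Rightarrow> real \<Rightarrow> real" where
  "P \<eta> y = y * \<bar>y\<bar> / 2 + 2 * \<eta> * y"

definition force :: "real \<Rightarrow> real \<Rightarrow> real" where
  "force \<eta> y = - (y - (1/2) * y ^ 3 - 3 * \<eta> * \<bar>y\<bar> * y - 4 * \<eta>\<^sup>2 * y)"

lemma P_deriv: "(P \<eta> has_real_derivative \<bar>y\<bar> + 2 * \<eta>) (at y)"
proof -
  have "((\<lambda>y. (y * \<bar>y\<bar>) / 2 + 2 * \<eta> * y) has_real_derivative (2 * \<bar>y\<bar>) / 2 + 2 * \<eta> * 1) (at y)"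
    by (intro DERIV_add DERIV_cdivide DERIV_cmult DERIV_ident has_real_derivative_mult_abs)
  then show ?thesis by (simp add: P_def[abs_def])
qed

lemma P_minus [simp]: "P \<eta> (- y) = - P \<eta> y"
  by (simp add: P_def)

lemma force_minus [simp]: "force \<eta> (- y) = - force \<eta> y"
  by (simp add: force_def)

text \<open>The factor \<open>\<bar>y\<bar> + 2 * \<eta>\<close> is the derivative of
  \<open>P\<close>. Hence \<open>x' = P' x - y\<close> along a characteristic, which gives the sign
  of \<open>x'\<close> wherever \<open>x = 0\<close>.\<close>

lemma force_eq: "force \<eta> y = P \<eta> y * (\<bar>y\<bar> + 2 * \<eta>) - y"
  by (simp add: force_def P_def algebra_simps power2_eq_square power3_eq_cube abs_if)

lemma G_eq: "G \<eta> y = (P \<eta> y)\<^sup>2 - y\<^sup>2"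
  by (simp add: G_def P_def algebra_simps power2_eq_square power3_eq_cube power4_eq_xxxx abs_if)

lemma G_minus [simp]: "G \<eta> (- y) = G \<eta> y"
  by (simp add: G_eq)

lemma G_deriv: "(G \<eta> has_real_derivative 2 * force \<eta> y) (at y)"
proof -
  have "((\<lambda>y. (P \<eta> y)\<^sup>2 - y\<^sup>2) has_real_derivative 2 * P \<eta> y * (\<bar>y\<bar> + 2 * \<eta>) - 2 * y) (at y)"
    by (auto intro!: derivative_eq_intros P_deriv)
  then show ?thesis by (simp add: G_eq[abs_def] force_eq algebra_simps)
qed

lemma force_deriv: "(force \<eta> has_real_derivative (3/2) * \<bar>y\<bar>\<^sup>2 + 6 * \<eta> * \<bar>y\<bar> + 4 * \<eta>\<^sup>2 - 1) (at y)"
proof -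
  have "((\<lambda>y. - (y - (1/2) * y ^ 3 - 3 * \<eta> * (y * \<bar>y\<bar>) - 4 * \<eta>\<^sup>2 * y)) has_real_derivative
      - (1 - (1/2) * (3 * y ^ 2) - 3 * \<eta> * (2 * \<bar>y\<bar>) - 4 * \<eta>\<^sup>2 * 1)) (at y)"
    by (rule derivative_eq_intros has_real_derivative_mult_abs refl | simp)+
  then show ?thesis by (simp add: force_def[abs_def] algebra_simps)
qed

text \<open>Solutions may blow up, but those that reach \<open>\<bar>x\<bar> \<le> 1\<close> stay in \<open>\<bar>y\<bar> \<le> 2\<close>; continuing the
  force linearly beyond \<open>\<bar>y\<bar> = R\<close> makes the flow global without losing convexity.\<close>

definition slope :: "real \<Rightarrow> real \<Rightarrow> real \<Rightarrow> real" where
  "slope \<eta> R y = (3/2) * (min \<bar>y\<bar> R)\<^sup>2 + 6 * \<eta> * min \<bar>y\<bar> R + 4 * \<eta>\<^sup>2 - 1"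

text \<open>Specifying the truncated force by its derivative avoids a piecewise formula beyond
  \<open>R\<close>.\<close>

definition tforce :: "real \<Rightarrow> real \<Rightarrow> real \<Rightarrow> real" where
  "tforce \<eta> R = (SOME F. F 0 = 0 \<and> (\<forall>y. (F has_real_derivative slope \<eta> R y) (at y)))"

lemma antiderivative_exists:
  fixes f :: "real \<Rightarrow> real"
  assumes "continuous_on UNIV f"
  shows "\<exists>F. F 0 = 0 \<and> (\<forall>y. (F has_real_derivative f y) (at y))"
proof -
  have "\<exists>F. \<forall>x :: real. - \<infinity> < ereal x \<longrightarrow> ereal x < \<infinity> \<longrightarrow> (F has_vector_derivative f x) (at x)"
    using assms by (intro einterval_antiderivative) (auto simp: continuous_on_eq_continuous_at)
  then obtain F where "\<And>x. (F has_real_derivative f x) (at x)"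
    by (auto simp: has_real_derivative_iff_has_vector_derivative)
  then show ?thesis
    by (intro exI[of _ "\<lambda>y. F y - F 0"]) (auto intro!: derivative_eq_intros)
qed

lemma tforce_0: "tforce \<eta> R 0 = 0"
  and tforce_deriv: "(tforce \<eta> R has_real_derivative slope \<eta> R y) (at y)"
proof -
  have "\<exists>F. F 0 = 0 \<and> (\<forall>y. (F has_real_derivative slope \<eta> R y) (at y))"
    by (rule antiderivative_exists) (auto simp: slope_def[abs_def] intro!: continuous_intros)
  from someI_ex[OF this] show "tforce \<eta> R 0 = 0"
    "(tforce \<eta> R has_real_derivative slope \<eta> R y) (at y)"
    by (auto simp: tforce_def)
qed

lemma deriv_eq_imp_eq:
  fixes f g :: "real \<Rightarrow> real"
  assumes "f 0 = g 0" "0 \<le> (y::real)"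
    and "\<And>x. 0 \<le> x \<Longrightarrow> x \<le> y \<Longrightarrow> (f has_real_derivative h x) (at x)"
    and "\<And>x. 0 \<le> x \<Longrightarrow> x \<le> y \<Longrightarrow> (g has_real_derivative h x) (at x)"
  shows "f y = g y"
proof -
  have c: "continuous_on {0..y} f" "continuous_on {0..y} g"
    using assms(3,4) by (auto intro!: continuous_at_imp_continuous_on DERIV_isCont)
  have "((\<lambda>x. f x - g x) has_real_derivative h x - h x) (at x)"
    "((\<lambda>x. g x - f x) has_real_derivative h x - h x) (at x)" if "0 < x" "x < y" for x
    by (intro DERIV_diff assms; use that in simp)+
  from nondecreasing_on_interval[OF assms(2) _ this(1)] nondecreasing_on_interval[OF assms(2) _ this(2)]
  show ?thesis using assms(1) by (simp add: c continuous_on_diff)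
qed

text \<open>The positive equilibrium of the force, a root of
  \<open>y\<^sup>2 + 6 * \<eta> * y + 8 * \<eta>\<^sup>2 - 2\<close>. On
  \<open>[0, y_crit \<eta>]\<close> the potential \<open>G\<close> decreases, and
  \<open>v_crit\<close> is the initial velocity whose energy level touches zero velocity
  there.\<close>

definition y_crit :: "real \<Rightarrow> real" where
  "y_crit \<eta> = sqrt (\<eta>\<^sup>2 + 2) - 3 * \<eta>"

lemma zero_deriv_nonpos:
  fixes f :: "real \<Rightarrow> real"
  assumes "(f has_real_derivative D) (at s)" "f s = 0" "0 < s" "\<And>r. 0 < r \<Longrightarrow> r < s \<Longrightarrow> 0 \<le> f r"
  shows "D \<le> 0"
proof (rule ccontr)
  assume "\<not> D \<le> 0"
  then obtain d where d: "0 < d" "\<And>h. 0 < h \<Longrightarrow> h < d \<Longrightarrow> f (s - h) < f s"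
    using DERIV_pos_inc_left[OF assms(1)] by auto
  define h where "h = min (d/2) (s/2)"
  have "0 < h" "h < d" "h < s" using d(1) assms(3) by (auto simp: h_def)
  then show False using d(2)[of h] assms(2) assms(4)[of "s - h"] by auto
qed

text \<open>\<open>R \<ge> 2\<close> keeps both \<open>y_crit \<eta>\<close> and the bound
  \<open>sqrt 2\<close> of the relevant trajectories strictly inside the range where the force is
  unchanged. Larger levels are used to capture arbitrary solutions of the original equation.\<close>

locale trunc =
  fixes \<eta> R :: real
  assumes eta: "0 \<le> \<eta>" "\<eta> < 1/2" and R: "2 \<le> R"
begin

sublocale ode_flow "tforce \<eta> R" "slope \<eta> R" "(3/2) * R\<^sup>2 + 6 * \<eta> * R + 4 * \<eta>\<^sup>2 + 1" "3 * R + 6 * \<eta>"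
proof
  fix x y :: real
  show "(tforce \<eta> R has_real_derivative slope \<eta> R x) (at x)" by (rule tforce_deriv)
  show "tforce \<eta> R 0 = 0" by (rule tforce_0)
  define m n where "m = min \<bar>x\<bar> R" and "n = min \<bar>y\<bar> R"
  have m: "0 \<le> m" "m \<le> R" and n: "0 \<le> n" "n \<le> R" using R by (auto simp: m_def n_def)
  have "m\<^sup>2 \<le> R\<^sup>2" "\<eta> * m \<le> \<eta> * R" "0 \<le> \<eta> * m" "0 \<le> m\<^sup>2"
    using m eta by (auto intro!: power_mono mult_left_mono)
  moreover have "0 \<le> \<eta>\<^sup>2" by simp
  moreover have "slope \<eta> R x = (3/2) * m\<^sup>2 + 6 * (\<eta> * m) + 4 * \<eta>\<^sup>2 - 1"
    by (simp add: slope_def m_def)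
  ultimately show "\<bar>slope \<eta> R x\<bar> \<le> (3/2) * R\<^sup>2 + 6 * \<eta> * R + 4 * \<eta>\<^sup>2 + 1"
    by linarith
  have "slope \<eta> R x - slope \<eta> R y = (m - n) * ((3/2) * (m + n) + 6 * \<eta>)"
    unfolding slope_def m_def[symmetric] n_def[symmetric] by (simp add: field_simps power2_eq_square)
  then have "\<bar>slope \<eta> R x - slope \<eta> R y\<bar> = \<bar>m - n\<bar> * ((3/2) * (m + n) + 6 * \<eta>)"
    using m n eta by (simp add: abs_mult)
  also have "\<dots> \<le> \<bar>x - y\<bar> * (3 * R + 6 * \<eta>)"
    using m n eta by (intro mult_mono) (auto simp: m_def n_def)
  finally show "\<bar>slope \<eta> R x - slope \<eta> R y\<bar> \<le> (3 * R + 6 * \<eta>) * \<bar>x - y\<bar>"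
    by (simp add: mult.commute)
qed

abbreviation "f \<equiv> tforce \<eta> R"

lemma f_minus [simp]: "f (- x) = - f x"
proof -
  have *: "f (- x) = - f x" if "0 \<le> x" for x
  proof -
    have "((\<lambda>x. - f (- x)) has_real_derivative slope \<eta> R x) (at x)" for x
    proof -
      have "((\<lambda>x. - f (- x)) has_real_derivative - (slope \<eta> R (- x) * - 1)) (at x)"
        by (rule DERIV_minus[OF DERIV_chain2[OF F_deriv DERIV_minus[OF DERIV_ident]]])
      then show ?thesis by (simp add: slope_def)
    qed
    then show ?thesis
      using deriv_eq_imp_eq[of "\<lambda>x. - f (- x)" f x "slope \<eta> R"] that F_deriv F_0 by auto
  qed
  show ?thesis
    using *[of x] *[of "- x"] by (cases "0 \<le> x") auto
qed

lemma f_force: "\<bar>x\<bar> \<le> R \<Longrightarrow> f x = force \<eta> x"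
proof -
  have *: "f x = force \<eta> x" if x: "0 \<le> x" "x \<le> R" for x
  proof (rule deriv_eq_imp_eq[OF _ x(1) F_deriv])
    fix u assume u: "0 \<le> u" "u \<le> x"
    then have "slope \<eta> R u = (3/2) * \<bar>u\<bar>\<^sup>2 + 6 * \<eta> * \<bar>u\<bar> + 4 * \<eta>\<^sup>2 - 1"
      using x by (simp add: slope_def min_def)
    then show "(force \<eta> has_real_derivative slope \<eta> R u) (at u)"
      using force_deriv[of \<eta> u] by simp
  qed (simp add: F_0 force_def)
  show "\<bar>x\<bar> \<le> R \<Longrightarrow> f x = force \<eta> x"
    using *[of x] *[of "- x"] by (cases "0 \<le> x") auto
qed

lemma slope_mono: "0 \<le> a \<Longrightarrow> a \<le> b \<Longrightarrow> slope \<eta> R a \<le> slope \<eta> R b"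
  unfolding slope_def using eta R
  by (intro diff_right_mono add_right_mono add_mono mult_left_mono power_mono) auto

lemma f_le_slope: "0 \<le> a \<Longrightarrow> f a \<le> a * slope \<eta> R a"
proof (cases "a = 0")
  case False
  assume "0 \<le> a"
  with False have "0 < a" by simp
  from MVT2[OF this, of f "slope \<eta> R"] F_deriv obtain c where c: "0 < c" "c < a" "f a - f 0 = (a - 0) * slope \<eta> R c"
    by blast
  then show ?thesis using F_0 slope_mono[of c a] \<open>0 < a\<close> by (simp add: mult_left_mono)
qed (simp add: F_0)

text \<open>Convexity together with \<open>f 0 = 0\<close> makes \<open>f a / a\<close>
  nondecreasing; cleared of denominators, this is the form that the derivative of the Wronskian
  requires.\<close>

lemma f_superlinear: "0 < a \<Longrightarrow> a \<le> b \<Longrightarrow> f a * b \<le> f b * a"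
proof -
  assume ab: "0 < a" "a \<le> b"
  have "f a / a \<le> f b / b"
  proof (rule nondecreasing_on_interval[OF ab(2)])
    show "continuous_on {a..b} (\<lambda>x. f x / x)"
      using ab by (intro continuous_intros F_cont) auto
    fix x assume x: "a < x"
    with ab show "((\<lambda>x. f x / x) has_real_derivative (slope \<eta> R x * x - f x * 1) / (x * x)) (at x)"
      by (intro DERIV_divide F_deriv DERIV_ident) auto
    show "0 \<le> (slope \<eta> R x * x - f x * 1) / (x * x)"
      using f_le_slope[of x] x ab by (auto intro!: divide_nonneg_nonneg simp: mult.commute)
  qed
  then show ?thesis using ab by (simp add: field_simps)
qed

text \<open>Positivity is where \<open>\<eta> < 1/2\<close> enters:
  \<open>(3 * \<eta>)\<^sup>2 < \<eta>\<^sup>2 + 2\<close> amounts to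
  \<open>4 * \<eta>\<^sup>2 < 1\<close>.\<close>

lemma y_crit: "0 < y_crit \<eta>" "y_crit \<eta> \<le> sqrt 2" "y_crit \<eta> < 2"
proof -
  have "\<eta>\<^sup>2 < (1/2)\<^sup>2" using eta by (intro power_strict_mono) auto
  then have "(3 * \<eta>)\<^sup>2 < \<eta>\<^sup>2 + 2" by (simp add: power_mult_distrib power2_eq_square)
  then have "3 * \<eta> < sqrt (\<eta>\<^sup>2 + 2)" by (rule real_less_rsqrt)
  then show "0 < y_crit \<eta>" by (simp add: y_crit_def)
  have "\<eta>\<^sup>2 + 2 \<le> (sqrt 2 + 3 * \<eta>)\<^sup>2" using eta by (simp add: power2_sum power_mult_distrib)
  then have "sqrt (\<eta>\<^sup>2 + 2) \<le> sqrt 2 + 3 * \<eta>" using eta by (intro real_le_lsqrt) auto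
  then show "y_crit \<eta> \<le> sqrt 2" by (simp add: y_crit_def)
  also have "sqrt 2 < 2" by (rule real_less_lsqrt) auto
  finally show "y_crit \<eta> < 2" .
qed

lemma force_factor: "0 \<le> x \<Longrightarrow> 2 * force \<eta> x = x * (x - y_crit \<eta>) * (x + sqrt (\<eta>\<^sup>2 + 2) + 3 * \<eta>)"
proof -
  assume x: "0 \<le> x"
  define r where "r = sqrt (\<eta>\<^sup>2 + 2)"
  have "r * r = \<eta>\<^sup>2 + 2" by (simp add: r_def)
  then have "(x - (r - 3 * \<eta>)) * (x + r + 3 * \<eta>) = x\<^sup>2 + 6 * \<eta> * x + 8 * \<eta>\<^sup>2 - 2"
    by (simp add: algebra_simps power2_eq_square)
  then show ?thesis
    using x by (simp add: y_crit_def r_def[symmetric] force_def mult.assoc)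
      (simp add: algebra_simps power2_eq_square power3_eq_cube)
qed

lemma force_neg: "0 < x \<Longrightarrow> x < y_crit \<eta> \<Longrightarrow> force \<eta> x < 0"
  and force_pos: "y_crit \<eta> < x \<Longrightarrow> 0 < force \<eta> x"
  and force_y_crit: "force \<eta> (y_crit \<eta>) = 0"
proof -
  have s: "0 < sqrt (\<eta>\<^sup>2 + 2)" by (simp add: add_nonneg_pos)
  show "force \<eta> x < 0" if "0 < x" "x < y_crit \<eta>"
  proof -
    have "x * (x - y_crit \<eta>) * (x + sqrt (\<eta>\<^sup>2 + 2) + 3 * \<eta>) < 0"
      using that s eta by (intro mult_neg_pos mult_pos_neg add_pos_nonneg add_pos_pos) auto
    then show ?thesis using force_factor[of x] that by simp
  qed
  show "0 < force \<eta> x" if "y_crit \<eta> < x"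
  proof -
    have "0 < x * (x - y_crit \<eta>) * (x + sqrt (\<eta>\<^sup>2 + 2) + 3 * \<eta>)"
      using that s eta y_crit(1) by (intro mult_pos_pos add_pos_nonneg) auto
    then show ?thesis using force_factor[of x] that y_crit(1) by simp
  qed
  show "force \<eta> (y_crit \<eta>) = 0" using force_factor[of "y_crit \<eta>"] y_crit(1) by simp
qed

text \<open>Beyond \<open>R\<close> the sign is carried over from \<open>R\<close> by
  superlinearity.\<close>

lemma f_pos: "y_crit \<eta> < x \<Longrightarrow> 0 < f x"
proof -
  assume x: "y_crit \<eta> < x"
  define m where "m = min x R"
  have m: "y_crit \<eta> < m" "m \<le> x" "m \<le> R" using x y_crit R by (auto simp: m_def)
  then have "0 < f m" using force_pos f_force[of m] y_crit(1) by simp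
  then have "0 < f m * x" using m y_crit(1) by simp
  also have "\<dots> \<le> f x * m" using f_superlinear[of m x] m y_crit(1) by simp
  finally show ?thesis using m y_crit(1) by (simp add: zero_less_mult_iff)
qed

lemma G_strict_decreasing: "0 \<le> a \<Longrightarrow> a < b \<Longrightarrow> b \<le> y_crit \<eta> \<Longrightarrow> G \<eta> b < G \<eta> a"
proof (rule DERIV_neg_imp_decreasing_open, assumption)
  show "continuous_on {a..b} (G \<eta>)"
    by (intro continuous_at_imp_continuous_on ballI DERIV_isCont[OF G_deriv])
next
  fix x assume "0 \<le> a" "b \<le> y_crit \<eta>" "a < x" "x < b"
  then show "\<exists>D. (G \<eta> has_real_derivative D) (at x) \<and> D < 0"
    using force_neg[of x] by (intro exI[of _ "2 * force \<eta> x"] conjI G_deriv) auto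
qed

lemma v_crit: "0 < v_crit \<eta>" "(v_crit \<eta>)\<^sup>2 = - G \<eta> (y_crit \<eta>)" "v_crit \<eta> \<le> y_crit \<eta>"
proof -
  have "G \<eta> (y_crit \<eta>) < 0" using G_strict_decreasing[of 0 "y_crit \<eta>"] y_crit(1) by (simp add: G_def)
  then show "0 < v_crit \<eta>" and *: "(v_crit \<eta>)\<^sup>2 = - G \<eta> (y_crit \<eta>)"
    by (auto simp: v_crit_def y_crit_def)
  have "(v_crit \<eta>)\<^sup>2 \<le> (y_crit \<eta>)\<^sup>2" unfolding * by (simp add: G_eq)
  then show "v_crit \<eta> \<le> y_crit \<eta>" by (rule power2_le_imp_le) (use y_crit in simp)
qed

section \<open>Energy and symmetries\<close>

lemma y_minus: "0 \<le> t \<Longrightarrow> y (- v) t = - y v t"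
  and dy_minus: "0 \<le> t \<Longrightarrow> dy (- v) t = - dy v t"
proof -
  assume t: "0 \<le> t"
  have *: "((\<lambda>s. - y v s) has_real_derivative - dy v s) (at s within {0..t})"
    "((\<lambda>s. - dy v s) has_real_derivative f (- y v s)) (at s within {0..t})" if "s \<in> {0..t}" for s
    using that by (auto intro!: DERIV_minus y_deriv' dy_deriv')
  show "y (- v) t = - y v t" "dy (- v) t = - dy v t"
    using y_unique[of "\<lambda>s. - y v s" "\<lambda>s. - dy v s" "- v" t t] * t by auto
qed

lemma y_zero [simp]: "0 \<le> t \<Longrightarrow> y 0 t = 0" "0 \<le> t \<Longrightarrow> dy 0 t = 0"
  using y_minus[of t 0] dy_minus[of t 0] by auto

lemma energy_exists: "\<exists>K. K 0 = 0 \<and> (\<forall>x. (K has_real_derivative 2 * f x) (at x))"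
  by (rule antiderivative_exists) (intro continuous_intros F_cont)

lemma energy_gen:
  assumes K: "K 0 = 0" "\<And>x. (K has_real_derivative 2 * f x) (at x)" and t: "0 \<le> t"
  shows "(dy v t)\<^sup>2 = K (y v t) + v\<^sup>2"
proof (cases "t = 0")
  case False
  define E where "E s = (dy v s)\<^sup>2 - K (y v s)" for s
  have d: "(E has_real_derivative 0) (at s)" if "0 < s" for s
  proof -
    have "(E has_real_derivative (of_nat 2 * dy v s ^ (2 - Suc 0) * f (y v s)) - (2 * f (y v s)) * dy v s) (at s)"
      unfolding E_def
      by (rule DERIV_diff[OF _ DERIV_chain2[OF K(2) y_deriv_at[OF that]]])
         (use DERIV_power[OF dy_deriv_at[OF that, of v], of 2] in \<open>simp add: mult_ac\<close>)
    then show ?thesis by (simp add: mult_ac)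
  qed
  have Kc: "continuous_on UNIV K" using K(2) by (auto intro!: continuous_at_imp_continuous_on DERIV_isCont)
  have "continuous_on {0..t} E"
    unfolding E_def by (intro continuous_intros dy_cont continuous_on_compose2[OF Kc] y_cont) auto
  then have "E 0 \<le> E t" "- E 0 \<le> - E t"
    using nondecreasing_on_interval[of 0 t E "\<lambda>_. 0"]
      nondecreasing_on_interval[of 0 t "\<lambda>s. - E s" "\<lambda>_. 0"] d t DERIV_minus[OF d]
    by (auto intro!: continuous_intros)
  then show ?thesis by (simp add: E_def K(1))
qed (simp add: K(1))

lemma K_eq_G:
  assumes K: "K 0 = 0" "\<And>x. (K has_real_derivative 2 * f x) (at x)" and x: "\<bar>x\<bar> \<le> R"
  shows "K x = G \<eta> x"
proof -
  have *: "K x = G \<eta> x" if "0 \<le> x" "x \<le> R" for x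
  proof (rule deriv_eq_imp_eq[OF _ that(1) K(2)])
    fix u assume "0 \<le> u" "u \<le> x"
    then show "(G \<eta> has_real_derivative 2 * f u) (at u)"
      using that G_deriv[of \<eta> u] f_force[of u] by simp
  qed (simp add: K(1) G_def)
  have "((\<lambda>x. K (- x)) has_real_derivative 2 * f x) (at x)" for x
    using DERIV_chain2[OF K(2) DERIV_minus[OF DERIV_ident], of x UNIV] by simp
  then have **: "K (- x) = K x" if "0 \<le> x" for x
    using deriv_eq_imp_eq[of "\<lambda>x. K (- x)" K x "\<lambda>x. 2 * f x"] that K by auto
  show ?thesis
    using *[of x] *[of "- x"] **[of "-x"] x by (cases "0 \<le> x") auto
qed

text \<open>Conservation holds globally for the potential of the truncated force, and that potential
  equals \<open>G\<close> on \<open>[-R, R]\<close>. The bound on \<open>y\<close> is therefore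
  required at the single time \<open>t\<close> and not on the way there.\<close>

lemma energy: "0 \<le> t \<Longrightarrow> \<bar>y v t\<bar> \<le> R \<Longrightarrow> (dy v t)\<^sup>2 = G \<eta> (y v t) + v\<^sup>2"
  using energy_exists energy_gen K_eq_G by metis

lemma energy_0: "0 \<le> t \<Longrightarrow> y v t = 0 \<Longrightarrow> (dy v t)\<^sup>2 = v\<^sup>2"
  using energy[of t v] R by (simp add: G_def)

lemma y_deriv_backward:
  assumes "0 \<le> q" "q \<le> r" "r \<le> s"
  shows "((\<lambda>u. y v (s - u)) has_real_derivative - dy v (s - q)) (at q within {0..r})"
    and "((\<lambda>u. dy v (s - u)) has_real_derivative - f (y v (s - q))) (at q within {0..r})"
proof -
  have a: "((\<lambda>u. s - u) has_real_derivative -1) (at q within {0..r})"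
    by (auto intro!: derivative_eq_intros)
  show "((\<lambda>u. y v (s - u)) has_real_derivative - dy v (s - q)) (at q within {0..r})"
    using DERIV_image_chain[OF y_deriv' a] assms by (auto simp: o_def image_subset_iff)
  show "((\<lambda>u. dy v (s - u)) has_real_derivative - f (y v (s - q))) (at q within {0..r})"
    using DERIV_image_chain[OF dy_deriv' a] assms by (auto simp: o_def image_subset_iff)
qed

text \<open>As functions of \<open>r\<close>, both sides solve the same autonomous second-order
  equation with the same data at \<open>r = 0\<close>, since the velocity vanishes at
  \<open>s\<close>. This transfers the ascent of a trajectory to its descent.\<close>

lemma reflection:
  assumes s: "0 \<le> s" and z: "dy v s = 0" and r: "0 \<le> r" "r \<le> s"
  shows "y v (s + r) = y v (s - r)" "dy v (s + r) = - dy v (s - r)"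
proof -
  have 1: "((\<lambda>u. y v (s + u)) has_real_derivative dy v (s + q)) (at q within {0..r})"
    "((\<lambda>u. dy v (s + u)) has_real_derivative f (y v (s + q))) (at q within {0..r})"
    if q: "q \<in> {0..r}" for q
  proof -
    have a: "((\<lambda>u. s + u) has_real_derivative 1) (at q within {0..r})"
      by (auto intro!: derivative_eq_intros)
    show "((\<lambda>u. y v (s + u)) has_real_derivative dy v (s + q)) (at q within {0..r})"
      using DERIV_image_chain[OF y_deriv' a] q s by (auto simp: o_def image_subset_iff)
    show "((\<lambda>u. dy v (s + u)) has_real_derivative f (y v (s + q))) (at q within {0..r})"
      using DERIV_image_chain[OF dy_deriv' a] q s by (auto simp: o_def image_subset_iff)
  qed
  have "(y v (s + r) - y v (s - r))\<^sup>2 + (dy v (s + r) + dy v (s - r))\<^sup>2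
     \<le> ((y v (s + 0) - y v (s - 0))\<^sup>2 + (dy v (s + 0) + dy v (s - 0))\<^sup>2 + 0\<^sup>2 * r)
        * exp (((3/2) * R\<^sup>2 + 6 * \<eta> * R + 4 * \<eta>\<^sup>2 + 1 + 2) * r)"
  proof (rule gronwall_pair[where c = "\<lambda>q. f (y v (s + q)) - f (y v (s - q))"])
    fix q assume q: "q \<in> {0..r}"
    show "((\<lambda>u. y v (s + u) - y v (s - u)) has_real_derivative dy v (s + q) + dy v (s - q)) (at q within {0..r})"
      using DERIV_diff[OF 1(1)[OF q] y_deriv_backward(1)] q r by simp
    show "((\<lambda>u. dy v (s + u) + dy v (s - u)) has_real_derivative f (y v (s + q)) - f (y v (s - q))) (at q within {0..r})"
      using DERIV_add[OF 1(2)[OF q] y_deriv_backward(2)] q r by simp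
    show "\<bar>f (y v (s + q)) - f (y v (s - q))\<bar>
        \<le> ((3/2) * R\<^sup>2 + 6 * \<eta> * R + 4 * \<eta>\<^sup>2 + 1) * \<bar>y v (s + q) - y v (s - q)\<bar> + 0"
      using F_lip by simp
  qed (use r L_nonneg in auto)
  then have "(y v (s + r) - y v (s - r))\<^sup>2 + (dy v (s + r) + dy v (s - r))\<^sup>2 \<le> 0"
    using z by simp
  then show "y v (s + r) = y v (s - r)" "dy v (s + r) = - dy v (s - r)"
    by (auto simp: sum_power2_le_zero_iff)
qed

section \<open>Sturm comparison\<close>

definition X where "X v t = P \<eta> (y v t) + dy v t"

lemma X_0 [simp]: "X v 0 = v"
  by (simp add: X_def P_def)

lemma X_minus: "0 \<le> t \<Longrightarrow> X (- v) t = - X v t"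
  by (simp add: X_def y_minus dy_minus)

lemma P_cont: "continuous_on A (P \<eta>)"
  by (auto intro!: continuous_at_imp_continuous_on DERIV_isCont P_deriv)

lemma X_cont: "A \<subseteq> {0..} \<Longrightarrow> continuous_on A (X v)"
  unfolding X_def by (intro continuous_intros continuous_on_compose2[OF P_cont[of UNIV]] y_cont dy_cont) auto

lemma P_nonneg: "0 \<le> x \<Longrightarrow> 0 \<le> P \<eta> x"
  using eta by (simp add: P_def)

lemma P_pos: "0 < x \<Longrightarrow> 0 < P \<eta> x"
  using eta by (simp add: P_def add_pos_nonneg)

text \<open>At a first return of \<open>y\<close> to 0 the energy forces a velocity of modulus
  \<open>v\<close>, necessarily negative, and \<open>P\<close> vanishes there; so \<open>X\<close>
  would be negative.\<close>

lemma y_pos: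
  assumes v: "0 < v" and X: "\<And>s. 0 \<le> s \<Longrightarrow> s \<le> t \<Longrightarrow> 0 \<le> X v s" and t: "0 < t"
  shows "0 < y v t"
proof (rule ccontr)
  assume neg: "\<not> 0 < y v t"
  obtain d where d: "0 < d" "\<And>h. 0 < h \<Longrightarrow> h < d \<Longrightarrow> y v 0 < y v h"
    using has_real_derivative_pos_inc_right[OF y_deriv[of 0 v]] v by auto
  \<comment> \<open>Time is shifted by \<open>e\<close> because \<open>y v 0 = 0\<close>, whereas
    \<open>first_zero\<close> starts from a positive value.\<close>
  define e where "e = min (d/2) (t/2)"
  have e: "0 < e" "e < d" "e < t" using d t by (auto simp: e_def)
  have "continuous_on {0..t-e} (\<lambda>s. y v (e + s))"
    using e by (intro continuous_on_compose2[OF y_cont[of "{0..}"]] continuous_intros) auto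
  moreover have "0 < y v (e + 0)" using d(2)[of e] e by simp
  ultimately obtain s where s: "0 < s" "s \<le> t - e" "y v (e + s) = 0" "\<And>r. 0 \<le> r \<Longrightarrow> r < s \<Longrightarrow> 0 < y v (e + r)"
    using first_zero[of "t-e" "\<lambda>s. y v (e + s)"] neg e by auto
  define u where "u = e + s"
  have u: "0 < u" "u \<le> t" "y v u = 0" using e s by (auto simp: u_def)
  have pos: "0 < y v r" if "0 < r" "r < u" for r
  proof (cases "r < e")
    case True then show ?thesis using d(2)[of r] that e by simp
  next
    case False then show ?thesis using s(4)[of "r - e"] that by (simp add: u_def)
  qed
  have "dy v u \<le> 0"
    using zero_deriv_nonpos[OF y_deriv_at[OF u(1)] u(3) u(1)] pos by (simp add: less_imp_le)
  moreover have "dy v u \<noteq> 0" using energy_0[of u v] u v by auto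
  ultimately have "X v u < 0" using u by (simp add: X_def P_def)
  then show False using X[of u] u by simp
qed

text \<open>With the Wronskian \<open>W\<close>, the quotient \<open>y v2 / y v1\<close> has
  derivative \<open>W / (y v1)\<^sup>2\<close>, and \<open>W\<close> grows from 0 by superlinearity
  of the force as long as \<open>y v1 \<le> y v2\<close>. The quotient starts from
  \<open>v2 / v1\<close>.\<close>

lemma sturm:
  assumes v: "0 < v1" "v1 < v2" and t: "0 < t"
    and pos: "\<And>s. 0 < s \<Longrightarrow> s \<le> t \<Longrightarrow> 0 < y v1 s"
  shows "y v1 t < y v2 t" "y v2 t * dy v1 t \<le> dy v2 t * y v1 t" "v2 * y v1 t \<le> v1 * y v2 t"
proof -
  define W where "W s = dy v2 s * y v1 s - y v2 s * dy v1 s" for s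
  have W_deriv: "(W has_real_derivative f (y v2 s) * y v1 s - y v2 s * f (y v1 s)) (at s)" if "0 < s" for s
  proof -
    have "(W has_real_derivative (f (y v2 s) * y v1 s + dy v1 s * dy v2 s) - (dy v2 s * dy v1 s + f (y v1 s) * y v2 s)) (at s)"
      unfolding W_def by (intro DERIV_diff DERIV_mult y_deriv_at dy_deriv_at that)
    then show ?thesis by (simp add: mult_ac)
  qed
  have W_cont: "continuous_on {0..s} W" for s
    unfolding W_def by (intro continuous_intros y_cont dy_cont) auto
  \<comment> \<open>The monotonicity of \<open>W\<close> is first obtained under the ordering of the
    two solutions, which superlinearity presupposes.\<close>
  have core: "0 \<le> W s \<and> y v2 r / y v1 r \<le> y v2 s / y v1 s"
    if s: "s \<le> t" "0 < r" "r \<le> s" and le: "\<And>q. 0 < q \<Longrightarrow> q < s \<Longrightarrow> y v1 q \<le> y v2 q" for r s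
  proof -
    have W: "0 \<le> W q" if q: "0 \<le> q" "q \<le> s" for q
    proof -
      have "W 0 \<le> W q"
      proof (rule nondecreasing_on_interval[OF q(1) W_cont])
        fix x assume x: "0 < x" "x < q"
        then show "(W has_real_derivative f (y v2 x) * y v1 x - y v2 x * f (y v1 x)) (at x)"
          by (intro W_deriv)
        show "0 \<le> f (y v2 x) * y v1 x - y v2 x * f (y v1 x)"
          using f_superlinear[of "y v1 x" "y v2 x"] pos[of x] le[of x] x q s by (simp add: mult.commute)
      qed
      then show ?thesis by (simp add: W_def)
    qed
    have "y v2 r / y v1 r \<le> y v2 s / y v1 s"
    proof (rule nondecreasing_on_interval[OF s(3)])
      show "continuous_on {r..s} (\<lambda>x. y v2 x / y v1 x)"
        using s pos by (intro continuous_intros y_cont) (auto simp: less_imp_neq[THEN not_sym])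
      fix x assume x: "r < x" "x < s"
      then have p: "0 < y v1 x" using pos[of x] s by simp
      have "((\<lambda>x. y v2 x / y v1 x) has_real_derivative
          (dy v2 x * y v1 x - y v2 x * dy v1 x) / (y v1 x * y v1 x)) (at x)"
        using s x p by (intro DERIV_divide y_deriv_at) auto
      then show "((\<lambda>x. y v2 x / y v1 x) has_real_derivative W x / (y v1 x * y v1 x)) (at x)"
        by (simp add: W_def)
      show "0 \<le> W x / (y v1 x * y v1 x)" using W[of x] x s by simp
    qed
    then show ?thesis using W[of s] s by simp
  qed
  obtain d where d: "0 < d" "\<And>h. 0 < h \<Longrightarrow> h < d \<Longrightarrow> y v2 0 - y v1 0 < y v2 h - y v1 h"
    using has_real_derivative_pos_inc_right[OF DERIV_diff[OF y_deriv[of 0 v2] y_deriv[of 0 v1]]] v by auto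
  \<comment> \<open>At a first crossing the quotient would equal 1, although it exceeded 1 earlier
    and does not decrease before the crossing.\<close>
  have less: "y v1 s < y v2 s" if s: "0 < s" "s \<le> t" for s
  proof (rule ccontr)
    assume neg: "\<not> y v1 s < y v2 s"
    define e where "e = min (d/2) (s/2)"
    have e: "0 < e" "e < d" "e < s" using d s by (auto simp: e_def)
    have "continuous_on {0..s-e} (\<lambda>r. y v2 (e + r) - y v1 (e + r))"
      using e by (intro continuous_on_diff continuous_on_compose2[OF y_cont[of "{0..}"]] continuous_intros) auto
    moreover have "0 < y v2 (e + 0) - y v1 (e + 0)" using d(2)[of e] e by simp
    ultimately obtain q where q: "0 < q" "q \<le> s - e" "y v2 (e + q) - y v1 (e + q) = 0"
        "\<And>r. 0 \<le> r \<Longrightarrow> r < q \<Longrightarrow> 0 < y v2 (e + r) - y v1 (e + r)"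
      using first_zero[of "s-e" "\<lambda>r. y v2 (e + r) - y v1 (e + r)"] neg e by auto
    define u where "u = e + q"
    have u: "0 < u" "u \<le> t" "y v2 u = y v1 u" "e < u" using e q s by (auto simp: u_def)
    have lt: "y v1 r < y v2 r" if "0 < r" "r < u" for r
    proof (cases "r < e")
      case True then show ?thesis using d(2)[of r] that e by simp
    next
      case False then show ?thesis using q(4)[of "r - e"] that by (simp add: u_def)
    qed
    have "y v2 e / y v1 e \<le> y v2 u / y v1 u"
      using core[of u e] u e lt by (simp add: less_imp_le)
    moreover have "1 < y v2 e / y v1 e" using lt[of e] pos[of e] e s u by simp
    moreover have "y v2 u / y v1 u = 1" using u pos[of u] by simp
    ultimately show False by simp
  qed
  then show "y v1 t < y v2 t" using t by simp
  have c: "0 \<le> W t \<and> y v2 r / y v1 r \<le> y v2 t / y v1 t" if "0 < r" "r \<le> t" for r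
    using core[of t r] that less by (simp add: less_imp_le)
  then show "y v2 t * dy v1 t \<le> dy v2 t * y v1 t" using t by (force simp: W_def)
  \<comment> \<open>Both solutions vanish at 0; dividing each by \<open>r\<close> identifies the
    initial value of the quotient as \<open>v2 / v1\<close>.\<close>
  have lim: "((\<lambda>r. y v r / r) \<longlongrightarrow> v) (at_right 0)" for v
  proof -
    have "((\<lambda>r. (y v r - y v 0) / (r - 0)) \<longlongrightarrow> dy v 0) (at 0 within {0..})"
      using y_deriv[of 0 v] by (simp add: has_field_derivative_iff)
    then show ?thesis by (simp add: at_within_Ici_at_right)
  qed
  have "v2 / v1 \<le> y v2 t / y v1 t"
  proof (rule tendsto_upperbound)
    show "((\<lambda>r. (y v2 r / r) / (y v1 r / r)) \<longlongrightarrow> v2 / v1) (at_right 0)"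
      using v by (intro tendsto_divide lim) auto
    show "\<forall>\<^sub>F r in at_right 0. (y v2 r / r) / (y v1 r / r) \<le> y v2 t / y v1 t"
      using eventually_at_right_less[of 0] eventually_at_right_real[OF t]
      by eventually_elim (use c in auto)
  qed auto
  then show "v2 * y v1 t \<le> v1 * y v2 t"
    using v pos[of t] t by (simp add: field_simps)
qed

text \<open>In \<open>X / y = P y / y + y' / y\<close> the first term increases with
  \<open>y\<close> because of the quadratic part of \<open>P\<close>, and the second is ordered by
  \<open>sturm\<close>. Hence \<open>X v2 / X v1\<close> is at least \<open>y v2 / y v1\<close>,
  which is at least \<open>v2 / v1\<close>.\<close>

lemma X_compare:
  assumes v: "0 < v1" "v1 < v2" and X: "\<And>s. 0 \<le> s \<Longrightarrow> s \<le> t \<Longrightarrow> 0 \<le> X v1 s" and t: "0 \<le> t"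
  shows "v2 * X v1 t \<le> v1 * X v2 t" "0 < X v2 t" "X v1 t < X v2 t"
proof -
  have "v2 * X v1 t \<le> v1 * X v2 t \<and> 0 < X v2 t"
  proof (cases "t = 0")
    case False
    then have t: "0 < t" using t by simp
    have pos: "0 < y v1 s" if "0 < s" "s \<le> t" for s
      using y_pos[OF v(1) _ that(1)] X that by simp
    have st: "y v1 t < y v2 t" "y v2 t * dy v1 t \<le> dy v2 t * y v1 t" "v2 * y v1 t \<le> v1 * y v2 t"
      by (rule sturm[OF v t pos]; assumption)+
    have y1: "0 < y v1 t" "0 < y v2 t" using pos[of t] st(1) t by auto
    have "P \<eta> (y v2 t) * y v1 t - P \<eta> (y v1 t) * y v2 t = y v1 t * y v2 t * (y v2 t - y v1 t) / 2"
      using y1 by (simp add: P_def algebra_simps)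
    moreover have "0 < y v1 t * y v2 t * (y v2 t - y v1 t) / 2" using y1 st(1) by simp
    ultimately have "X v1 t * y v2 t < X v2 t * y v1 t"
      using st(2) unfolding X_def distrib_right by (simp add: mult.commute)
    moreover have X0: "0 \<le> X v1 t" using X t by simp
    ultimately have "0 < X v2 t * y v1 t" using y1 by (smt (verit) mult_nonneg_nonneg)
    then have X2: "0 < X v2 t" using y1 by (simp add: zero_less_mult_iff)
    have "v2 * X v1 t * y v1 t \<le> v1 * y v2 t * X v1 t"
      using mult_right_mono[OF st(3) X0] by (simp add: mult_ac)
    also have "\<dots> \<le> v1 * (X v2 t * y v1 t)"
      using \<open>X v1 t * y v2 t < X v2 t * y v1 t\<close> v by (simp add: mult_ac)
    finally have "v2 * X v1 t \<le> v1 * X v2 t" using y1 by (simp add: mult.assoc[symmetric])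
    then show ?thesis using X2 by simp
  qed (use v in auto)
  then show "v2 * X v1 t \<le> v1 * X v2 t" "0 < X v2 t" by auto
  then show "X v1 t < X v2 t"
  proof -
    have "v1 * X v1 t \<le> v2 * X v1 t" using v X[of t] t by (intro mult_right_mono) auto
    moreover have "v1 * X v1 t < v1 * X v2 t"
    proof (cases "X v1 t = 0")
      case True then show ?thesis using v \<open>0 < X v2 t\<close> by simp
    next
      case False
      then have "v1 * X v1 t < v2 * X v1 t" using v X[of t] t by (intro mult_strict_right_mono) auto
      then show ?thesis using \<open>v2 * X v1 t \<le> v1 * X v2 t\<close> by linarith
    qed
    ultimately show ?thesis using v by simp
  qed
qed


section \<open>Turning points and the return time\<close>

lemma nondecreasing_y:
  assumes "0 \<le> a" "a \<le> b" and "\<And>s. a < s \<Longrightarrow> s < b \<Longrightarrow> 0 \<le> dy v s"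
  shows "y v a \<le> y v b"
  by (rule nondecreasing_on_interval[OF assms(2) y_cont y_deriv_at]) (use assms in auto)

text \<open>At a first zero of the velocity the acceleration cannot be positive, but the force is
  positive beyond the equilibrium.\<close>

lemma turning_le_y_crit:
  assumes s: "0 < s" "dy v s = 0" "\<And>r. 0 \<le> r \<Longrightarrow> r < s \<Longrightarrow> 0 < dy v r"
  shows "y v s \<le> y_crit \<eta>"
proof (rule ccontr)
  assume "\<not> ?thesis"
  then have "0 < f (y v s)" by (intro f_pos) simp
  moreover have "f (y v s) \<le> 0"
    by (rule zero_deriv_nonpos[OF dy_deriv_at[OF s(1)] s(2) s(1)]) (use s(3) in \<open>simp add: less_imp_le\<close>)
  ultimately show False by simp
qed

text \<open>Either the velocity is positive up to \<open>t\<close>, and then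
  \<open>X v t \<le> 1\<close> gives \<open>P \<le> 1\<close> and so
  \<open>y\<^sup>2 \<le> 2\<close> at the largest value of \<open>y\<close>; or the trajectory has
  turned, and its maximum is at most \<open>y_crit \<eta>\<close>. This confinement makes the
  truncation harmless for the points of the strip.\<close>

lemma y_le:
  assumes v: "0 < v" and X: "\<And>s. 0 \<le> s \<Longrightarrow> s \<le> t \<Longrightarrow> 0 \<le> X v s"
    and X1: "X v t \<le> 1" and s: "0 \<le> s" "s \<le> t"
  shows "0 \<le> y v s" "y v s \<le> sqrt 2"
proof -
  have pos: "0 < y v r" if "0 < r" "r \<le> t" for r
    using y_pos[OF v _ that(1)] X that by simp
  then show "0 \<le> y v s" using s by (cases "s = 0") (auto simp: less_imp_le)
  have t: "0 \<le> t" using s by simp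
  consider "\<And>r. 0 \<le> r \<Longrightarrow> r \<le> t \<Longrightarrow> 0 < dy v r" | r where "0 \<le> r" "r \<le> t" "dy v r \<le> 0"
    by fastforce
  then show "y v s \<le> sqrt 2"
  proof cases
    case 1
    have "y v s \<le> y v t"
      by (rule nondecreasing_y[OF s]) (use 1 s in \<open>simp add: less_imp_le\<close>)
    have yt: "0 \<le> y v t" using pos[of t] t by (cases "t = 0") (auto simp: less_imp_le)
    have "P \<eta> (y v t) \<le> 1" using X1 1[of t] t by (simp add: X_def)
    then have "(y v t)\<^sup>2 \<le> 2"
      using yt mult_nonneg_nonneg[OF eta(1) yt] unfolding P_def power2_eq_square by simp
    then have "y v t \<le> sqrt 2" by (rule real_le_rsqrt)
    then show ?thesis using \<open>y v s \<le> y v t\<close> by simp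
  next
    case (2 r)
    obtain u where u: "0 < u" "u \<le> r" "dy v u = 0" "\<And>q. 0 \<le> q \<Longrightarrow> q < u \<Longrightarrow> 0 < dy v q"
      using first_zero[of r "dy v"] 2 v dy_cont[of "{0..r}" v] by auto
    have le: "y v q \<le> y v u" if "0 \<le> q" "q \<le> u" for q
      by (rule nondecreasing_y[OF that]) (use u(4) that in \<open>simp add: less_imp_le\<close>)
    \<comment> \<open>By reflection \<open>y\<close> returns to 0 at time \<open>2 * u\<close>,
      which positivity excludes up to \<open>t\<close>. Every time after \<open>u\<close> is thus a
      mirror image of one before.\<close>
    have "t < 2 * u"
    proof (rule ccontr)
      assume "\<not> t < 2 * u"
      then have "0 < y v (u + u)" using pos[of "u + u"] u(1) by simp
      then show False using reflection(1)[of u v u] u by simp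
    qed
    have "y v s \<le> y v u"
    proof (cases "s \<le> u")
      case True then show ?thesis using le s by simp
    next
      case False
      then have "y v s = y v (2 * u - s)"
        using reflection(1)[of u v "s - u"] u \<open>t < 2 * u\<close> s by simp
      also have "\<dots> \<le> y v u" using False \<open>t < 2 * u\<close> s by (intro le) auto
      finally show ?thesis .
    qed
    also have "\<dots> \<le> y_crit \<eta>" by (rule turning_le_y_crit) (use u in auto)
    finally show ?thesis using y_crit(2) by simp
  qed
qed

text \<open>At energy at or above the critical level a zero of the velocity can only occur at the
  equilibrium, and backward uniqueness forbids arriving there in finite time.\<close>

lemma supercritical:
  assumes v: "v_crit \<eta> \<le> v" and t: "0 \<le> t"
  shows "0 < dy v t"
proof (rule ccontr)
  assume neg: "\<not> 0 < dy v t"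
  have v0: "0 < v" using v v_crit by simp
  obtain u where u: "0 < u" "u \<le> t" "dy v u = 0" "\<And>q. 0 \<le> q \<Longrightarrow> q < u \<Longrightarrow> 0 < dy v q"
    using first_zero[of t "dy v"] neg t v0 dy_cont[of "{0..t}" v] by auto
  have le: "y v u \<le> y_crit \<eta>" by (rule turning_le_y_crit) (use u in auto)
  have ge: "0 \<le> y v u"
    using nondecreasing_y[of 0 u v] u by (simp add: less_imp_le)
  have "\<bar>y v u\<bar> \<le> R" using le ge y_crit R by simp
  then have en: "G \<eta> (y v u) = - v\<^sup>2" using energy[of u v] u by simp
  have "(v_crit \<eta>)\<^sup>2 \<le> v\<^sup>2" using v v_crit(1) by (intro power_mono) auto
  then have "G \<eta> (y v u) \<le> G \<eta> (y_crit \<eta>)" using en v_crit(2) by simp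
  then have eq: "y v u = y_crit \<eta>"
    using G_strict_decreasing[of "y v u" "y_crit \<eta>"] le ge by fastforce
  have f0: "f (y_crit \<eta>) = 0" using f_force[of "y_crit \<eta>"] y_crit R force_y_crit by simp
  \<comment> \<open>The arguments \<open>u - u\<close> and \<open>u - 0\<close> are the two
    endpoints of the time-reversed trajectory, to which \<open>gronwall_pair\<close> is
    applied.\<close>
  have "(y v (u - u) - y_crit \<eta>)\<^sup>2 + (- dy v (u - u))\<^sup>2
      \<le> ((y v (u - 0) - y_crit \<eta>)\<^sup>2 + (- dy v (u - 0))\<^sup>2 + 0\<^sup>2 * u)
        * exp (((3/2) * R\<^sup>2 + 6 * \<eta> * R + 4 * \<eta>\<^sup>2 + 1 + 2) * u)"
  proof (rule gronwall_pair[where c = "\<lambda>q. f (y v (u - q))"])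
    fix q assume q: "q \<in> {0..u}"
    show "((\<lambda>r. y v (u - r) - y_crit \<eta>) has_real_derivative - dy v (u - q)) (at q within {0..u})"
      using DERIV_diff[OF y_deriv_backward(1) DERIV_const] q by simp
    show "((\<lambda>r. - dy v (u - r)) has_real_derivative f (y v (u - q))) (at q within {0..u})"
      using DERIV_minus[OF y_deriv_backward(2)] q by simp
    show "\<bar>f (y v (u - q))\<bar> \<le> ((3/2) * R\<^sup>2 + 6 * \<eta> * R + 4 * \<eta>\<^sup>2 + 1) * \<bar>y v (u - q) - y_crit \<eta>\<bar> + 0"
      using F_lip[of "y v (u - q)" "y_crit \<eta>"] f0 by simp
  qed (use u L_nonneg in auto)
  then have "(y v 0 - y_crit \<eta>)\<^sup>2 + (dy v 0)\<^sup>2 \<le> 0" using u eq by simp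
  then show False using v0 by (simp add: sum_power2_le_zero_iff)
qed

lemma supercritical_X_pos:
  assumes "v_crit \<eta> \<le> v" "0 \<le> t" shows "0 < X v t"
  using supercritical[OF assms] nondecreasing_y[of 0 t v] supercritical[OF assms(1)] assms(2) P_nonneg[of "y v t"]
  by (simp add: X_def less_imp_le add_nonneg_pos)

text \<open>Energy keeps \<open>y\<close> below the root \<open>m\<close> of
  \<open>G + v\<^sup>2\<close> while the velocity is positive. If it stayed positive forever,
  \<open>y\<close> would remain in a compact range where the force is bounded above by a negative
  constant, and the velocity would reach 0 after all.\<close>

lemma subcritical_turning:
  assumes v: "0 < v" "v < v_crit \<eta>"
  obtains s where "0 < s" "dy v s = 0" "\<And>r. 0 \<le> r \<Longrightarrow> r < s \<Longrightarrow> 0 < dy v r"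
    "v < y v s" "y v s < y_crit \<eta>" "G \<eta> (y v s) = - v\<^sup>2"
proof -
  have v2: "v\<^sup>2 < (v_crit \<eta>)\<^sup>2" using v by (intro power_strict_mono) auto
  have "\<exists>m. 0 \<le> m \<and> m \<le> y_crit \<eta> \<and> G \<eta> m = - v\<^sup>2"
    by (rule IVT2'[of "G \<eta>"])
       (use v2 v_crit y_crit(1) in \<open>auto simp: G_def intro!: continuous_at_imp_continuous_on DERIV_isCont[OF G_deriv[unfolded G_def]]\<close>)
  then obtain m where m: "0 \<le> m" "m \<le> y_crit \<eta>" "G \<eta> m = - v\<^sup>2" by blast
  have "m \<noteq> y_crit \<eta>" using m(3) v2 v_crit(2) by auto
  then have m': "m < y_crit \<eta>" using m by simp
  have "0 < m" using m v by (cases "m = 0") (auto simp: G_def)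
  \<comment> \<open>At the level \<open>v\<close> one has
    \<open>G \<eta> v + v\<^sup>2 = (P \<eta> v)\<^sup>2 > 0\<close>, so the root lies beyond it and
    the integral \<open>H\<close> has a genuine interval.\<close>
  have "v < m"
  proof (rule ccontr)
    assume "\<not> v < m"
    then have "G \<eta> v \<le> G \<eta> m"
      using G_strict_decreasing[of m v] v v_crit m by (cases "m = v") auto
    then have "(P \<eta> v)\<^sup>2 \<le> 0" using m(3) by (simp add: G_eq)
    then show False using P_pos[OF v(1)] by simp
  qed
  have not_m: "y v s \<noteq> m" if "0 \<le> s" "0 < dy v s" for s
  proof
    assume "y v s = m"
    then have "(dy v s)\<^sup>2 = 0" using energy[OF that(1), of v] m y_crit R by simp
    then show False using that by simp
  qed
  have bound: "y v s < m" if s: "0 \<le> s" and p: "\<And>r. 0 \<le> r \<Longrightarrow> r \<le> s \<Longrightarrow> 0 < dy v r" for s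
  proof (rule ccontr)
    assume "\<not> y v s < m"
    then obtain r where "0 \<le> r" "r \<le> s" "y v r = m"
      using IVT'[of "y v" 0 m s] \<open>0 < m\<close> s y_cont[of "{0..s}" v] by auto
    then show False using not_m[of r] p by auto
  qed
  have "\<exists>s\<ge>0. dy v s \<le> 0"
  proof (rule ccontr)
    assume "\<not> ?thesis"
    then have p: "0 < dy v s" if "0 \<le> s" for s using that by force
    have lt: "y v s < m" if "0 \<le> s" for s using bound[OF that] p by simp
    have y1: "y v 1 \<le> y v s" if "1 \<le> s" for s
      by (rule nondecreasing_y) (use that p in \<open>auto simp: less_imp_le\<close>)
    have "y v 0 < y v 1"
      by (rule DERIV_pos_imp_increasing_open[OF zero_less_one _ y_cont]) (use p y_deriv_at in \<open>auto intro!: exI\<close>)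
    then have "0 < y v 1" by simp
    \<comment> \<open>Starting at time 1 keeps \<open>y\<close> away from 0, where the force
      vanishes; this makes the maximum of the force strictly negative.\<close>
    have "\<exists>x\<in>{y v 1..m}. \<forall>z\<in>{y v 1..m}. f z \<le> f x"
      by (rule continuous_attains_sup) (use lt[of 1] in \<open>auto intro: F_cont\<close>)
    then obtain x where x: "x \<in> {y v 1..m}" "\<And>z. z \<in> {y v 1..m} \<Longrightarrow> f z \<le> f x" by blast
    have fx: "f x < 0"
      using force_neg[of x] f_force[of x] x(1) \<open>0 < y v 1\<close> m' y_crit R by simp
    \<comment> \<open>The time at which the linear upper bound of the velocity vanishes.\<close>
    define T where "T = 1 + dy v 1 / (- f x)"
    have T: "1 \<le> T" using fx p[of 1] by (simp add: T_def divide_nonneg_neg less_imp_le divide_nonpos_neg divide_le_0_iff)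
    have "- dy v 1 + f x * 1 \<le> - dy v T + f x * T"
    proof (rule nondecreasing_on_interval[OF T, where f = "\<lambda>s. - dy v s + f x * s"])
      show "continuous_on {1..T} (\<lambda>s. - dy v s + f x * s)"
        by (intro continuous_intros dy_cont) auto
      fix s assume s: "1 < s" "s < T"
      show "((\<lambda>s. - dy v s + f x * s) has_real_derivative - f (y v s) + f x * 1) (at s)"
        using s by (intro DERIV_add DERIV_minus dy_deriv_at DERIV_cmult DERIV_ident) auto
      show "0 \<le> - f (y v s) + f x * 1"
        using x(2)[of "y v s"] y1[of s] lt[of s] s by simp
    qed
    then have "dy v T \<le> dy v 1 + f x * (T - 1)" by (simp add: algebra_simps)
    also have "\<dots> = 0" using fx by (simp add: T_def)
    finally show False using p[of T] T by simp
  qed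
  then obtain r where "0 \<le> r" "dy v r \<le> 0" by blast
  then obtain s where s: "0 < s" "dy v s = 0" "\<And>q. 0 \<le> q \<Longrightarrow> q < s \<Longrightarrow> 0 < dy v q"
    using first_zero[of r "dy v"] v dy_cont[of "{0..r}" v] by auto
  have "y v s \<le> y_crit \<eta>" by (rule turning_le_y_crit) (use s in auto)
  moreover have "0 \<le> y v s" using nondecreasing_y[of 0 s v] s by (simp add: less_imp_le)
  moreover from calculation have "G \<eta> (y v s) = - v\<^sup>2" using energy[of s v] s y_crit R by simp
  ultimately have "y v s = m"
    using G_strict_decreasing[of m "y v s"] G_strict_decreasing[of "y v s" m] m by fastforce
  then show thesis using that s m m' \<open>v < m\<close> by auto
qed

text \<open>With turning time \<open>s\<close> and \<open>r\<close> the time at which the ascent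
  passes the level \<open>v\<close>, the substitution \<open>z = y v q\<close> yields
  \<open>T = s\<close> and \<open>H = s - r\<close>. By reflection the level \<open>v\<close> is met
  again at \<open>2 * s - r\<close>, where \<open>P\<close> equals minus the velocity.\<close>

lemma subcritical_T1:
  assumes v: "0 < v" "v < v_crit \<eta>"
  obtains \<tau> where "0 < \<tau>" "T1 \<eta> v = ereal \<tau>" "X v \<tau> = 0" "\<And>s. 0 \<le> s \<Longrightarrow> s < \<tau> \<Longrightarrow> 0 < X v s"
proof -
  obtain s where s: "0 < s" "dy v s = 0" "\<And>r. 0 \<le> r \<Longrightarrow> r < s \<Longrightarrow> 0 < dy v r"
    "v < y v s" "y v s < y_crit \<eta>" "G \<eta> (y v s) = - v\<^sup>2"
    using subcritical_turning[OF v] by blast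
  define m where "m = y v s"
  have mono: "y v a < y v b" if "0 \<le> a" "a < b" "b \<le> s" for a b
    by (rule DERIV_pos_imp_increasing_open[OF that(2) _ y_cont])
       (use s(3) that in \<open>auto intro!: exI[where P = "\<lambda>D. _ D \<and> 0 < D"] conjI y_deriv_at\<close>)
  obtain r where r: "0 \<le> r" "r \<le> s" "y v r = v"
    using IVT'[of "y v" 0 v s] v s y_cont[of "{0..s}" v] by auto
  have "r \<noteq> 0" "r \<noteq> s" using r(3) v s(4) y_0[of v] by (metis less_irrefl)+
  then have rs: "0 < r" "r < s" using r by auto
  have y_range: "0 < y v q" "y v q < m" if "0 < q" "q < s" for q
    using mono[of 0 q] mono[of q s] that by (auto simp: m_def)
  have en: "dy v q = sqrt (G \<eta> (y v q) + v\<^sup>2)" if "0 < q" "q < s" for q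
  proof -
    have "(dy v q)\<^sup>2 = G \<eta> (y v q) + v\<^sup>2"
      using energy[of q v] y_range[OF that] s(5) y_crit R that by (simp add: m_def)
    then show ?thesis using s(3)[of q] that by (simp add: real_sqrt_unique)
  qed
  have root: "y_root \<eta> v = m"
    unfolding y_root_def
  proof (rule Least_equality)
    show "0 < m \<and> G \<eta> m + v\<^sup>2 = 0" using s v by (simp add: m_def)
    fix z assume z: "0 < z \<and> G \<eta> z + v\<^sup>2 = 0"
    show "m \<le> z"
    proof (rule ccontr)
      assume "\<not> m \<le> z"
      then have "G \<eta> m < G \<eta> z" using z s(5) by (intro G_strict_decreasing) (auto simp: m_def)
      then show False using z s(6) by (simp add: m_def)
    qed
  qed
  \<comment> \<open>The integrand is singular at the upper limit, where \<open>G + v\<^sup>2\<close>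
    vanishes; after the substitution it is constantly 1. The cases \<open>a = 0\<close> and
    \<open>a = r\<close> give the two integrals.\<close>
  have subst: "(LBINT z=ereal (y v a)..ereal m. 1 / sqrt (G \<eta> z + v\<^sup>2)) = s - a"
    if a: "0 \<le> a" "a < s" for a
  proof -
    have one: "1 / sqrt (G \<eta> (y v q) + v\<^sup>2) * dy v q = 1" if "a < q" "q < s" for q
    proof -
      have "0 < q" using that a by simp
      then show ?thesis using en[of q] s(3)[of q] that by simp
    qed
    have ycont: "isCont (y v) q" if "0 < q" for q using y_deriv_at[OF that] by (rule DERIV_isCont)
    have "(LBINT z=ereal (y v a)..ereal m. 1 / sqrt (G \<eta> z + v\<^sup>2))
        = (LBINT q=ereal a..ereal s. 1 / sqrt (G \<eta> (y v q) + v\<^sup>2) * dy v q)"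
    proof (rule interval_integral_substitution_nonneg(2))
      show "ereal a < ereal s" using a by simp
      fix q assume q: "ereal a < ereal q" "ereal q < ereal s"
      then have q': "0 < q" "q < s" using a by auto
      show "(y v has_real_derivative dy v q) (at q)" by (rule y_deriv_at[OF q'(1)])
      have "0 < sqrt (G \<eta> (y v q) + v\<^sup>2)" using en[OF q'] s(3)[of q] q' by simp
      then show "isCont (\<lambda>z. 1 / sqrt (G \<eta> z + v\<^sup>2)) (y v q)"
        by (intro continuous_intros DERIV_isCont[OF G_deriv]) auto
      show "isCont (dy v) q" by (rule DERIV_isCont[OF dy_deriv_at[OF q'(1)]])
      show "0 \<le> 1 / sqrt (G \<eta> (y v q) + v\<^sup>2)" using en[OF q'] s(3)[of q] q' by simp
    next
      fix q assume "ereal a \<le> ereal q" "ereal q \<le> ereal s"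
      then show "0 \<le> dy v q" using s(2) s(3)[of q] a by (cases "q = s") (auto simp: less_imp_le)
    next
      have "(y v \<longlongrightarrow> y v a) (at_right a)"
        using y_cont[of "{0..}" v] a by (auto simp: continuous_on_def intro: tendsto_within_subset)
      then show "((ereal \<circ> y v \<circ> real_of_ereal) \<longlongrightarrow> ereal (y v a)) (at_right (ereal a))"
        by (simp add: ereal_tendsto_simps1 ereal_tendsto_simps2)
      have "(y v \<longlongrightarrow> m) (at_left s)"
        using ycont[OF s(1)] by (auto simp: isCont_def m_def intro: tendsto_within_subset)
      then show "((ereal \<circ> y v \<circ> real_of_ereal) \<longlongrightarrow> ereal m) (at_left (ereal s))"
        by (simp add: ereal_tendsto_simps1 ereal_tendsto_simps2)
    next
      have "set_integrable lborel {a<..<s} (\<lambda>q. 1 / sqrt (G \<eta> (y v q) + v\<^sup>2) * dy v q)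
          \<longleftrightarrow> set_integrable lborel {a<..<s} (\<lambda>q. 1 :: real)"
        by (rule set_integrable_cong[OF refl refl]) (simp only: one greaterThanLessThan_iff)
      moreover have "set_integrable lborel {a<..<s} (\<lambda>q. 1 :: real)"
        unfolding set_integrable_def by (use a in simp)
      ultimately show "set_integrable lborel (einterval (ereal a) (ereal s)) (\<lambda>q. 1 / sqrt (G \<eta> (y v q) + v\<^sup>2) * dy v q)"
        unfolding einterval_eq by blast
    qed
    also have "\<dots> = (LBINT q=ereal a..ereal s. 1)"
      by (rule interval_integral_cong, rule one) (use a in \<open>auto simp: min_def max_def\<close>)
    also have "\<dots> = s - a" using a by simp
    finally show ?thesis .
  qed
  have "T_int \<eta> v = s" using subst[of 0] s(1) by (simp add: T_int_def root zero_ereal_def)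
  moreover have "H_int \<eta> v = s - r" using subst[of r] rs r(3) by (simp add: H_int_def root)
  ultimately have T1: "T1 \<eta> v = ereal (2 * s - r)" using v by (simp add: T1_def)
  have before: "0 < X v q" if q: "0 \<le> q" "q \<le> s" for q
  proof (cases "q = s")
    case True
    then show ?thesis using s P_pos[of "y v s"] v by (simp add: X_def)
  next
    case False
    then show ?thesis
      using s(3)[of q] q mono[of 0 q] P_nonneg[of "y v q"] by (cases "q = 0") (auto simp: X_def v add_nonneg_pos)
  qed
  have P_dy: "(P \<eta> (y v q))\<^sup>2 - (dy v q)\<^sup>2 = (y v q)\<^sup>2 - v\<^sup>2" "0 < P \<eta> (y v q)" "0 < dy v q" if "0 < q" "q < s" for q
  proof -
    show "0 < P \<eta> (y v q)" "0 < dy v q" using P_pos y_range[OF that] s(3) that by auto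
    have "(dy v q)\<^sup>2 = G \<eta> (y v q) + v\<^sup>2"
      using energy[of q v] y_range[OF that] s(5) y_crit R that by (simp add: m_def)
    then show "(P \<eta> (y v q))\<^sup>2 - (dy v q)\<^sup>2 = (y v q)\<^sup>2 - v\<^sup>2" by (simp add: G_eq)
  qed
  \<comment> \<open>On the descent the velocity has the opposite sign, so the sign of
    \<open>X\<close> is that of \<open>P - y'\<close> at the mirrored time, hence that of
    \<open>y - v\<close> by the energy identity.\<close>
  have refl: "X v (2 * s - q) = P \<eta> (y v q) - dy v q" if "0 \<le> q" "q \<le> s" for q
    using reflection[of s v "s - q"] s that by (simp add: X_def)
  show thesis
  proof (rule that)
    show "0 < 2 * s - r" using rs by simp
    show "T1 \<eta> v = ereal (2 * s - r)" by (rule T1)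
    have "(P \<eta> (y v r))\<^sup>2 = (dy v r)\<^sup>2" using P_dy(1)[OF rs] r by simp
    then have "P \<eta> (y v r) = dy v r" using P_dy(2,3)[OF rs] by (simp add: power2_eq_iff)
    then show "X v (2 * s - r) = 0" using refl[of r] r by simp
    fix q assume q: "0 \<le> q" "q < 2 * s - r"
    show "0 < X v q"
    proof (cases "q \<le> s")
      case True then show ?thesis using before q by simp
    next
      case False
      define q' where "q' = 2 * s - q"
      have q': "r < q'" "q' < s" using False q by (auto simp: q'_def)
      then have "v < y v q'" using mono[of r q'] r by simp
      then have "v\<^sup>2 < (y v q')\<^sup>2" using v by (intro power_strict_mono) auto
      then have "(dy v q')\<^sup>2 < (P \<eta> (y v q'))\<^sup>2" using P_dy(1)[of q'] q' rs by simp
      then have "dy v q' < P \<eta> (y v q')"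
        by (rule power2_less_imp_less) (use P_dy(2)[of q'] q' rs in simp)
      then show ?thesis using refl[of q'] q' rs by (simp add: q'_def)
    qed
  qed
qed

text \<open>Trades the integrals in \<open>T1\<close> for a sign condition on the flow, which passes
  easily to limits and to neighbouring velocities.\<close>

lemma less_T1_iff:
  assumes v: "0 < v" and t: "0 \<le> t"
  shows "ereal t < T1 \<eta> v \<longleftrightarrow> (\<forall>s\<in>{0..t}. 0 < X v s)"
proof (cases "v < v_crit \<eta>")
  case True
  obtain \<tau> where \<tau>: "0 < \<tau>" "T1 \<eta> v = ereal \<tau>" "X v \<tau> = 0" "\<And>s. 0 \<le> s \<Longrightarrow> s < \<tau> \<Longrightarrow> 0 < X v s"
    using subcritical_T1[OF v True] by auto
  show ?thesis
  proof
    assume "ereal t < T1 \<eta> v"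
    then show "\<forall>s\<in>{0..t}. 0 < X v s" using \<tau> by auto
  next
    assume p: "\<forall>s\<in>{0..t}. 0 < X v s"
    show "ereal t < T1 \<eta> v"
    proof (rule ccontr)
      assume "\<not> ereal t < T1 \<eta> v"
      then have "\<tau> \<in> {0..t}" using \<tau> by simp
      then show False using p \<tau>(3) by force
    qed
  qed
next
  case False
  then show ?thesis using supercritical_X_pos[of v] v by (simp add: T1_def)
qed

section \<open>Solutions of the original equation\<close>

lemma ode_solution_on_flow:
  assumes "\<And>s. 0 \<le> s \<Longrightarrow> s \<le> t \<Longrightarrow> \<bar>y v s\<bar> \<le> R"
  shows "ode_solution_on \<eta> v t (y v)"
  unfolding ode_solution_on_def force_def[symmetric]
proof (intro conjI exI[of _ "dy v"] ballI)
  fix s assume s: "s \<in> {0..t}"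
  then show "(y v has_real_derivative dy v s) (at s within {0..t})"
    by (intro y_deriv') auto
  have "f (y v s) = force \<eta> (y v s)" using assms s by (intro f_force) auto
  then show "(dy v has_real_derivative force \<eta> (y v s)) (at s within {0..t})"
    using dy_deriv'[of s "{0..t}" v] s by auto
qed auto

lemma ode_solution_on_eq_flow:
  assumes "ode_solution_on \<eta> v t w" and "\<And>s. 0 \<le> s \<Longrightarrow> s \<le> t \<Longrightarrow> \<bar>w s\<bar> \<le> R"
    and "0 \<le> s" "s \<le> t"
  shows "w s = y v s"
proof -
  from assms(1) obtain w' where w: "w 0 = 0" "w' 0 = v"
    "\<And>s. s \<in> {0..t} \<Longrightarrow> (w has_real_derivative w' s) (at s within {0..t})"
    "\<And>s. s \<in> {0..t} \<Longrightarrow> (w' has_real_derivative force \<eta> (w s)) (at s within {0..t})"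
    by (auto simp: ode_solution_on_def force_def)
  show ?thesis
  proof (rule y_unique(1)[OF w(1,2,3)])
    show "(w' has_real_derivative f (w s)) (at s within {0..t})" if "s \<in> {0..t}" for s
      using w(4)[OF that] f_force[of "w s"] assms(2)[of s] that by simp
  qed (use assms in auto)
qed

lemma flow_agree:
  assumes "trunc \<eta> R'" and b: "\<And>s. 0 \<le> s \<Longrightarrow> s \<le> t \<Longrightarrow> \<bar>ode_flow.y (tforce \<eta> R') v s\<bar> \<le> min R R'"
    and s: "0 \<le> s" "s \<le> t"
  shows "ode_flow.y (tforce \<eta> R') v s = y v s" "ode_flow.dy (tforce \<eta> R') v s = dy v s"
proof -
  interpret r: trunc \<eta> R' by fact
  have *: "(r.dy v has_real_derivative f (r.y v u)) (at u within {0..t})" if "u \<in> {0..t}" for u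
    using r.dy_deriv'[of u "{0..t}" v] that r.f_force[of "r.y v u"] f_force[of "r.y v u"] b[of u] by simp
  show "r.y v s = y v s" "r.dy v s = dy v s"
    by (rule y_unique[OF r.y_0 r.dy_0 r.y_deriv' *]; use s in auto)+
qed

end

lemma ode_solution_on_bounded:
  assumes "ode_solution_on \<eta> v t w"
  obtains R where "2 \<le> R" "\<And>s. 0 \<le> s \<Longrightarrow> s \<le> t \<Longrightarrow> \<bar>w s\<bar> < R"
proof -
  have "continuous_on {0..t} w"
    using assms by (auto simp: ode_solution_on_def intro: DERIV_continuous_on)
  then have "bounded (w ` {0..t})"
    by (intro compact_imp_bounded compact_continuous_image) auto
  then obtain B where B: "\<forall>x\<in>w ` {0..t}. norm x \<le> B" unfolding bounded_iff by blast
  show thesis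
  proof (rule that[of "max 2 (B + 1)"])
    fix s assume "0 \<le> s" "s \<le> t"
    then have "\<bar>w s\<bar> \<le> B" using B by simp
    then show "\<bar>w s\<bar> < max 2 (B + 1)" by linarith
  qed simp
qed

text \<open>Two solutions on \<open>[0, t]\<close> are both trajectories of the flow truncated at
  the larger of their bounds, so they coincide and the description in \<open>y_sol\<close> is
  definite.\<close>

lemma y_sol_eq:
  assumes eta: "0 \<le> \<eta>" "\<eta> < 1/2" and w: "ode_solution_on \<eta> v t w" and t: "0 \<le> t"
  shows "y_sol \<eta> v t = w t"
  unfolding y_sol_def
proof (rule the_equality)
  show "\<exists>y. ode_solution_on \<eta> v t y \<and> y t = w t" using w by blast
  fix a assume "\<exists>y. ode_solution_on \<eta> v t y \<and> y t = a"
  then obtain u where u: "ode_solution_on \<eta> v t u" "u t = a" by blast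
  obtain R1 where R1: "2 \<le> R1" "\<And>s. 0 \<le> s \<Longrightarrow> s \<le> t \<Longrightarrow> \<bar>w s\<bar> < R1"
    using ode_solution_on_bounded[OF w] by blast
  obtain R2 where R2: "2 \<le> R2" "\<And>s. 0 \<le> s \<Longrightarrow> s \<le> t \<Longrightarrow> \<bar>u s\<bar> < R2"
    using ode_solution_on_bounded[OF u(1)] by blast
  interpret trunc \<eta> "max R1 R2" using eta R1 by unfold_locales auto
  have "w t = y v t"
    by (rule ode_solution_on_eq_flow[OF w]) (use R1(2) t in \<open>auto simp: le_max_iff_disj less_imp_le\<close>)
  moreover have "u t = y v t"
    by (rule ode_solution_on_eq_flow[OF u(1)]) (use R2(2) t in \<open>auto simp: le_max_iff_disj less_imp_le\<close>)
  ultimately show "a = w t" using u by simp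
qed

context trunc
begin

text \<open>The derivative in \<open>x_sol\<close> is taken within \<open>{0..}\<close> and sees
  times after \<open>t\<close>. A strict bound on \<open>[0, t]\<close> keeps the trajectory a
  solution of the original equation slightly longer.\<close>

lemma y_less_extend:
  assumes t: "0 \<le> t" and b: "\<And>s. 0 \<le> s \<Longrightarrow> s \<le> t \<Longrightarrow> \<bar>y v s\<bar> < R"
  obtains t' where "t < t'" "\<And>s. 0 \<le> s \<Longrightarrow> s \<le> t' \<Longrightarrow> \<bar>y v s\<bar> \<le> R"
proof -
  have "(y v \<longlongrightarrow> y v t) (at t within {0..})"
    using y_cont[of "{0..}" v] t by (auto simp: continuous_on_def)
  then obtain d where d: "0 < d" "\<And>s. 0 \<le> s \<Longrightarrow> dist s t < d \<Longrightarrow> s \<noteq> t \<Longrightarrow> dist (y v s) (y v t) < R - \<bar>y v t\<bar>"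
    using tendstoD[of "y v" "y v t" "at t within {0..}" "R - \<bar>y v t\<bar>"] b[of t] t
    by (auto simp: eventually_at)
  show thesis
  proof (rule that[of "t + d/2"])
    fix s assume s: "0 \<le> s" "s \<le> t + d/2"
    show "\<bar>y v s\<bar> \<le> R"
    proof (cases "s \<le> t")
      case True then show ?thesis using b[of s] s by simp
    next
      case False
      then have "dist (y v s) (y v t) < R - \<bar>y v t\<bar>"
        using d s by (auto simp: dist_real_def)
      then show ?thesis by (simp add: dist_real_def)
    qed
  qed (use d in simp)
qed

lemma sol_eq_flow:
  assumes t: "0 \<le> t" and b: "\<And>s. 0 \<le> s \<Longrightarrow> s \<le> t \<Longrightarrow> \<bar>y v s\<bar> < R"
  shows "finite_until \<eta> v t" "y_sol \<eta> v t = y v t" "x_sol \<eta> v t = X v t"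
proof -
  obtain t' where t': "t < t'" "\<And>s. 0 \<le> s \<Longrightarrow> s \<le> t' \<Longrightarrow> \<bar>y v s\<bar> \<le> R"
    using y_less_extend[OF t b] by blast
  have sol: "ode_solution_on \<eta> v s (y v)" if "s \<le> t'" for s
    by (rule ode_solution_on_flow) (use t' that in auto)
  show "finite_until \<eta> v t" unfolding finite_until_def using sol[of t] t'(1) by auto
  have ys: "y_sol \<eta> v s = y v s" if "0 \<le> s" "s \<le> t'" for s
    by (rule y_sol_eq[OF eta sol]) (use that in auto)
  then show yt: "y_sol \<eta> v t = y v t" using t t' by simp
  have "(y v has_vector_derivative dy v t) (at t within {0..})"
    using y_deriv[OF t] by (simp add: has_real_derivative_iff_has_vector_derivative)
  then have "(y_sol \<eta> v has_vector_derivative dy v t) (at t within {0..})"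
    by (rule has_vector_derivative_transform_within[where d = "t' - t"]) (use t' t ys in \<open>auto simp: dist_real_def\<close>)
  moreover have "at t within {0..} \<noteq> bot"
  proof (cases "t = 0")
    case True then show ?thesis by (simp add: at_within_Ici_at_right)
  qed (use t in \<open>simp add: at_within_pos\<close>)
  ultimately have "vector_derivative (y_sol \<eta> v) (at t within {0..}) = dy v t"
    by (metis vector_derivative_within)
  then show "x_sol \<eta> v t = X v t" by (simp add: x_sol_def yt X_def P_def)
qed

end

lemma finite_untilE:
  assumes eta: "0 \<le> \<eta>" "\<eta> < 1/2" and fin: "finite_until \<eta> v t"
  obtains R where "trunc \<eta> R" "\<And>s. 0 \<le> s \<Longrightarrow> s \<le> t \<Longrightarrow> \<bar>ode_flow.y (tforce \<eta> R) v s\<bar> < R"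
proof -
  obtain w where w: "ode_solution_on \<eta> v t w" using fin by (auto simp: finite_until_def)
  obtain R where R2: "2 \<le> R" and w_lt: "\<And>s. 0 \<le> s \<Longrightarrow> s \<le> t \<Longrightarrow> \<bar>w s\<bar> < R"
    using ode_solution_on_bounded[OF w] by blast
  interpret trunc \<eta> R using eta R2 by unfold_locales
  show thesis
  proof (rule that)
    fix s assume s: "0 \<le> s" "s \<le> t"
    have "w s = y v s"
      by (rule ode_solution_on_eq_flow[OF w]) (use w_lt s in \<open>auto simp: less_imp_le\<close>)
    then show "\<bar>y v s\<bar> < R" using w_lt[OF s] by simp
  qed unfold_locales
qed

section \<open>The initial velocity as a function of position and time\<close>

context trunc
begin

text \<open>Positivity is demanded on the whole of \<open>[0, t]\<close>, since the sign at time
  \<open>t\<close> alone would not exclude an earlier return.\<close>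

definition X_pos where "X_pos v t \<longleftrightarrow> (\<forall>s\<in>{0..t}. 0 < X v s)"

lemma X_posD: "X_pos v t \<Longrightarrow> 0 \<le> s \<Longrightarrow> s \<le> t \<Longrightarrow> 0 < X v s"
  by (simp add: X_pos_def)

lemma y_bounds:
  assumes "0 < v" "X_pos v t" "X v t \<le> 1" "0 \<le> s" "s \<le> t"
  shows "0 \<le> y v s" "y v s \<le> sqrt 2" "\<bar>y v s\<bar> < R"
proof -
  have *: "0 \<le> y v s \<and> y v s \<le> sqrt 2"
    using y_le[OF assms(1) _ assms(3-5)] X_posD[OF assms(2)] less_imp_le by auto
  moreover have "sqrt 2 < 2" by (rule real_less_lsqrt) auto
  ultimately show "0 \<le> y v s" "y v s \<le> sqrt 2" "\<bar>y v s\<bar> < R" using R by auto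
qed

text \<open>A finite solution comes with its own truncation level \<open>R'\<close>. At that level
  \<open>x \<le> 1\<close> confines the trajectory to \<open>[0, sqrt 2]\<close>, below every
  admissible level, so it is a trajectory for \<open>R\<close> too. Negative velocities are excluded
  by oddness of \<open>X\<close> and evenness of \<open>T1\<close>.\<close>

lemma v_of_cond_iff:
  assumes x: "0 < x" "x \<le> 1" and t: "0 \<le> t"
  shows "finite_until \<eta> v t \<and> x_sol \<eta> v t = x \<and> ereal t < T1 \<eta> v \<longleftrightarrow> 0 < v \<and> X_pos v t \<and> X v t = x"
proof
  assume r: "0 < v \<and> X_pos v t \<and> X v t = x"
  then have "\<bar>y v s\<bar> < R" if "0 \<le> s" "s \<le> t" for s
    using y_bounds(3)[of v t s] that x by simp
  from sol_eq_flow[OF t this] less_T1_iff[of v t] r t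
  show "finite_until \<eta> v t \<and> x_sol \<eta> v t = x \<and> ereal t < T1 \<eta> v"
    by (auto simp: X_pos_def)
next
  assume l: "finite_until \<eta> v t \<and> x_sol \<eta> v t = x \<and> ereal t < T1 \<eta> v"
  then obtain R' where R': "trunc \<eta> R'" and b: "\<And>s. 0 \<le> s \<Longrightarrow> s \<le> t \<Longrightarrow> \<bar>ode_flow.y (tforce \<eta> R') v s\<bar> < R'"
    using finite_untilE[OF eta] by blast
  interpret r: trunc \<eta> R' by (rule R')
  have rx: "r.X v t = x" using r.sol_eq_flow(3)[OF t b] l by simp
  have v: "0 < v"
  proof (rule ccontr)
    assume "\<not> 0 < v"
    moreover have "v \<noteq> 0" using rx x t by (auto simp: r.X_def P_def)
    ultimately have v: "0 < - v" by simp
    have "T1 \<eta> (- v) = T1 \<eta> v" by (simp add: T1_def)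
    then have "0 < r.X (- v) t" using r.less_T1_iff[OF v t] l t by auto
    then show False using r.X_minus[OF t, of v] rx x by simp
  qed
  have pos: "r.X_pos v t" using r.less_T1_iff[OF v t] l by (simp add: r.X_pos_def)
  have "\<bar>r.y v s\<bar> \<le> min R R'" if "0 \<le> s" "s \<le> t" for s
  proof -
    have "r.y v s \<le> sqrt 2" "0 \<le> r.y v s" using r.y_bounds[OF v pos _ that] rx x by auto
    moreover have "sqrt 2 < 2" by (rule real_less_lsqrt) auto
    ultimately show ?thesis using R r.R by simp
  qed
  from flow_agree[OF R' this] have "r.X v s = X v s" if "0 \<le> s" "s \<le> t" for s
    using that by (simp add: r.X_def X_def)
  then show "0 < v \<and> X_pos v t \<and> X v t = x"
    using pos v rx t by (simp add: r.X_pos_def X_pos_def)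
qed

lemma X_cont2: "continuous_on (UNIV \<times> {0..}) (\<lambda>(v, t). X v t)"
  using y_cont2 dy_cont2 unfolding X_def case_prod_unfold
  by (intro continuous_intros continuous_on_compose2[OF P_cont[of UNIV]]) auto

lemma X_cont_v: "0 \<le> t \<Longrightarrow> continuous_on A (\<lambda>v. X v t)"
  using continuous_on_compose2[OF X_cont2, of A "\<lambda>v. (v, t)"]
  by (simp add: continuous_on_Pair image_subset_iff)

lemma y_cont_v: "0 \<le> t \<Longrightarrow> continuous_on A (\<lambda>v. y v t)"
  using continuous_on_compose2[OF y_cont2, of A "\<lambda>v. (v, t)"]
  by (simp add: continuous_on_Pair image_subset_iff)

lemma X_pos_open:
  assumes "X_pos v t" "0 \<le> t"
  obtains d where "0 < d" "\<And>w t'. \<bar>w - v\<bar> < d \<Longrightarrow> \<bar>t' - t\<bar> < d \<Longrightarrow> X_pos w t'"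
proof -
  have "\<exists>s\<in>{0..t}. \<forall>r\<in>{0..t}. X v s \<le> X v r"
    by (rule continuous_attains_inf) (use assms X_cont in auto)
  then obtain s where s: "s \<in> {0..t}" "\<And>r. r \<in> {0..t} \<Longrightarrow> X v s \<le> X v r" by blast
  have m: "0 < X v s" using s(1) assms(1) by (simp add: X_pos_def)
  have "uniformly_continuous_on ({v-1..v+1} \<times> {0..t+1}) (\<lambda>(v, t). X v t)"
    by (rule compact_uniformly_continuous[OF continuous_on_subset[OF X_cont2]]) (auto intro: compact_Times)
  then obtain e where e: "0 < e" "\<And>w r u. w \<in> {v-1..v+1} \<Longrightarrow> r \<in> {0..t+1} \<Longrightarrow> u \<in> {0..t+1} \<Longrightarrow>
      dist (w, r) (v, u) < e \<Longrightarrow> dist (X w r) (X v u) < X v s"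
    using uniformly_continuous_onE[OF _ m] by (smt (verit) SigmaI atLeastAtMost_iff case_prod_conv)
  define d where "d = min 1 (e / 2)"
  show thesis
  proof (rule that[of d])
    show "0 < d" using e by (simp add: d_def)
    fix w t' assume w: "\<bar>w - v\<bar> < d" "\<bar>t' - t\<bar> < d"
    show "X_pos w t'"
      unfolding X_pos_def
    proof
      fix r assume r: "r \<in> {0..t'}"
      \<comment> \<open>Times slightly beyond \<open>t\<close> are compared with \<open>t\<close>
        itself, where the minimum of \<open>X v\<close> over \<open>[0, t]\<close> is a lower
        bound.\<close>
      define u where "u = min r t"
      have "dist (w, r) (v, u) \<le> \<bar>w - v\<bar> + \<bar>r - u\<bar>"
        unfolding dist_Pair_Pair dist_real_def using sqrt_sum_squares_le_sum_abs[of "w - v" "r - u"] by simp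
      also have "\<bar>r - u\<bar> \<le> \<bar>t' - t\<bar>" using r by (auto simp: u_def min_def)
      also have "\<bar>w - v\<bar> + \<bar>t' - t\<bar> < e" using w by (simp add: d_def)
      finally have "dist (X w r) (X v u) < X v s"
        using w r assms(2) by (intro e(2)) (auto simp: d_def u_def)
      moreover have "X v s \<le> X v u" using s(2)[of u] r assms(2) by (simp add: u_def)
      ultimately show "0 < X w r" by (simp add: dist_real_def)
    qed
  qed
qed

lemma X_pos_mono: "X_pos v t \<Longrightarrow> 0 < v \<Longrightarrow> v \<le> w \<Longrightarrow> X_pos w t"
proof (cases "v = w")
  case False
  assume a: "X_pos v t" "0 < v" "v \<le> w"
  show ?thesis unfolding X_pos_def
  proof
    fix s assume s: "s \<in> {0..t}"
    show "0 < X w s" by (rule X_compare(2)[of v]) (use a False s X_posD[OF a(1)] in \<open>auto simp: less_imp_le\<close>)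
  qed
qed simp

lemma X_strict_mono: "X_pos v t \<Longrightarrow> 0 < v \<Longrightarrow> v < w \<Longrightarrow> 0 \<le> t \<Longrightarrow> X v t < X w t"
  by (rule X_compare(3)) (auto simp: X_posD less_imp_le)

lemma X_deriv_t:
  assumes "0 \<le> t" shows "(X v has_real_derivative (\<bar>y v t\<bar> + 2 * \<eta>) * dy v t + f (y v t)) (at t within {0..})"
  unfolding X_def[abs_def]
  by (intro DERIV_add dy_deriv[OF assms] DERIV_chain2[OF P_deriv y_deriv[OF assms]])

text \<open>The threshold of the velocities whose characteristics are still alive: it is 0 before
  the onset, and afterwards it is the velocity whose characteristic returns exactly at time
  \<open>t\<close>.\<close>

definition v_low where "v_low t = Inf {v. 0 < v \<and> X_pos v t}"

lemma X_pos_v_crit: "X_pos (v_crit \<eta>) t"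
  by (auto simp: X_pos_def intro: supercritical_X_pos)

lemma v_low_nonneg: "0 \<le> v_low t"
  unfolding v_low_def using X_pos_v_crit v_crit by (intro cInf_greatest) auto

lemma v_low_less: "v_low t < v \<Longrightarrow> 0 < v \<and> X_pos v t"
proof -
  assume "v_low t < v"
  moreover have "bdd_below {v. 0 < v \<and> X_pos v t}" by (intro bdd_belowI[of _ 0]) auto
  ultimately obtain w where "0 < w" "X_pos w t" "w < v"
    unfolding v_low_def using X_pos_v_crit v_crit by (subst (asm) cInf_less_iff) auto
  then show ?thesis using X_pos_mono[of w t v] by auto
qed

lemma v_low_le: "0 < v \<Longrightarrow> X_pos v t \<Longrightarrow> v_low t \<le> v"
  unfolding v_low_def by (intro cInf_lower bdd_belowI[of _ 0]) auto

lemma v_low_not_X_pos: "0 < v_low t \<Longrightarrow> 0 \<le> t \<Longrightarrow> \<not> X_pos (v_low t) t"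
proof
  assume a: "0 < v_low t" "0 \<le> t" "X_pos (v_low t) t"
  obtain d where d: "0 < d" "\<And>w t'. \<bar>w - v_low t\<bar> < d \<Longrightarrow> \<bar>t' - t\<bar> < d \<Longrightarrow> X_pos w t'"
    using X_pos_open[OF a(3,2)] by blast
  define w where "w = v_low t - min (d/2) (v_low t/2)"
  have "0 < w" "w < v_low t" "X_pos w t" using d a by (auto simp: w_def intro!: d(2))
  then show False using v_low_le[of w t] by simp
qed

lemma X_v_low_nonneg: "0 \<le> s \<Longrightarrow> s \<le> t \<Longrightarrow> 0 \<le> X (v_low t) s"
proof (rule tendsto_lowerbound)
  assume s: "0 \<le> s" "s \<le> t"
  show "((\<lambda>v. X v s) \<longlongrightarrow> X (v_low t) s) (at_right (v_low t))"
    using X_cont_v[OF s(1), of UNIV] by (auto simp: continuous_on_def intro: tendsto_within_subset)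
  show "\<forall>\<^sub>F v in at_right (v_low t). 0 \<le> X v s"
    using eventually_at_right_less[of "v_low t"]
    by eventually_elim (use v_low_less X_posD s less_imp_le in blast)
qed auto

text \<open>As a limit of positive functions, \<open>X (v_low t)\<close> is nonnegative on
  \<open>[0, t]\<close>, and it has a zero there when \<open>v_low t\<close> is positive. A zero
  before \<open>t\<close> would be an interior minimum, but the derivative there is
  \<open>- y < 0\<close>.\<close>

lemma X_v_low: "0 \<le> t \<Longrightarrow> X (v_low t) t = 0"
proof (cases "v_low t = 0")
  case True
  then show "0 \<le> t \<Longrightarrow> X (v_low t) t = 0" by (simp add: X_def P_def)
next
  case False
  assume t: "0 \<le> t"
  let ?v = "v_low t"
  have v: "0 < ?v" using False v_low_nonneg[of t] by simp
  obtain s where s: "0 \<le> s" "s \<le> t" "X ?v s \<le> 0"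
    using v_low_not_X_pos[OF v t] by (auto simp: X_pos_def not_less)
  then have Xs: "X ?v s = 0" using X_v_low_nonneg[of s t] by simp
  have "s \<noteq> 0" using Xs v by auto
  then have s0: "0 < s" using s by simp
  have "s = t"
  proof (rule ccontr)
    assume "s \<noteq> t"
    then have "s < t" using s by simp
    have yb: "0 \<le> y ?v s" "y ?v s \<le> sqrt 2"
      using y_le[OF v X_v_low_nonneg, of s s] Xs s by auto
    have "sqrt 2 < 2" by (rule real_less_lsqrt) auto
    then have "f (y ?v s) = force \<eta> (y ?v s)" using yb R by (intro f_force) simp
    then have "(X ?v has_real_derivative (\<bar>y ?v s\<bar> + 2 * \<eta>) * X ?v s - y ?v s) (at s)"
      using X_deriv_t[OF s(1), of ?v] s0
      by (simp add: at_within_pos force_eq X_def) (simp add: algebra_simps)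
    then have "(\<bar>y ?v s\<bar> + 2 * \<eta>) * X ?v s - y ?v s = 0"
    proof (rule DERIV_local_min[where d = "min s (t - s)"])
      show "0 < min s (t - s)" using s0 \<open>s < t\<close> by simp
      show "\<forall>r. \<bar>s - r\<bar> < min s (t - s) \<longrightarrow> X ?v s \<le> X ?v r"
        using X_v_low_nonneg Xs by auto
    qed
    moreover have "0 < y ?v s" by (rule y_pos[OF v _ s0]) (use X_v_low_nonneg s in auto)
    ultimately show False using Xs by simp
  qed
  then show ?thesis using Xs by simp
qed

lemma exists_v:
  assumes x: "0 < x" and t: "0 \<le> t"
  shows "\<exists>!v. 0 < v \<and> X_pos v t \<and> X v t = x"
proof (rule ex_ex1I)
  have "((\<lambda>v. X v t) \<longlongrightarrow> X (v_low t) t) (at_right (v_low t))"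
    using X_cont_v[OF t, of UNIV] by (auto simp: continuous_on_def intro: tendsto_within_subset)
  then have "\<forall>\<^sub>F v in at_right (v_low t). X v t < x"
    using X_v_low[OF t] x by (intro order_tendstoD(2)[of _ 0]) auto
  then have "\<forall>\<^sub>F v in at_right (v_low t). X v t < x \<and> v_low t < v"
    using eventually_at_right_less by (rule eventually_conj)
  then obtain v where v: "X v t < x" "v_low t < v"
    by (metis (mono_tags, lifting) eventually_happens' trivial_limit_at_right_real)
  have v': "0 < v" "X_pos v t" using v_low_less[OF v(2)] by auto
  have X: "0 < X v t" using v'(2) t by (simp add: X_pos_def)
  \<comment> \<open>The ratio bound of \<open>X_compare\<close> shows that this velocity carries the
    characteristic at least as far as \<open>x\<close>.\<close>
  define w where "w = v * (x / X v t)"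
  have w: "v < w" using v' v X by (simp add: w_def divide_simps)
  have "w * X v t \<le> v * X w t"
    by (rule X_compare(1)[OF v'(1) w]) (use X_posD[OF v'(2)] t in \<open>auto simp: less_imp_le\<close>)
  then have "x \<le> X w t" using v' X by (simp add: w_def)
  then obtain u where u: "v \<le> u" "u \<le> w" "X u t = x"
    using IVT'[of "\<lambda>v. X v t" v x w] v w X_cont_v[OF t] by auto
  then show "\<exists>v. 0 < v \<and> X_pos v t \<and> X v t = x"
    using X_pos_mono[OF v'(2,1) u(1)] v' u by (intro exI[of _ u]) simp
  fix v1 v2 assume a: "0 < v1 \<and> X_pos v1 t \<and> X v1 t = x" "0 < v2 \<and> X_pos v2 t \<and> X v2 t = x"
  show "v1 = v2"
    using X_strict_mono[of v1 t v2] X_strict_mono[of v2 t v1] a t by (cases v1 v2 rule: linorder_cases) auto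
qed

abbreviation "V \<equiv> v_of \<eta>"

abbreviation "Y \<equiv> Y_fun \<eta>"

lemma v_of_0 [simp]: "V 0 t = 0"
  by (simp add: v_of_def)

lemma v_of:
  assumes x: "0 < x" "x \<le> 1" and t: "0 \<le> t"
  shows "0 < V x t" "X_pos (V x t) t" "X (V x t) t = x"
proof -
  have "V x t = (THE v. 0 < v \<and> X_pos v t \<and> X v t = x)"
    using x by (simp add: v_of_def v_of_cond_iff[OF x t])
  then show "0 < V x t" "X_pos (V x t) t" "X (V x t) t = x"
    using theI'[OF exists_v[OF x(1) t]] by auto
qed

lemma v_of_unique:
  assumes "0 < x" "x \<le> 1" "0 \<le> t" "0 < v" "X_pos v t" "X v t = x"
  shows "V x t = v"
  using v_of[OF assms(1-3)] exists_v[OF assms(1,3)] assms by blast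

lemma x_sol_minus:
  assumes t: "0 \<le> t" and fin: "finite_until \<eta> v t"
  shows "finite_until \<eta> (- v) t" "x_sol \<eta> (- v) t = - x_sol \<eta> v t" "y_sol \<eta> (- v) t = - y_sol \<eta> v t"
proof -
  obtain R' where R': "trunc \<eta> R'" and b: "\<And>s. 0 \<le> s \<Longrightarrow> s \<le> t \<Longrightarrow> \<bar>ode_flow.y (tforce \<eta> R') v s\<bar> < R'"
    using finite_untilE[OF eta fin] by blast
  interpret r: trunc \<eta> R' by (rule R')
  have b': "\<bar>r.y (- v) s\<bar> < R'" if "0 \<le> s" "s \<le> t" for s
    using b[OF that] r.y_minus[OF that(1)] by simp
  show "finite_until \<eta> (- v) t" "x_sol \<eta> (- v) t = - x_sol \<eta> v t" "y_sol \<eta> (- v) t = - y_sol \<eta> v t"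
    using r.sol_eq_flow[OF t b] r.sol_eq_flow[OF t b'] r.X_minus[OF t] r.y_minus[OF t] by auto
qed

lemma v_of_minus:
  assumes t: "0 \<le> t" and x: "0 < x" "x \<le> 1"
  shows "V (- x) t = - V x t"
proof -
  have "finite_until \<eta> v t \<and> x_sol \<eta> v t = - x \<and> ereal t < T1 \<eta> v
      \<longleftrightarrow> finite_until \<eta> (- v) t \<and> x_sol \<eta> (- v) t = x \<and> ereal t < T1 \<eta> (- v)" for v
    using x_sol_minus[OF t, of v] x_sol_minus[OF t, of "- v"] by (auto simp: T1_def)
  then have "V (- x) t = (THE v. 0 < - v \<and> X_pos (- v) t \<and> X (- v) t = x)"
    using x by (simp add: v_of_def v_of_cond_iff[OF x t])
  also have "\<dots> = - V x t"
  proof (rule the_equality)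
    show "0 < - (- V x t) \<and> X_pos (- (- V x t)) t \<and> X (- (- V x t)) t = x"
      using v_of[OF x t] by simp
    show "v = - V x t" if "0 < - v \<and> X_pos (- v) t \<and> X (- v) t = x" for v
      using v_of_unique[OF x t, of "- v"] that by simp
  qed
  finally show ?thesis .
qed

lemma Y_fun_eq:
  assumes x: "\<bar>x\<bar> \<le> 1" and t: "0 \<le> t"
  shows "Y x t = y (V x t) t"
proof -
  have pos: "Y x t = y (V x t) t \<and> finite_until \<eta> (V x t) t" if "0 < x" "x \<le> 1" for x
  proof -
    have "\<bar>y (V x t) s\<bar> < R" if "0 \<le> s" "s \<le> t" for s
      using y_bounds(3)[OF v_of(1,2)[OF \<open>0 < x\<close> \<open>x \<le> 1\<close> t] _ that] v_of(3)[OF \<open>0 < x\<close> \<open>x \<le> 1\<close> t] \<open>x \<le> 1\<close> by simp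
    from sol_eq_flow[OF t this] show ?thesis by (simp add: Y_fun_def)
  qed
  consider "0 < x" | "x = 0" | "0 < - x" by linarith
  then show ?thesis
  proof cases
    case 1 then show ?thesis using pos x by auto
  next
    case 2
    then show ?thesis using sol_eq_flow(2)[OF t, of 0] t R by (simp add: Y_fun_def)
  next
    case 3
    then have "Y (- (- x)) t = y_sol \<eta> (- V (- x) t) t"
      using v_of_minus[OF t 3] x by (simp add: Y_fun_def)
    also have "\<dots> = - Y (- x) t"
      using x_sol_minus(3)[OF t] pos[OF 3] x by (simp add: Y_fun_def)
    also have "\<dots> = y (V (- (- x)) t) t"
      using pos[OF 3] x v_of_minus[OF t 3] y_minus[OF t] by simp
    finally show ?thesis by simp
  qed
qed

lemma v_of_odd: "\<bar>x\<bar> \<le> 1 \<Longrightarrow> 0 \<le> t \<Longrightarrow> V (- x) t = - V x t"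
  using v_of_minus[of t x] v_of_minus[of t "- x"] by (cases x "0 :: real" rule: linorder_cases) auto

lemma Y_fun_odd: "\<bar>x\<bar> \<le> 1 \<Longrightarrow> 0 \<le> t \<Longrightarrow> Y (- x) t = - Y x t"
  using v_of_odd[of x t] by (simp add: Y_fun_eq y_minus)

lemma Y_fun_bounds: "0 \<le> x \<Longrightarrow> x \<le> 1 \<Longrightarrow> 0 \<le> t \<Longrightarrow> 0 \<le> Y x t"
  "0 \<le> x \<Longrightarrow> x \<le> 1 \<Longrightarrow> 0 \<le> t \<Longrightarrow> Y x t \<le> sqrt 2"
proof -
  assume x: "0 \<le> x" "x \<le> 1" and t: "0 \<le> t"
  have "0 \<le> Y x t \<and> Y x t \<le> sqrt 2"
    using v_of[of x t] y_bounds[of "V x t" t t] x t by (cases "x = 0") (auto simp: Y_fun_eq)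
  then show "0 \<le> Y x t" "Y x t \<le> sqrt 2" by auto
qed

lemma Y_fun_0: "\<bar>x\<bar> \<le> 1 \<Longrightarrow> Y x 0 = 0"
  by (simp add: Y_fun_eq)

lemma Y_fun_at_0: "0 \<le> t \<Longrightarrow> Y 0 t = 0"
  by (simp add: Y_fun_eq)

section \<open>The onset of the shock\<close>

text \<open>If the faster characteristic returned first, the slower one would still be positive at
  that moment, and by comparison so would the faster one.\<close>

lemma T1_mono: "0 < v \<Longrightarrow> v \<le> w \<Longrightarrow> T1 \<eta> v \<le> T1 \<eta> w"
proof (rule ccontr)
  assume v: "0 < v" "v \<le> w" and "\<not> T1 \<eta> v \<le> T1 \<eta> w"
  then have lt: "T1 \<eta> w < T1 \<eta> v" by simp
  then have "w < v_crit \<eta>" using v by (auto simp: T1_def split: if_splits)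
  then obtain \<tau> where \<tau>: "0 < \<tau>" "T1 \<eta> w = ereal \<tau>" "X w \<tau> = 0"
    using subcritical_T1[of w] v by auto
  then have "X_pos v \<tau>" using less_T1_iff[of v \<tau>] lt v by (simp add: X_pos_def)
  then have "X_pos w \<tau>" using X_pos_mono v by blast
  then show False using X_posD[of w \<tau> \<tau>] \<tau> by simp
qed

text \<open>Monotonicity turns the one-sided limit into an infimum, which avoids any asymptotics of
  the integrals near \<open>v = 0\<close>.\<close>

lemma T1_0plus_eq: "T1_0plus \<eta> = (INF v\<in>{0<..}. T1 \<eta> v)"
proof -
  let ?I = "INF v\<in>{0<..}. T1 \<eta> v"
  have "(T1 \<eta> \<longlongrightarrow> ?I) (at_right 0)"
  proof (rule order_tendstoI)
    fix a assume "a < ?I"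
    then have "a < T1 \<eta> v" if "0 < v" for v
      using that by (meson INF_lower greaterThan_iff less_le_trans)
    then show "\<forall>\<^sub>F v in at_right 0. a < T1 \<eta> v"
      using eventually_at_right_less by (rule eventually_mono[rotated])
  next
    fix a assume "?I < a"
    then obtain v where v: "0 < v" "T1 \<eta> v < a" by (auto simp: INF_less_iff)
    have "\<forall>\<^sub>F w in at_right 0. w \<in> {0<..<v}" using v by (intro eventually_at_right_real)
    then show "\<forall>\<^sub>F w in at_right 0. T1 \<eta> w < a"
    proof eventually_elim
      case (elim w)
      then have "T1 \<eta> w \<le> T1 \<eta> v" by (intro T1_mono) auto
      then show ?case using v(2) by (rule le_less_trans)
    qed
  qed
  then show ?thesis unfolding T1_0plus_def by (intro tendsto_Lim) auto
qed

lemma before_shock: "ereal t < T1_0plus \<eta> \<Longrightarrow> 0 \<le> t \<Longrightarrow> 0 < v \<Longrightarrow> X_pos v t"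
  using less_T1_iff[of v t] INF_lower[of v "{0<..}" "T1 \<eta>"]
  by (auto simp: T1_0plus_eq X_pos_def dest: less_le_trans)

lemma after_shock:
  assumes "T1_0plus \<eta> < ereal t" "0 \<le> t"
  shows "0 < v_low t"
proof -
  obtain v where v: "0 < v" "T1 \<eta> v < ereal t" using assms by (auto simp: T1_0plus_eq INF_less_iff)
  then have "\<not> X_pos v t" using less_T1_iff[of v t] assms by (auto simp: X_pos_def)
  then have "\<not> v_low t < v" using v_low_less by blast
  then show ?thesis using v by simp
qed

end

section \<open>The classical solution\<close>

text \<open>The domain includes boundary points such as \<open>t = 0\<close> and
  \<open>x = 1\<close>, so the derivatives are relative to sets that need not be open. The implicit
  function and its continuity come from monotonicity in \<open>v\<close>; only its differentiability
  is left to prove.\<close>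

lemma has_derivative_implicit:
  fixes \<Phi> V :: "real \<times> real \<Rightarrow> real"
  assumes d: "(\<Phi> has_derivative (\<lambda>(h, s). a * h + b * s)) (at (V p, snd p) within U)"
    and a: "a \<noteq> 0" and p: "p \<in> D"
    and eq: "\<And>q. q \<in> D \<Longrightarrow> \<Phi> (V q, snd q) = fst q" and U: "\<And>q. q \<in> D \<Longrightarrow> (V q, snd q) \<in> U"
    and V: "(V \<longlongrightarrow> V p) (at p within D)"
  shows "(V has_derivative (\<lambda>(h, s). (h - b * s) / a)) (at p within D)"
  unfolding has_derivative_within_alt
proof (intro conjI allI impI)
  show "bounded_linear (\<lambda>(h, s). (h - b * s) / a)"
    unfolding case_prod_unfold
    by (intro bounded_linear_compose[OF bounded_linear_divide] bounded_linear_sub bounded_linear_fst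
        bounded_linear_const_mult bounded_linear_snd)
  fix e :: real assume e: "0 < e"
  define C where "C = 2 * (1 + \<bar>b\<bar> + \<bar>a\<bar>) / \<bar>a\<bar>"
  have C: "0 < C" using a by (simp add: C_def add_pos_nonneg)
  \<comment> \<open>The bound \<open>\<bar>a\<bar> / 2\<close> allows the increment of
    \<open>V\<close> to be absorbed into the left-hand side; the other bound makes the final error
    at most \<open>e\<close>.\<close>
  define k where "k = min (\<bar>a\<bar> / 2) (e * \<bar>a\<bar> / (C + 1))"
  have k: "0 < k" "k \<le> \<bar>a\<bar> / 2" "k * (C + 1) \<le> e * \<bar>a\<bar>"
  proof -
    show "0 < k" using e a C by (simp add: k_def)
    show "k \<le> \<bar>a\<bar> / 2" unfolding k_def by (rule min.cobounded1)
    have "k \<le> e * \<bar>a\<bar> / (C + 1)" unfolding k_def by (rule min.cobounded2)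
    then show "k * (C + 1) \<le> e * \<bar>a\<bar>" using C by (simp add: pos_le_divide_eq)
  qed
  obtain d1 where d1: "0 < d1" "\<And>q. q \<in> U \<Longrightarrow> norm (q - (V p, snd p)) < d1 \<Longrightarrow>
      norm (\<Phi> q - \<Phi> (V p, snd p) - (\<lambda>(h, s). a * h + b * s) (q - (V p, snd p))) \<le> k * norm (q - (V p, snd p))"
    using d k(1) unfolding has_derivative_within_alt by blast
  have "((\<lambda>q. (V q, snd q)) \<longlongrightarrow> (V p, snd p)) (at p within D)"
    by (intro tendsto_Pair V tendsto_snd tendsto_ident_at)
  from tendstoD[OF this d1(1)] obtain d2 where d2: "0 < d2" "\<And>q. q \<in> D \<Longrightarrow> q \<noteq> p \<Longrightarrow> dist q p < d2 \<Longrightarrow> dist (V q, snd q) (V p, snd p) < d1"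
    unfolding eventually_at by blast
  show "\<exists>d>0. \<forall>q\<in>D. norm (q - p) < d \<longrightarrow>
      norm (V q - V p - (\<lambda>(h, s). (h - b * s) / a) (q - p)) \<le> e * norm (q - p)"
  proof (intro exI[of _ d2] conjI d2(1) ballI impI)
    fix q assume q: "q \<in> D" "norm (q - p) < d2"
    define u s h where "u = V q - V p" and "s = snd q - snd p" and "h = fst q - fst p"
    define r where "r = h - (a * u + b * s)"
    have "norm ((V q, snd q) - (V p, snd p)) < d1"
      using d2(2)[of q] q d1(1) by (cases "q = p") (auto simp: dist_norm)
    then have "\<bar>r\<bar> \<le> k * norm (u, s)"
      using d1(2)[OF U[OF q(1)]] eq[OF q(1)] eq[OF p] by (simp add: r_def h_def u_def s_def)
    also have "\<dots> \<le> k * (\<bar>u\<bar> + \<bar>s\<bar>)"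
      using k norm_Pair_le[of u s] by (intro mult_left_mono) auto
    finally have r: "\<bar>r\<bar> \<le> k * (\<bar>u\<bar> + \<bar>s\<bar>)" .
    define N where "N = norm (q - p)"
    have N: "\<bar>h\<bar> \<le> N" "\<bar>s\<bar> \<le> N"
    proof -
      have "q - p = (h, s)" by (simp add: prod_eq_iff h_def s_def)
      then show "\<bar>h\<bar> \<le> N" "\<bar>s\<bar> \<le> N"
        using norm_fst_le[of h s] norm_snd_le[of s h] by (simp_all add: N_def)
    qed
    have "a * u = h - b * s - r" by (simp add: r_def)
    then have "\<bar>a\<bar> * \<bar>u\<bar> \<le> \<bar>h\<bar> + \<bar>b\<bar> * \<bar>s\<bar> + \<bar>r\<bar>"
      by (metis abs_mult abs_triangle_ineq4 add_right_mono order.trans)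
    also have "\<dots> \<le> N + \<bar>b\<bar> * N + (\<bar>a\<bar> / 2) * (\<bar>u\<bar> + N)"
    proof (intro add_mono mult_left_mono N)
      have "k * (\<bar>u\<bar> + \<bar>s\<bar>) \<le> (\<bar>a\<bar> / 2) * (\<bar>u\<bar> + N)"
        using k N by (intro mult_mono) auto
      then show "\<bar>r\<bar> \<le> (\<bar>a\<bar> / 2) * (\<bar>u\<bar> + N)" using r by simp
    qed simp
    finally have "\<bar>a\<bar> * \<bar>u\<bar> \<le> 2 * (1 + \<bar>b\<bar> + \<bar>a\<bar>/2) * N" by (simp add: field_simps)
    also have "\<dots> \<le> 2 * (1 + \<bar>b\<bar> + \<bar>a\<bar>) * N" by (intro mult_right_mono) (auto simp: N_def)
    finally have u: "\<bar>u\<bar> \<le> C * N" using a by (simp add: C_def field_simps)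
    have "\<bar>r\<bar> \<le> k * (C * N + N)"
      using r k u N by (smt (verit) mult_left_mono)
    also have "\<dots> = k * (C + 1) * N" by (simp add: algebra_simps)
    also have "\<dots> \<le> e * \<bar>a\<bar> * N" by (intro mult_right_mono k) (simp add: N_def)
    finally have "\<bar>r\<bar> / \<bar>a\<bar> \<le> e * N" using a by (simp add: field_simps)
    moreover have "u - (h - b * s) / a = - r / a" using a by (simp add: r_def field_simps)
    ultimately show "norm (V q - V p - (\<lambda>(h, s). (h - b * s) / a) (q - p)) \<le> e * norm (q - p)"
      by (simp add: u_def h_def s_def N_def case_prod_unfold)
  qed
qed

context trunc
begin

definition Xv where "Xv v t = (\<bar>y v t\<bar> + 2 * \<eta>) * z v t + dz v t"

definition Xt where "Xt v t = (\<bar>y v t\<bar> + 2 * \<eta>) * dy v t + f (y v t)"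

lemma Xv_cont2: "continuous_on (UNIV \<times> {0..}) (\<lambda>(v, t). Xv v t)"
  using y_cont2 z_cont2 dz_cont2 unfolding Xv_def case_prod_unfold by (intro continuous_intros)

lemma Xt_cont2: "continuous_on (UNIV \<times> {0..}) (\<lambda>(v, t). Xt v t)"
  using y_cont2 dy_cont2 unfolding Xt_def case_prod_unfold
  by (intro continuous_intros continuous_on_compose2[OF F_cont[of UNIV]]) auto

lemma X_deriv_v: "0 \<le> t \<Longrightarrow> ((\<lambda>v. X v t) has_real_derivative Xv v t) (at v)"
  unfolding X_def Xv_def by (intro DERIV_add dy_deriv_v DERIV_chain2[OF P_deriv y_deriv_v])

lemma X_has_derivative:
  "0 \<le> t \<Longrightarrow> ((\<lambda>(v, t). X v t) has_derivative (\<lambda>(h, s). Xv v t * h + Xt v t * s)) (at (v, t) within UNIV \<times> {0..})"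
  using X_deriv_t by (intro has_derivative_param_time X_deriv_v Xt_cont2) (auto simp: Xt_def)

lemma Xv_minus: "0 \<le> t \<Longrightarrow> Xv (- v) t = Xv v t"
proof -
  assume t: "0 \<le> t"
  have "((\<lambda>v. - X (- v) t) has_real_derivative - (Xv (- v) t * - 1)) (at v)"
    by (intro DERIV_minus DERIV_chain2[OF X_deriv_v[OF t]] DERIV_ident)
  then have "((\<lambda>v. X v t) has_real_derivative Xv (- v) t) (at v)"
    using X_minus[OF t] by simp
  from DERIV_unique[OF this X_deriv_v[OF t]] show ?thesis .
qed

text \<open>By \<open>X_compare\<close> the difference quotients from the right are at least
  \<open>X v t / v\<close>.\<close>

lemma Xv_pos:
  assumes v: "0 < v" and X: "X_pos v t" and t: "0 \<le> t"
  shows "0 < Xv v t"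
proof -
  have "X v t / v \<le> Xv v t"
  proof (rule tendsto_lowerbound)
    show "((\<lambda>w. (X w t - X v t) / (w - v)) \<longlongrightarrow> Xv v t) (at_right v)"
      using X_deriv_v[OF t, of v] unfolding has_field_derivative_iff by (rule tendsto_within_subset) simp
    show "\<forall>\<^sub>F w in at_right v. X v t / v \<le> (X w t - X v t) / (w - v)"
      using eventually_at_right_less[of v]
    proof eventually_elim
      case (elim w)
      have "w * X v t \<le> v * X w t"
        by (rule X_compare(1)[OF v elim]) (use X_posD[OF X] t in \<open>auto simp: less_imp_le\<close>)
      then show ?case using v elim by (simp add: field_simps)
    qed
  qed simp
  moreover have "0 < X v t / v" using v X_posD[OF X] t by simp
  ultimately show ?thesis by simp
qed

lemma slope_0: "slope \<eta> R 0 = 4 * \<eta>\<^sup>2 - 1"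
  using R by (simp add: slope_def)

text \<open>Along the trivial characteristic the linearised flow is a harmonic oscillator, so \<open>Xv\<close>
  changes sign at its first zero; before the onset of the shock it cannot.\<close>

lemma Xv_pos_0:
  assumes t: "0 \<le> t" and T: "ereal t < T1_0plus \<eta>"
  shows "0 < Xv 0 t"
proof -
  have Xv_eq: "Xv 0 s = 2 * \<eta> * z 0 s + dz 0 s" if "0 \<le> s" for s
    using that by (simp add: Xv_def)
  have ge: "0 \<le> Xv 0 s" if s: "0 \<le> s" "ereal s < T1_0plus \<eta>" for s
  proof (rule tendsto_lowerbound)
    show "((\<lambda>w. (X w s - X 0 s) / (w - 0)) \<longlongrightarrow> Xv 0 s) (at_right 0)"
      using X_deriv_v[OF s(1), of 0] unfolding has_field_derivative_iff by (rule tendsto_within_subset) simp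
    show "\<forall>\<^sub>F w in at_right 0. 0 \<le> (X w s - X 0 s) / (w - 0)"
      using eventually_at_right_less[of 0]
    proof eventually_elim
      case (elim w)
      have "0 < X w s" using X_posD[OF before_shock[OF s(2,1) elim]] s(1) by simp
      then show ?case using elim s(1) by (simp add: X_def P_def)
    qed
  qed simp
  have zd: "(z 0 has_real_derivative dz 0 s) (at s)" "(dz 0 has_real_derivative (4 * \<eta>\<^sup>2 - 1) * z 0 s) (at s)"
    if "0 < s" for s :: real
    using z_deriv[of s 0] dz_deriv[of s 0] that by (auto simp: at_within_pos slope_0)
  have zc: "continuous_on {0..s} (z 0)" "continuous_on {0..s} (dz 0)" for s :: real
    by (rule DERIV_continuous_on, rule has_field_derivative_subset[OF z_deriv] has_field_derivative_subset[OF dz_deriv]; auto)+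
  \<comment> \<open>The oscillator energy is conserved and equals 1, so \<open>z 0\<close> and
    \<open>dz 0\<close> never vanish together.\<close>
  have en: "(dz 0 t)\<^sup>2 - (4 * \<eta>\<^sup>2 - 1) * (z 0 t)\<^sup>2 \<ge> 1"
  proof -
    let ?E = "\<lambda>s. (dz 0 s)\<^sup>2 - (4 * \<eta>\<^sup>2 - 1) * (z 0 s)\<^sup>2"
    have "?E 0 \<le> ?E t"
    proof (rule nondecreasing_on_interval[OF t])
      show "continuous_on {0..t} ?E" by (intro continuous_intros zc)
      fix s :: real assume s: "0 < s"
      have "(?E has_real_derivative
          (2 * dz 0 s * ((4 * \<eta>\<^sup>2 - 1) * z 0 s)) - (4 * \<eta>\<^sup>2 - 1) * (2 * z 0 s * dz 0 s)) (at s)"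
        using DERIV_power[OF zd(1)[OF s], of 2] DERIV_power[OF zd(2)[OF s], of 2]
        by (intro DERIV_diff DERIV_cmult) (simp_all add: mult_ac)
      then show "(?E has_real_derivative 0) (at s)" by (simp add: mult_ac)
    qed simp
    then show ?thesis by simp
  qed
  show ?thesis
  proof (rule ccontr)
    assume "\<not> 0 < Xv 0 t"
    then have zero: "Xv 0 t = 0" using ge[OF t T] by simp
    then have "t \<noteq> 0" by (auto simp: Xv_def)
    then have t0: "0 < t" using t by simp
    obtain u where u: "t < u" "ereal u < T1_0plus \<eta>"
      using ereal_dense2[OF T] by auto
    \<comment> \<open>There is still time before the onset on the right of \<open>t\<close>, so a
      zero is an interior minimum and the derivative vanishes too. Together with
      \<open>dz 0 t = - 2 * \<eta> * z 0 t\<close> this forces \<open>z 0 t = 0\<close>.\<close>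
    have "2 * \<eta> * dz 0 t + (4 * \<eta>\<^sup>2 - 1) * z 0 t = 0"
    proof (rule DERIV_local_min[where d = "min t (u - t)" and f = "\<lambda>s. 2 * \<eta> * z 0 s + dz 0 s"])
      show "((\<lambda>s. 2 * \<eta> * z 0 s + dz 0 s) has_real_derivative 2 * \<eta> * dz 0 t + (4 * \<eta>\<^sup>2 - 1) * z 0 t) (at t)"
        by (intro DERIV_add DERIV_cmult zd t0)
      show "0 < min t (u - t)" using t0 u by simp
      show "\<forall>s. \<bar>t - s\<bar> < min t (u - t) \<longrightarrow> 2 * \<eta> * z 0 t + dz 0 t \<le> 2 * \<eta> * z 0 s + dz 0 s"
      proof (intro allI impI)
        fix s assume "\<bar>t - s\<bar> < min t (u - t)"
        then have s: "0 \<le> s" "s < u" by auto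
        then have "ereal s < T1_0plus \<eta>" using u(2) by (meson ereal_less_eq(3) less_imp_le order_le_less_trans)
        then show "2 * \<eta> * z 0 t + dz 0 t \<le> 2 * \<eta> * z 0 s + dz 0 s"
          using ge[of s] s zero Xv_eq[of s] Xv_eq[of t] t by simp
      qed
    qed
    moreover have dz: "dz 0 t = - (2 * \<eta> * z 0 t)" using zero Xv_eq[OF t] by simp
    ultimately have "z 0 t = 0" by (simp add: power2_eq_square algebra_simps)
    then show False using en dz by simp
  qed
qed

text \<open>The pairs \<open>(v, t)\<close> that parametrise \<open>Dom\<close>. At
  \<open>v = 0\<close> the function \<open>X\<close> vanishes identically, so positivity is replaced
  by the condition that the onset has not occurred.\<close>

definition adm where
  "adm v t \<longleftrightarrow> 0 \<le> t \<and> (if v = 0 then ereal t < T1_0plus \<eta> else X_pos \<bar>v\<bar> t)"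

lemma adm_open:
  assumes "adm v t"
  obtains d where "0 < d" "\<And>w t'. \<bar>w - v\<bar> < d \<Longrightarrow> \<bar>t' - t\<bar> < d \<Longrightarrow> 0 \<le> t' \<Longrightarrow> adm w t'"
proof (cases "v = 0")
  case True
  then have T: "ereal t < T1_0plus \<eta>" using assms by (simp add: adm_def)
  obtain u where u: "t < u" "ereal u < T1_0plus \<eta>"
    using ereal_dense2[OF T] by auto
  show thesis
  proof (rule that[of "u - t"])
    fix w t' assume "\<bar>t' - t\<bar> < u - t" and t': "0 \<le> t'"
    then have "ereal t' < ereal u" by simp
    then have "ereal t' < T1_0plus \<eta>" using u(2) by (rule less_trans)
    then show "adm w t'" using before_shock[of t' "\<bar>w\<bar>"] t' by (simp add: adm_def)
  qed (use u in simp)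
next
  case False
  then have "X_pos \<bar>v\<bar> t" "0 \<le> t" using assms by (auto simp: adm_def)
  then obtain d where d: "0 < d" "\<And>w t'. \<bar>w - \<bar>v\<bar>\<bar> < d \<Longrightarrow> \<bar>t' - t\<bar> < d \<Longrightarrow> X_pos w t'"
    using X_pos_open by blast
  show thesis
  proof (rule that[of "min d \<bar>v\<bar>"])
    fix w t' assume "\<bar>w - v\<bar> < min d \<bar>v\<bar>" "\<bar>t' - t\<bar> < min d \<bar>v\<bar>" "0 \<le> t'"
    then show "adm w t'" using d(2)[of "\<bar>w\<bar>" t'] abs_triangle_ineq3[of w v] by (auto simp: adm_def)
  qed (use d False in simp)
qed

lemma adm_Xv_pos: "adm v t \<Longrightarrow> 0 < Xv v t"
  using Xv_pos[of v t] Xv_pos[of "- v" t] Xv_pos_0[of t] Xv_minus[of t v]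
  by (cases v "0 :: real" rule: linorder_cases) (auto simp: adm_def)

lemma adm_sgn: "adm v t \<Longrightarrow> sgn (X v t) = sgn v"
  using X_posD[of v t t] X_posD[of "- v" t t] X_minus[of t v]
  by (cases v "0 :: real" rule: linorder_cases) (auto simp: adm_def X_def P_def)

lemma adm_inj:
  assumes "adm v t" "adm w t" "X v t = X w t"
  shows "v = w"
proof -
  have t: "0 \<le> t" using assms by (simp add: adm_def)
  have pos: "v = w" if "0 < v" "0 < w" "X_pos v t" "X_pos w t" "X v t = X w t" for v w
    using X_strict_mono[of v t w] X_strict_mono[of w t v] that t by (cases v w rule: linorder_cases) auto
  have "sgn v = sgn w" using adm_sgn assms by metis
  then consider "v = 0" "w = 0" | "0 < v" "0 < w" | "0 < - v" "0 < - w"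
    by (auto simp: sgn_if split: if_splits)
  then show ?thesis
  proof cases
    case 2 then show ?thesis using pos[of v w] assms by (auto simp: adm_def)
  next
    case 3 then show ?thesis using pos[of "- v" "- w"] assms X_minus[OF t] by (auto simp: adm_def)
  qed simp
qed

definition Dom :: "(real \<times> real) set" where
  "Dom = ({-1..1} \<times> {0..}) - {(0, t) |t. T1_0plus \<eta> \<le> ereal t}"

lemma DomD: "(x, t) \<in> Dom \<Longrightarrow> \<bar>x\<bar> \<le> 1 \<and> 0 \<le> t \<and> (x = 0 \<longrightarrow> ereal t < T1_0plus \<eta>)"
  by (auto simp: Dom_def abs_le_iff)

lemma adm_v_of: "(x, t) \<in> Dom \<Longrightarrow> adm (V x t) t" and X_v_of: "(x, t) \<in> Dom \<Longrightarrow> X (V x t) t = x"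
proof -
  assume "(x, t) \<in> Dom"
  then have x: "\<bar>x\<bar> \<le> 1" and t: "0 \<le> t" and T: "x = 0 \<Longrightarrow> ereal t < T1_0plus \<eta>" by (auto dest: DomD)
  have "adm (V x t) t \<and> X (V x t) t = x"
    using v_of[of x t] v_of[of "- x" t] v_of_odd[OF x t] X_minus[OF t, of "V x t"] x t T
    by (cases x "0 :: real" rule: linorder_cases) (auto simp: adm_def X_def P_def)
  then show "adm (V x t) t" "X (V x t) t = x" by auto
qed

text \<open>Near the given velocity \<open>X\<close> increases strictly in \<open>v\<close>, so for
  nearby points of \<open>Dom\<close> its values at \<open>v - k\<close> and \<open>v + k\<close>
  still enclose \<open>x\<close>. The intermediate value found between them is admissible, and
  injectivity identifies it with \<open>V\<close>.\<close>

lemma v_of_tendsto: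
  assumes p: "(x0, t0) \<in> Dom"
  shows "((\<lambda>p. V (fst p) (snd p)) \<longlongrightarrow> V x0 t0) (at (x0, t0) within Dom)"
proof (rule tendstoI)
  fix e :: real assume e: "0 < e"
  let ?v = "V x0 t0"
  have t0: "0 \<le> t0" using DomD[OF p] by simp
  obtain d where d: "0 < d" "\<And>w t'. \<bar>w - ?v\<bar> < d \<Longrightarrow> \<bar>t' - t0\<bar> < d \<Longrightarrow> 0 \<le> t' \<Longrightarrow> adm w t'"
    using adm_open[OF adm_v_of[OF p]] by blast
  define k where "k = min e d / 2"
  have k: "0 < k" "k < e" "k < d" using e d by (auto simp: k_def)
  have inc: "X a t < X b t" if "\<bar>t - t0\<bar> < d" "0 \<le> t" "?v - k \<le> a" "a < b" "b \<le> ?v + k" for a b t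
    by (rule DERIV_pos_imp_increasing_open[OF that(4) _ X_cont_v[OF that(2)]])
       (use X_deriv_v[OF that(2)] adm_Xv_pos d(2) that k in force)
  have c: "((\<lambda>p. X w (snd p)) \<longlongrightarrow> X w t0) (at (x0, t0) within Dom)" for w
  proof -
    have "continuous_on Dom (\<lambda>p. X w (snd p))"
      by (rule continuous_on_compose2[OF X_cont[of "{0..}"]]) (auto intro!: continuous_intros dest: DomD)
    then show ?thesis using p by (auto simp: continuous_on_def)
  qed
  have f: "((\<lambda>p. fst p) \<longlongrightarrow> x0) (at (x0, t0) within Dom)"
    using tendsto_fst[OF tendsto_ident_at, of "(x0,t0)"] by simp
  have s: "((\<lambda>p. snd p) \<longlongrightarrow> t0) (at (x0, t0) within Dom)"
    using tendsto_snd[OF tendsto_ident_at, of "(x0,t0)"] by simp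
  have lo: "X (?v - k) t0 - x0 < 0" and hi: "0 < X (?v + k) t0 - x0"
    using inc[of t0 "?v - k" ?v] inc[of t0 ?v "?v + k"] X_v_of[OF p] k d t0 by auto
  have "\<forall>\<^sub>F p in at (x0, t0) within Dom. X (?v - k) (snd p) - fst p < 0"
    by (rule order_tendstoD(2)[OF tendsto_diff[OF c f] lo])
  moreover have "\<forall>\<^sub>F p in at (x0, t0) within Dom. 0 < X (?v + k) (snd p) - fst p"
    by (rule order_tendstoD(1)[OF tendsto_diff[OF c f] hi])
  moreover have "\<forall>\<^sub>F p in at (x0, t0) within Dom. dist (snd p) t0 < d"
    by (rule tendstoD[OF s d(1)])
  moreover have "\<forall>\<^sub>F p in at (x0, t0) within Dom. p \<in> Dom"
    by (auto simp: eventually_at_filter)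
  ultimately show "\<forall>\<^sub>F p in at (x0, t0) within Dom. dist (V (fst p) (snd p)) ?v < e"
  proof eventually_elim
    case (elim q)
    obtain x t where q: "q = (x, t)" by (cases q)
    have t: "0 \<le> t" "\<bar>t - t0\<bar> < d" using elim DomD[of x t] by (auto simp: q dist_real_def)
    obtain w where w: "?v - k \<le> w" "w \<le> ?v + k" "X w t = x"
      using IVT'[of "\<lambda>v. X v t" "?v - k" x "?v + k"] elim k X_cont_v[OF t(1)] by (auto simp: q)
    have "adm w t" using d(2)[of w t] w k t by auto
    then have "V x t = w"
      using adm_inj[of "V x t" t w] adm_v_of[of x t] X_v_of[of x t] elim w by (simp add: q)
    then show ?case using w k by (auto simp: q dist_real_def)
  qed
qed

lemma v_of_cont: "continuous_on Dom (\<lambda>p. V (fst p) (snd p))"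
  using v_of_tendsto by (auto simp: continuous_on_def)

lemma v_of_has_derivative:
  assumes p: "(x, t) \<in> Dom"
  shows "((\<lambda>p. V (fst p) (snd p)) has_derivative
    (\<lambda>(h, s). (h - Xt (V x t) t * s) / Xv (V x t) t)) (at (x, t) within Dom)"
proof (rule has_derivative_implicit[where \<Phi> = "\<lambda>(v, t). X v t" and U = "UNIV \<times> {0..}"])
  show "((\<lambda>(v, t). X v t) has_derivative (\<lambda>(h, s). Xv (V x t) t * h + Xt (V x t) t * s))
     (at (V (fst (x, t)) (snd (x, t)), snd (x, t)) within UNIV \<times> {0..})"
    using X_has_derivative[of t "V x t"] DomD[OF p] by simp
  show "Xv (V x t) t \<noteq> 0" using adm_Xv_pos[OF adm_v_of[OF p]] by simp
  fix q :: "real \<times> real" assume "q \<in> Dom"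
  then show "(\<lambda>(v, t). X v t) (V (fst q) (snd q), snd q) = fst q"
    "(V (fst q) (snd q), snd q) \<in> UNIV \<times> {0..}"
    using X_v_of[of "fst q" "snd q"] DomD[of "fst q" "snd q"] by auto
qed (use p v_of_tendsto[OF p] in auto)

definition Yx where "Yx p = (let v = V (fst p) (snd p) in z v (snd p) / Xv v (snd p))"

definition Yt where
  "Yt p = (let v = V (fst p) (snd p) in dy v (snd p) - z v (snd p) * Xt v (snd p) / Xv v (snd p))"

lemma continuous_on_v_of_compose:
  assumes "continuous_on (UNIV \<times> {0..}) (\<lambda>(v, t). g v t)"
  shows "continuous_on Dom (\<lambda>p. g (V (fst p) (snd p)) (snd p))"
proof -
  have c: "continuous_on Dom (\<lambda>p. (V (fst p) (snd p), snd p))"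
    by (intro continuous_on_Pair v_of_cont continuous_on_snd continuous_on_id)
  have "(\<lambda>p. (V (fst p) (snd p), snd p)) ` Dom \<subseteq> UNIV \<times> {0..}"
    by (auto dest: DomD)
  from continuous_on_compose2[OF assms c this] show ?thesis by simp
qed

lemma Xv_v_of_nz: "p \<in> Dom \<Longrightarrow> Xv (V (fst p) (snd p)) (snd p) \<noteq> 0"
  using adm_Xv_pos[OF adm_v_of, of "fst p" "snd p"] by simp

lemma Yx_cont: "continuous_on Dom Yx"
  unfolding Yx_def Let_def
  by (intro continuous_on_divide continuous_on_v_of_compose z_cont2 Xv_cont2 ballI Xv_v_of_nz)

lemma Yt_cont: "continuous_on Dom Yt"
  unfolding Yt_def Let_def
  by (intro continuous_on_diff continuous_on_mult continuous_on_divide continuous_on_v_of_compose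
      dy_cont2 z_cont2 Xv_cont2 Xt_cont2 ballI Xv_v_of_nz)

lemma Y_has_derivative:
  assumes p: "(x, t) \<in> Dom"
  shows "((\<lambda>(x, t). Y x t) has_derivative (\<lambda>(h, s). Yx (x, t) * h + Yt (x, t) * s)) (at (x, t) within Dom)"
proof -
  let ?v = "V x t"
  let ?g = "\<lambda>p. (V (fst p) (snd p), snd p)"
  have t: "0 \<le> t" using DomD[OF p] by simp
  have g: "(?g has_derivative (\<lambda>q. ((fst q - Xt ?v t * snd q) / Xv ?v t, snd q))) (at (x, t) within Dom)"
    using v_of_has_derivative[OF p] unfolding case_prod_unfold
    by (intro has_derivative_Pair has_derivative_snd has_derivative_ident)
  have "((\<lambda>(v, t). y v t) has_derivative (\<lambda>(h, s). z ?v t * h + dy ?v t * s)) (at (?g (x, t)) within ?g ` Dom)"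
    by (rule has_derivative_subset[of _ _ _ "UNIV \<times> {0..}"])
       (use y_has_derivative[OF t, of ?v] in \<open>auto dest: DomD\<close>)
  from has_derivative_in_compose[OF g this]
  have "((\<lambda>p. y (V (fst p) (snd p)) (snd p)) has_derivative
      (\<lambda>q. z ?v t * ((fst q - Xt ?v t * snd q) / Xv ?v t) + dy ?v t * snd q)) (at (x, t) within Dom)"
    by simp
  moreover have "(\<lambda>q. z ?v t * ((fst q - Xt ?v t * snd q) / Xv ?v t) + dy ?v t * snd q)
      = (\<lambda>(h, s). Yx (x, t) * h + Yt (x, t) * s)"
    by (simp add: Yx_def Yt_def Let_def fun_eq_iff diff_divide_distrib algebra_simps)
  ultimately have "((\<lambda>p. y (V (fst p) (snd p)) (snd p)) has_derivative
      (\<lambda>(h, s). Yx (x, t) * h + Yt (x, t) * s)) (at (x, t) within Dom)"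
    by simp
  then show ?thesis
    by (rule has_derivative_transform[rotated 2]) (use p in \<open>auto simp: Y_fun_eq dest: DomD\<close>)
qed

lemma Y_cont: "continuous_on Dom (\<lambda>(x, t). Y x t)"
  using Y_has_derivative by (auto simp: continuous_on_eq_continuous_within intro: has_derivative_continuous)

lemma Dom_slice:
  assumes p: "(x, t) \<in> Dom"
  shows "at x within {\<xi>. (\<xi>, t) \<in> Dom} = at x within {-1..1}"
proof (cases "x = 0")
  case True
  then have "{\<xi>. (\<xi>, t) \<in> Dom} = {-1..1}" using p by (auto simp: Dom_def)
  then show ?thesis by (simp only:)
next
  case False
  then show ?thesis
    using p by (intro at_within_nhd[of x "- {0}"]) (auto simp: Dom_def)
qed

lemma Y_deriv_x:
  assumes p: "(x, t) \<in> Dom"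
  shows "((\<lambda>\<xi>. Y \<xi> t) has_real_derivative Yx (x, t)) (at x within {-1..1})"
proof -
  have g: "((\<lambda>\<xi>. (\<xi>, t)) has_derivative (\<lambda>h. (h, 0 :: real))) (at x within {\<xi>. (\<xi>, t) \<in> Dom})"
    by (intro has_derivative_Pair has_derivative_ident has_derivative_const)
  have "((\<lambda>(x, t). Y x t) has_derivative (\<lambda>(h, s). Yx (x, t) * h + Yt (x, t) * s))
     (at ((\<lambda>\<xi>. (\<xi>, t)) x) within (\<lambda>\<xi>. (\<xi>, t)) ` {\<xi>. (\<xi>, t) \<in> Dom})"
    by (rule has_derivative_subset[OF Y_has_derivative[OF p]]) auto
  from has_derivative_in_compose[OF g this] show ?thesis
    by (simp add: has_field_derivative_def Dom_slice[OF p] mult_commute_abs)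
qed

lemma Y_deriv_t:
  assumes p: "(x, t) \<in> Dom" and x: "x \<noteq> 0"
  shows "((\<lambda>s. Y x s) has_real_derivative Yt (x, t)) (at t within {0..})"
proof -
  have sub: "(\<lambda>s. (x, s)) ` {0..} \<subseteq> Dom" using DomD[OF p] x by (auto simp: Dom_def)
  have g: "((\<lambda>s. (x, s)) has_derivative (\<lambda>h. (0 :: real, h))) (at t within {0..})"
    by (intro has_derivative_Pair has_derivative_ident has_derivative_const)
  have "((\<lambda>(x, t). Y x t) has_derivative (\<lambda>(h, s). Yx (x, t) * h + Yt (x, t) * s))
     (at ((\<lambda>s. (x, s)) t) within (\<lambda>s. (x, s)) ` {0..})"
    by (rule has_derivative_subset[OF Y_has_derivative[OF p]]) (rule sub)
  from has_derivative_in_compose[OF g this] show ?thesis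
    by (simp add: has_field_derivative_def mult_commute_abs)
qed

lemma flux_eq: "flux \<eta> x u = x * P \<eta> u - u\<^sup>2 / 2 - x\<^sup>2 / 2"
  by (simp add: flux_def P_def algebra_simps)

text \<open>In the untruncated range \<open>Xt = x * P' - y\<close> is the derivative of the flux in
  its second argument, that is the characteristic speed, and \<open>dy = x - P\<close> is the rate
  of change of \<open>Y\<close> along the characteristic. The law is
  \<open>Yt + Xt * Yx = dy\<close>.\<close>

lemma conservation_law:
  assumes p: "(x, t) \<in> Dom"
  shows "P \<eta> (Y x t) + (x * (\<bar>Y x t\<bar> + 2 * \<eta>) - Y x t) * Yx (x, t) - x = - Yt (x, t)"
proof -
  have t: "0 \<le> t" "\<bar>x\<bar> \<le> 1" using DomD[OF p] by auto
  let ?v = "V x t"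
  define u where "u = y ?v t"
  have u: "Y x t = u" using Y_fun_eq t by (simp add: u_def)
  have "\<bar>u\<bar> \<le> sqrt 2"
    using Y_fun_bounds[of x t] Y_fun_bounds[of "- x" t] Y_fun_odd[of x t] t
    by (cases "0 \<le> x") (auto simp: u abs_le_iff)
  moreover have "sqrt 2 < 2" by (rule real_less_lsqrt) auto
  ultimately have fu: "f u = P \<eta> u * (\<bar>u\<bar> + 2 * \<eta>) - u" using R f_force[of u] force_eq by simp
  have dy: "dy ?v t = x - P \<eta> u" using X_v_of[OF p] by (simp add: X_def u_def)
  have "Xt ?v t = x * (\<bar>u\<bar> + 2 * \<eta>) - u"
    unfolding Xt_def u_def[symmetric] fu dy by (simp add: algebra_simps)
  then show ?thesis by (simp add: Yx_def Yt_def Let_def u dy)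
qed

lemma flux_deriv:
  assumes p: "(x, t) \<in> Dom"
  shows "((\<lambda>\<xi>. flux \<eta> \<xi> (Y \<xi> t)) has_real_derivative - Yt (x, t)) (at x within {-1..1})"
proof -
  have "((\<lambda>\<xi>. \<xi> * P \<eta> (Y \<xi> t) - (Y \<xi> t)\<^sup>2 / 2 - \<xi>\<^sup>2 / 2) has_real_derivative
     (1 * P \<eta> (Y x t) + (\<bar>Y x t\<bar> + 2 * \<eta>) * Yx (x, t) * x)
      - (2 * Y x t * Yx (x, t)) / 2 - (2 * x) / 2) (at x within {-1..1})"
    using DERIV_power[OF Y_deriv_x[OF p], of 2] DERIV_power[OF DERIV_ident, where n = 2]
    by (intro DERIV_diff DERIV_mult DERIV_cdivide DERIV_ident DERIV_chain2[OF P_deriv] Y_deriv_x p)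
       (simp_all add: mult_ac)
  then have "((\<lambda>\<xi>. flux \<eta> \<xi> (Y \<xi> t)) has_real_derivative
      P \<eta> (Y x t) + (x * (\<bar>Y x t\<bar> + 2 * \<eta>) - Y x t) * Yx (x, t) - x) (at x within {-1..1})"
    by (simp add: flux_eq algebra_simps)
  then show ?thesis using conservation_law[OF p] by simp
qed

lemma classical: "C1_classical_solution_on Dom (flux \<eta>) (Y)"
  unfolding C1_classical_solution_on_def
proof (rule exI[of _ Yx], rule exI[of _ Yt], intro conjI Yx_cont Yt_cont ballI)
  fix p assume "p \<in> Dom"
  then show "((\<lambda>(x, t). Y x t) has_derivative (\<lambda>(h, s). Yx p * h + Yt p * s)) (at p within Dom)"
    using Y_has_derivative by (cases p) auto
next
  fix p assume "p \<in> Dom"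
  then show "case p of (x, t) \<Rightarrow> ((\<lambda>\<xi>. flux \<eta> \<xi> (Y \<xi> t)) has_real_derivative - Yt (x, t)) (at x within {-1..1})"
    using flux_deriv by (cases p) simp
qed

section \<open>Traces and admissibility at x = 0\<close>

text \<open>For small \<open>x > 0\<close> strict monotonicity squeezes the velocity between
  \<open>v_low t\<close> and \<open>v_low t + e\<close>, so the trace is carried by the
  characteristic that returns at time \<open>t\<close>.\<close>

lemma Y_shock_right:
  assumes t: "0 \<le> t" and T: "T1_0plus \<eta> < ereal t"
  shows "((\<lambda>x. Y x t) \<longlongrightarrow> y (v_low t) t) (at_right 0)"
proof -
  have "((\<lambda>x. V x t) \<longlongrightarrow> v_low t) (at_right 0)"
  proof (rule tendstoI)
    fix e :: real assume e: "0 < e"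
    let ?w = "v_low t + e"
    have w: "0 < ?w" "X_pos ?w t" using v_low_less[of t ?w] e by auto
    have "0 < X ?w t" using X_posD[OF w(2)] t by simp
    then have "\<forall>\<^sub>F x in at_right 0. x \<in> {0<..<min 1 (X ?w t)}"
      by (intro eventually_at_right_real) simp
    then show "\<forall>\<^sub>F x in at_right 0. dist (V x t) (v_low t) < e"
    proof eventually_elim
      case (elim x)
      then have v: "0 < V x t" "X_pos (V x t) t" "X (V x t) t = x"
        using v_of[of x t] t by auto
      have "V x t < ?w"
      proof (rule ccontr)
        assume "\<not> V x t < ?w"
        then have "X ?w t \<le> X (V x t) t"
          using X_strict_mono[OF w(2,1), of "V x t"] t by (cases "?w = V x t") auto
        then show False using v elim by auto
      qed
      moreover have "v_low t \<le> V x t" using v by (intro v_low_le)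
      ultimately show ?case by (simp add: dist_real_def)
    qed
  qed
  then have "((\<lambda>x. y (V x t) t) \<longlongrightarrow> y (v_low t) t) (at_right 0)"
    by (rule continuous_on_tendsto_compose[OF y_cont_v[OF t, of UNIV]]) auto
  moreover have "\<forall>\<^sub>F x in at_right 0. x \<in> {0<..<1::real}"
    by (intro eventually_at_right_real) simp
  then have "\<forall>\<^sub>F x in at_right 0. y (V x t) t = Y x t"
    by eventually_elim (use t in \<open>simp add: Y_fun_eq\<close>)
  ultimately show ?thesis by (rule Lim_transform_eventually)
qed

lemma shock:
  assumes T: "T1_0plus \<eta> < ereal t"
  shows "admissible_shock_at (flux \<eta>) (\<lambda>t. 0) (Y) t"
proof -
  have "0 \<le> T1_0plus \<eta>"
    unfolding T1_0plus_eq
  proof (rule INF_greatest)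
    fix v :: real assume "v \<in> {0<..}"
    then have v: "0 < v" by simp
    then have "ereal 0 < T1 \<eta> v" using less_T1_iff[OF v, of 0] by simp
    then show "0 \<le> T1 \<eta> v" by (simp add: zero_ereal_def less_imp_le)
  qed
  then have "0 < ereal t" using T by (rule le_less_trans)
  then have t: "0 < t" by simp
  define a where "a = y (v_low t) t"
  have a: "0 < a"
    unfolding a_def by (rule y_pos[OF after_shock[OF T] _ t]) (use X_v_low_nonneg t in auto)
  have r: "((\<lambda>x. Y x t) \<longlongrightarrow> a) (at_right 0)"
    unfolding a_def using Y_shock_right[OF _ T] t by simp
  have l: "((\<lambda>x. Y x t) \<longlongrightarrow> - a) (at_left 0)"
  proof -
    have "((\<lambda>x. - Y x t) \<longlongrightarrow> - a) (at_right 0)" using r by (intro tendsto_minus)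
    moreover have "\<forall>\<^sub>F x in at_right 0. x \<in> {0<..<1::real}"
      by (intro eventually_at_right_real) simp
    then have "\<forall>\<^sub>F x in at_right 0. - Y x t = Y (- x) t"
      by eventually_elim (use t in \<open>simp add: Y_fun_odd\<close>)
    ultimately have "((\<lambda>x. Y (- x) t) \<longlongrightarrow> - a) (at_right 0)" by (rule Lim_transform_eventually)
    then show ?thesis by (simp add: filterlim_at_left_to_right)
  qed
  show ?thesis
    unfolding admissible_shock_at_def
  proof (rule exI[of _ a], rule exI[of _ "- a"], rule exI[of _ 0], intro conjI allI impI r l)
    show "a \<noteq> - a" using a by simp
    show "0 = (flux \<eta> 0 a - flux \<eta> 0 (- a)) / (a - - a)" by (simp add: flux_eq)
    fix c assume c: "min (- a) a < c \<and> c < max (- a) a"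
    then have c': "- a < c" "c < a" using a by auto
    have "(flux \<eta> 0 c - flux \<eta> 0 a) / (c - a) = - (c + a) / 2"
      using c' by (simp add: flux_eq field_simps power2_eq_square)
    also have "\<dots> < 0" using c' by simp
    finally show "(flux \<eta> 0 c - flux \<eta> 0 a) / (c - a) < 0" .
    have "0 < (a - c) / 2" using c' by simp
    also have "\<dots> = (flux \<eta> 0 c - flux \<eta> 0 (- a)) / (c - - a)"
      using c' by (simp add: flux_eq field_simps power2_eq_square)
    finally show "0 < (flux \<eta> 0 c - flux \<eta> 0 (- a)) / (c - - a)" .
  qed simp
qed

lemma shock_curve: "has_shock_curve (flux \<eta>) (Y) (\<lambda>t. 0) (T1_0plus \<eta>)"
  using classical shock by (simp add: has_shock_curve_def Dom_def)

end

section \<open>The entropy inequality\<close>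

text \<open>The limit is correct at \<open>u = 0\<close> as well, because \<open>sgn 0 = 0\<close>;
  the convergence is therefore pointwise everywhere and dominated convergence applies
  directly.\<close>

lemma tendsto_arctan_sgn: "(\<lambda>n. 2 / pi * arctan (real n * u)) \<longlonglongrightarrow> sgn u"
proof -
  have pos: "(\<lambda>n. 2 / pi * arctan (real n * u)) \<longlonglongrightarrow> 1" if "0 < u" for u
  proof -
    have "filterlim (\<lambda>n. u * real n) at_top sequentially"
      by (rule filterlim_tendsto_pos_mult_at_top[OF tendsto_const that filterlim_real_sequentially])
    then have "(\<lambda>n. arctan (u * real n)) \<longlonglongrightarrow> pi / 2"
      by (rule filterlim_compose[OF tendsto_arctan_at_top])
    then have "(\<lambda>n. 2 / pi * arctan (u * real n)) \<longlonglongrightarrow> 2 / pi * (pi / 2)"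
      by (intro tendsto_intros)
    then show ?thesis by (simp add: mult.commute)
  qed
  show ?thesis
    using pos[of u] tendsto_minus[OF pos[of "- u"]]
    by (cases u "0 :: real" rule: linorder_cases) (auto simp: arctan_minus)
qed

lemma arctan_smoothing_bound: "\<bar>2 / pi * arctan w\<bar> \<le> 1"
  using arctan_lbound[of w] arctan_ubound[of w] by (auto simp: abs_mult divide_simps abs_le_iff)

lemma smoothing_deriv_bound: "\<bar>2 / pi * (n / (1 + (n * u)\<^sup>2)) * u\<bar> \<le> 1" for n u :: real
proof -
  have "2 * \<bar>n * u\<bar> \<le> 1 + (n * u)\<^sup>2"
    using sum_squares_bound[of 1 "\<bar>n * u\<bar>"] by simp
  then have "\<bar>n * u\<bar> / (1 + (n * u)\<^sup>2) \<le> 1 / 2"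
    by (simp add: pos_divide_le_eq add_pos_nonneg)
  then have "2 / pi * (\<bar>n * u\<bar> / (1 + (n * u)\<^sup>2)) \<le> 2 / pi * (1 / 2)"
    by (intro mult_left_mono) auto
  also have "\<dots> \<le> 1" using pi_gt3 by simp
  finally show ?thesis by (simp add: abs_mult abs_divide)
qed

lemma smoothing_deriv_tendsto: "(\<lambda>n. 2 / pi * (real n / (1 + (real n * u)\<^sup>2)) * u) \<longlonglongrightarrow> 0"
proof (cases "u = 0")
  case False
  have "(\<lambda>n. 1 / real n * (1 / \<bar>u\<bar>)) \<longlonglongrightarrow> 0 * (1 / \<bar>u\<bar>)"
    by (intro tendsto_mult lim_1_over_n tendsto_const)
  then have lim: "(\<lambda>n. 1 / real n * (1 / \<bar>u\<bar>)) \<longlonglongrightarrow> 0" by simp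
  show ?thesis
  proof (rule Lim_null_comparison[OF _ lim])
    show "\<forall>\<^sub>F n in sequentially. norm (2 / pi * (real n / (1 + (real n * u)\<^sup>2)) * u) \<le> 1 / real n * (1 / \<bar>u\<bar>)"
      using eventually_gt_at_top[of 0]
    proof eventually_elim
      case (elim n)
      define w where "w = \<bar>real n * u\<bar>"
      have w: "0 < w" using elim False by (simp add: w_def)
      have "w / (1 + w\<^sup>2) \<le> 1 / w" using w by (simp add: divide_simps power2_eq_square add_pos_nonneg)
      then have "2 / pi * (w / (1 + w\<^sup>2)) \<le> 1 * (1 / w)"
        using pi_gt3 w by (intro mult_mono) auto
      moreover have "norm (2 / pi * (real n / (1 + (real n * u)\<^sup>2)) * u) = 2 / pi * (w / (1 + w\<^sup>2))"
        by (simp add: w_def abs_mult power_mult_distrib)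
      ultimately show ?case by (simp add: w_def abs_mult)
    qed
  qed
qed simp

lemma C_diff_1D:
  assumes "C_diff 1 \<phi>"
  obtains fx ft where "continuous_on UNIV \<phi>" "continuous_on UNIV fx" "continuous_on UNIV ft"
    "\<And>p. (\<phi> has_derivative (\<lambda>(h, s). fx p * h + ft p * s)) (at p)"
proof -
  obtain fx ft where *: "C_diff 0 fx" "C_diff 0 ft"
    "\<And>p. (\<phi> has_derivative (\<lambda>(h, s). fx p * h + ft p * s)) (at p)"
    using assms unfolding One_nat_def C_diff.simps(2) by blast
  have "continuous_on UNIV \<phi>"
    by (intro continuous_at_imp_continuous_on ballI has_derivative_continuous[OF *(3)])
  moreover have "continuous_on UNIV fx" "continuous_on UNIV ft" using *(1,2) by simp_all
  ultimately show thesis using *(3) by (intro that)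
qed

lemma has_derivative_zero_off_support:
  fixes \<phi> :: "real \<times> real \<Rightarrow> real"
  assumes d: "(\<phi> has_derivative (\<lambda>(h, s). a * h + b * s)) (at p)"
    and p: "p \<notin> closure {p. \<phi> p \<noteq> 0}"
  shows "\<phi> p = 0" "a = 0" "b = 0"
proof -
  have z: "\<phi> q = 0" if "q \<in> - closure {p. \<phi> p \<noteq> 0}" for q
    using subsetD[OF closure_subset, of q "{p. \<phi> p \<noteq> 0}"] that by (cases "\<phi> q = 0") simp_all
  show "\<phi> p = 0" by (rule z) (use p in simp)
  have "((\<lambda>_. 0) has_derivative (\<lambda>(h, s). a * h + b * s)) (at p)"
  proof (rule has_derivative_transform_within_open[OF d])
    show "open (- closure {p. \<phi> p \<noteq> 0})" by (simp add: open_Compl)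
    show "p \<in> - closure {p. \<phi> p \<noteq> 0}" using p by simp
  qed (rule z)
  then have "(\<lambda>(h, s). a * h + b * s) = (\<lambda>h. 0)"
    by (rule has_derivative_unique) (rule has_derivative_const)
  then have "a * h + b * s = 0" for h s by (simp add: fun_eq_iff)
  from this[of 1 0] this[of 0 1] show "a = 0" "b = 0" by auto
qed

lemma partial_derivs:
  fixes \<phi> :: "real \<times> real \<Rightarrow> real"
  assumes "(\<phi> has_derivative (\<lambda>(h, s). a * h + b * s)) (at (x, t))"
  shows "((\<lambda>\<xi>. \<phi> (\<xi>, t)) has_real_derivative a) (at x)" "((\<lambda>s. \<phi> (x, s)) has_real_derivative b) (at t)"
proof -
  have 1: "((\<lambda>\<xi>. (\<xi>, t)) has_derivative (\<lambda>h. (h, 0 :: real))) (at x)"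
    and 2: "((\<lambda>s. (x, s)) has_derivative (\<lambda>h. (0 :: real, h))) (at t)"
    by (intro has_derivative_Pair has_derivative_ident has_derivative_const)+
  have "(\<phi> has_derivative (\<lambda>(h, s). a * h + b * s)) (at (x, t) within A)" for A
    using assms by (rule has_derivative_at_withinI)
  from has_derivative_in_compose[OF 1 this] has_derivative_in_compose[OF 2 this]
  show "((\<lambda>\<xi>. \<phi> (\<xi>, t)) has_real_derivative a) (at x)" "((\<lambda>s. \<phi> (x, s)) has_real_derivative b) (at t)"
    by (simp_all add: has_field_derivative_def mult_commute_abs)
qed

context trunc
begin

definition dflux where "dflux c x u = flux \<eta> x u - flux \<eta> x c"

lemma dflux_eq: "dflux c x u = x * (P \<eta> u - P \<eta> c) - (u\<^sup>2 - c\<^sup>2) / 2"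
  by (simp add: dflux_def flux_eq algebra_simps diff_divide_distrib)

lemma flux_deriv_x: "((\<lambda>\<xi>. flux \<eta> \<xi> c) has_real_derivative P \<eta> c - x) (at x)"
  unfolding flux_eq by (auto intro!: derivative_eq_intros)

text \<open>The flux difference vanishes linearly where \<open>Y = c\<close>. This controls the
  smoothing error there and bounds the Kruzhkov integrand.\<close>

lemma dflux_lip:
  assumes "\<bar>u\<bar> \<le> B" "\<bar>c\<bar> \<le> B" "\<bar>x\<bar> \<le> 1"
  shows "\<bar>dflux c x u\<bar> \<le> (2 * B + 2 * \<eta>) * \<bar>u - c\<bar>"
proof -
  have "norm (P \<eta> u - P \<eta> c) \<le> (B + 2 * \<eta>) * norm (u - c)"
  proof (rule field_differentiable_bound[of "{-B..B}" "P \<eta>" "\<lambda>y. \<bar>y\<bar> + 2 * \<eta>"])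
    show "(P \<eta> has_real_derivative \<bar>z\<bar> + 2 * \<eta>) (at z within {-B..B})" for z
      by (rule has_field_derivative_at_within[OF P_deriv])
  qed (use assms eta in auto)
  then have "\<bar>x * (P \<eta> u - P \<eta> c)\<bar> \<le> 1 * ((B + 2 * \<eta>) * \<bar>u - c\<bar>)"
    unfolding abs_mult using assms by (intro mult_mono) auto
  moreover have "\<bar>(u\<^sup>2 - c\<^sup>2) / 2\<bar> \<le> B * \<bar>u - c\<bar>"
  proof -
    have "(u\<^sup>2 - c\<^sup>2) / 2 = ((u + c) / 2) * (u - c)" by (simp add: power2_eq_square algebra_simps)
    then have "\<bar>(u\<^sup>2 - c\<^sup>2) / 2\<bar> = \<bar>(u + c) / 2\<bar> * \<bar>u - c\<bar>" by (simp only: abs_mult)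
    also have "\<dots> \<le> B * \<bar>u - c\<bar>" using assms by (intro mult_right_mono) auto
    finally show ?thesis .
  qed
  moreover have "(2 * B + 2 * \<eta>) * \<bar>u - c\<bar> = 1 * ((B + 2 * \<eta>) * \<bar>u - c\<bar>) + B * \<bar>u - c\<bar>"
    by (simp add: algebra_simps)
  ultimately show ?thesis unfolding dflux_eq by linarith
qed

text \<open>The integrand of the entropy inequality, with the partial derivatives of the test
  function supplied as functions and the derivative of the flux in \<open>x\<close>
  evaluated.\<close>

definition kruzhkov where
  "kruzhkov c \<phi> fx ft p = (let u = Y (fst p) (snd p) in
     \<bar>u - c\<bar> * ft p + sgn (u - c) * dflux c (fst p) u * fx p - sgn (u - c) * (P \<eta> c - fst p) * \<phi> p)"

lemma Y_fun_abs_le: "\<bar>x\<bar> \<le> 1 \<Longrightarrow> 0 \<le> t \<Longrightarrow> \<bar>Y x t\<bar> \<le> 2"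
proof -
  assume "\<bar>x\<bar> \<le> 1" "0 \<le> t"
  then have "\<bar>Y x t\<bar> \<le> sqrt 2"
    using Y_fun_bounds[of x t] Y_fun_bounds[of "- x" t] Y_fun_odd[of x t]
    by (cases "0 \<le> x") (auto simp: abs_le_iff)
  moreover have "sqrt 2 < 2" by (rule real_less_lsqrt) auto
  ultimately show ?thesis by simp
qed

text \<open>Smoothing \<open>sgn\<close> to \<open>\<sigma> u = 2 / pi * arctan (n * u)\<close>, the entropy pair \<open>(\<sigma> u * u, \<sigma> u * dflux)\<close> satisfies
  its balance law up to a term \<open>\<sigma>' u * (u * Yt + dflux * Yx)\<close>, which is bounded and tends to \<open>0\<close>
  because \<open>dflux = O(u)\<close> and \<open>\<sigma>' u * u\<close> tends to \<open>0\<close> boundedly.\<close>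

lemma kruzhkov_box:
  fixes \<phi> fx ft :: "real \<times> real \<Rightarrow> real" and c :: real
  assumes ab: "\<alpha> \<le> \<beta>" "a \<le> b" "0 < a" and box: "\<And>x. \<alpha> \<le> x \<Longrightarrow> x \<le> \<beta> \<Longrightarrow> \<bar>x\<bar> \<le> 1 \<and> x \<noteq> 0"
    and c\<phi>: "continuous_on UNIV \<phi>" "continuous_on UNIV fx" "continuous_on UNIV ft"
    and dx: "\<And>x t. ((\<lambda>\<xi>. \<phi> (\<xi>, t)) has_real_derivative fx (x, t)) (at x)"
    and dt: "\<And>x t. ((\<lambda>s. \<phi> (x, s)) has_real_derivative ft (x, t)) (at t)"
    and zero: "\<And>x. \<phi> (x, a) = 0" "\<And>x. \<phi> (x, b) = 0"
  defines "Q \<equiv> \<lambda>x t. sgn (Y x t - c) * dflux c x (Y x t) * \<phi> (x, t)"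
  shows "kruzhkov c \<phi> fx ft integrable_on cbox (\<alpha>, a) (\<beta>, b)"
    and "(\<lambda>t. Q \<beta> t - Q \<alpha> t) integrable_on {a..b}"
    and "integral (cbox (\<alpha>, a) (\<beta>, b)) (kruzhkov c \<phi> fx ft) = integral {a..b} (\<lambda>t. Q \<beta> t - Q \<alpha> t)"
proof -
  let ?B = "cbox (\<alpha>, a) (\<beta>, b)"
  have B_iff: "p \<in> ?B \<longleftrightarrow> \<alpha> \<le> fst p \<and> fst p \<le> \<beta> \<and> a \<le> snd p \<and> snd p \<le> b" for p
    by (cases p) auto
  have BD: "p \<in> Dom" if "p \<in> ?B" for p
    using that box[of "fst p"] ab by (cases p) (auto simp: Dom_def abs_le_iff)
  define u where "u p = Y (fst p) (snd p) - c" for p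
  define \<Delta> where "\<Delta> p = dflux c (fst p) (Y (fst p) (snd p))" for p
  define \<sigma> where "\<sigma> n w = 2 / pi * arctan (real n * w)" for n w
  define \<sigma>' where "\<sigma>' n w = 2 / pi * (real n / (1 + (real n * w)\<^sup>2))" for n w
  have \<sigma>_deriv: "(\<sigma> n has_real_derivative \<sigma>' n w) (at w)" for n w
    unfolding \<sigma>_def[abs_def] \<sigma>'_def
    by (auto intro!: derivative_eq_intros simp: inverse_eq_divide mult_ac)
  have u_deriv_x: "((\<lambda>\<xi>. u (\<xi>, t)) has_real_derivative Yx (x, t)) (at x within {\<alpha>..\<beta>})"
    and \<Delta>_deriv_x: "((\<lambda>\<xi>. \<Delta> (\<xi>, t)) has_real_derivative - Yt (x, t) - (P \<eta> c - x)) (at x within {\<alpha>..\<beta>})"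
    and u_deriv_t: "((\<lambda>s. u (x, s)) has_real_derivative Yt (x, t)) (at t within {a..b})"
    if xt: "\<alpha> \<le> x" "x \<le> \<beta>" "a \<le> t" "t \<le> b" for x t
  proof -
    have D: "(x, t) \<in> Dom" using BD[of "(x, t)"] B_iff xt by simp
    have sub: "{\<alpha>..\<beta>} \<subseteq> {-1..1}" using box by (force simp: abs_le_iff)
    have Yd: "((\<lambda>\<xi>. Y \<xi> t) has_real_derivative Yx (x, t)) (at x within {\<alpha>..\<beta>})"
      by (rule has_field_derivative_subset[OF Y_deriv_x[OF D] sub])
    then show "((\<lambda>\<xi>. u (\<xi>, t)) has_real_derivative Yx (x, t)) (at x within {\<alpha>..\<beta>})"
      unfolding u_def fst_conv snd_conv using DERIV_diff[OF Yd DERIV_const] by simp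
    have "((\<lambda>s. Y x s) has_real_derivative Yt (x, t)) (at t within {a..b})"
      by (rule has_field_derivative_subset[OF Y_deriv_t[OF D]]) (use box xt ab in auto)
    from DERIV_diff[OF this DERIV_const]
    show "((\<lambda>s. u (x, s)) has_real_derivative Yt (x, t)) (at t within {a..b})"
      unfolding u_def fst_conv snd_conv by simp
    have "((\<lambda>\<xi>. flux \<eta> \<xi> (Y \<xi> t)) has_real_derivative - Yt (x, t)) (at x within {\<alpha>..\<beta>})"
      using flux_deriv[OF D] by (rule has_field_derivative_subset) (rule sub)
    then show "((\<lambda>\<xi>. \<Delta> (\<xi>, t)) has_real_derivative - Yt (x, t) - (P \<eta> c - x)) (at x within {\<alpha>..\<beta>})"
      unfolding \<Delta>_def dflux_def fst_conv snd_conv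
      by (intro DERIV_diff has_field_derivative_at_within[OF flux_deriv_x])
  qed
  have Yc: "continuous_on ?B (\<lambda>p. Y (fst p) (snd p))"
    using continuous_on_subset[OF Y_cont subsetI[OF BD]] by (simp add: case_prod_unfold)
  have uc: "continuous_on ?B u" unfolding u_def by (intro continuous_intros Yc)
  have \<Delta>c: "continuous_on ?B \<Delta>"
    unfolding \<Delta>_def dflux_eq by (intro continuous_intros Yc continuous_on_compose2[OF P_cont[of UNIV]]) auto
  have nz: "1 + w\<^sup>2 \<noteq> 0" for w :: real
    using zero_le_power2[of w] by linarith
  have \<sigma>c: "continuous_on ?B (\<lambda>p. \<sigma> n (u p))" for n
    unfolding \<sigma>_def by (intro continuous_intros uc)
  have \<sigma>'c: "continuous_on ?B (\<lambda>p. \<sigma>' n (u p))" for n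
    unfolding \<sigma>'_def by (intro continuous_intros uc ballI nz)
  have Yxc: "continuous_on ?B Yx" and Ytc: "continuous_on ?B Yt"
    by (rule continuous_on_subset[OF Yx_cont] continuous_on_subset[OF Yt_cont]; use BD in auto)+
  have cs: "continuous_on ?B \<phi>" "continuous_on ?B fx" "continuous_on ?B ft"
    using c\<phi> by (auto intro: continuous_on_subset)
  note conts = uc \<Delta>c \<sigma>c \<sigma>'c Yxc Ytc cs
  \<comment> \<open>\<open>A\<close> is the time derivative of
    \<open>\<sigma> u * u * \<phi>\<close> and integrates to 0 because \<open>\<phi>\<close>
    vanishes at \<open>a\<close> and \<open>b\<close>; \<open>E\<close> is the space derivative of
    \<open>\<sigma> u * \<Delta> * \<phi>\<close> and leaves the boundary terms at
    \<open>\<alpha>\<close> and \<open>\<beta>\<close>.\<close>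
  define A where "A n p = ((\<sigma>' n (u p) * Yt p) * u p + Yt p * \<sigma> n (u p)) * \<phi> p + ft p * (\<sigma> n (u p) * u p)" for n p
  define E where "E n p = ((\<sigma>' n (u p) * Yx p) * \<Delta> p + (- Yt p - (P \<eta> c - fst p)) * \<sigma> n (u p)) * \<phi> p
      + fx p * (\<sigma> n (u p) * \<Delta> p)" for n p
  have Ac: "continuous_on ?B (A n)" and Ec: "continuous_on ?B (E n)" for n
    unfolding A_def E_def by (intro continuous_intros conts)+
  have A_int: "integral ?B (A n) = 0" for n
  proof -
    have "integral (cbox a b) (\<lambda>t. A n (x, t)) = 0" if x: "x \<in> cbox \<alpha> \<beta>" for x
    proof -
      have "((\<lambda>t. A n (x, t)) has_integral
          (\<sigma> n (u (x, b)) * u (x, b)) * \<phi> (x, b) - (\<sigma> n (u (x, a)) * u (x, a)) * \<phi> (x, a)) {a..b}"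
      proof (rule fundamental_theorem_of_calculus[OF ab(2)])
        fix t assume t: "t \<in> {a..b}"
        have ut: "((\<lambda>s. u (x, s)) has_real_derivative Yt (x, t)) (at t within {a..b})"
          by (rule u_deriv_t) (use x t in auto)
        have "((\<lambda>s. (\<sigma> n (u (x, s)) * u (x, s)) * \<phi> (x, s)) has_real_derivative A n (x, t)) (at t within {a..b})"
          unfolding A_def
          by (intro DERIV_mult ut has_field_derivative_at_within[OF dt] DERIV_chain2[OF \<sigma>_deriv ut])
        then show "((\<lambda>s. (\<sigma> n (u (x, s)) * u (x, s)) * \<phi> (x, s)) has_vector_derivative A n (x, t)) (at t within {a..b})"
          by (simp add: has_real_derivative_iff_has_vector_derivative)
      qed
      then show ?thesis by (simp add: zero integral_unique)
    qed
    then have "integral (cbox \<alpha> \<beta>) (\<lambda>x. integral (cbox a b) (\<lambda>t. A n (x, t))) = integral (cbox \<alpha> \<beta>) (\<lambda>x. 0)"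
      by (rule integral_cong)
    then show ?thesis by (simp add: integral_prod_continuous[OF Ac])
  qed
  define q where "q n x t = \<sigma> n (u (x, t)) * \<Delta> (x, t) * \<phi> (x, t)" for n x t
  have E_int: "integral ?B (E n) = integral {a..b} (\<lambda>t. q n \<beta> t - q n \<alpha> t)" for n
  proof -
    have "integral (cbox \<alpha> \<beta>) (\<lambda>x. E n (x, t)) = q n \<beta> t - q n \<alpha> t" if t: "t \<in> cbox a b" for t
    proof -
      have "((\<lambda>x. E n (x, t)) has_integral (q n \<beta> t - q n \<alpha> t)) {\<alpha>..\<beta>}"
      proof (rule fundamental_theorem_of_calculus[OF ab(1)])
        fix x assume x: "x \<in> {\<alpha>..\<beta>}"
        have ux: "((\<lambda>\<xi>. u (\<xi>, t)) has_real_derivative Yx (x, t)) (at x within {\<alpha>..\<beta>})"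
          and dx': "((\<lambda>\<xi>. \<Delta> (\<xi>, t)) has_real_derivative - Yt (x, t) - (P \<eta> c - fst (x, t))) (at x within {\<alpha>..\<beta>})"
          using u_deriv_x[of x t] \<Delta>_deriv_x[of x t] x t by auto
        have "((\<lambda>x. q n x t) has_real_derivative E n (x, t)) (at x within {\<alpha>..\<beta>})"
          unfolding E_def q_def
          by (intro DERIV_mult ux dx' has_field_derivative_at_within[OF dx] DERIV_chain2[OF \<sigma>_deriv ux])
        then show "((\<lambda>x. q n x t) has_vector_derivative E n (x, t)) (at x within {\<alpha>..\<beta>})"
          by (simp add: has_real_derivative_iff_has_vector_derivative)
      qed
      then show ?thesis by (simp add: integral_unique)
    qed
    then have "integral (cbox a b) (\<lambda>t. integral (cbox \<alpha> \<beta>) (\<lambda>x. E n (x, t)))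
        = integral (cbox a b) (\<lambda>t. q n \<beta> t - q n \<alpha> t)"
      by (rule integral_cong)
    then show ?thesis
      using integral_prod_continuous[OF Ec] integral_swap_continuous[of \<alpha> a \<beta> b "\<lambda>x t. E n (x, t)"] Ec
      by simp
  qed
  define J where "J n p = A n p + E n p" for n p
  have Jc: "continuous_on ?B (J n)" for n unfolding J_def by (intro continuous_intros Ac Ec)
  have J_int: "integral ?B (J n) = integral {a..b} (\<lambda>t. q n \<beta> t - q n \<alpha> t)" for n
    unfolding J_def using A_int E_int by (simp add: integral_add integrable_continuous Ac Ec)
  define r where "r n p = \<sigma>' n (u p) * (u p * Yt p + \<Delta> p * Yx p)" for n p
  \<comment> \<open>The terms \<open>\<sigma> u * Yt * \<phi>\<close> of \<open>A\<close> and
    \<open>E\<close> cancel, which is the conservation law; only \<open>r\<close> still contains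
    derivatives of \<open>Y\<close>.\<close>
  have J_eq: "J n p = \<sigma> n (u p) * u p * ft p + \<sigma> n (u p) * \<Delta> p * fx p
      - \<sigma> n (u p) * (P \<eta> c - fst p) * \<phi> p + r n p * \<phi> p" for n p
    by (simp add: J_def A_def E_def r_def algebra_simps)
  define Lf where "Lf = 2 * max 2 \<bar>c\<bar> + 2 * \<eta>"
  have Lf: "0 \<le> Lf" using eta by (simp add: Lf_def)
  have \<Delta>_le: "\<bar>\<Delta> p\<bar> \<le> Lf * \<bar>u p\<bar>" if p: "p \<in> ?B" for p
    unfolding \<Delta>_def u_def Lf_def
    using box[of "fst p"] p ab Y_fun_abs_le[of "fst p" "snd p"]
    by (intro dflux_lip) (auto simp: B_iff le_max_iff_disj)
  have r_le: "\<bar>r n p\<bar> \<le> \<bar>\<sigma>' n (u p) * u p\<bar> * (\<bar>Yt p\<bar> + Lf * \<bar>Yx p\<bar>)" if p: "p \<in> ?B" for n p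
  proof -
    have "\<bar>u p * Yt p + \<Delta> p * Yx p\<bar> \<le> \<bar>u p\<bar> * \<bar>Yt p\<bar> + \<bar>\<Delta> p\<bar> * \<bar>Yx p\<bar>"
      by (metis abs_mult abs_triangle_ineq)
    also have "\<dots> \<le> \<bar>u p\<bar> * \<bar>Yt p\<bar> + (Lf * \<bar>u p\<bar>) * \<bar>Yx p\<bar>"
      using \<Delta>_le[OF p] by (intro add_left_mono mult_right_mono) auto
    also have "\<dots> = \<bar>u p\<bar> * (\<bar>Yt p\<bar> + Lf * \<bar>Yx p\<bar>)" by (simp add: algebra_simps)
    finally show ?thesis unfolding r_def abs_mult by (simp add: mult.assoc mult_left_mono)
  qed
  have \<sigma>_le: "\<bar>\<sigma> n w\<bar> \<le> 1" for n w unfolding \<sigma>_def by (rule arctan_smoothing_bound)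
  have \<sigma>'_le: "\<bar>\<sigma>' n w * w\<bar> \<le> 1" for n w unfolding \<sigma>'_def by (rule smoothing_deriv_bound)
  \<comment> \<open>A continuous majorant independent of \<open>n\<close>, available because
    derivatives of \<open>Y\<close> are continuous on a box that avoids
    \<open>x = 0\<close>.\<close>
  define h where "h p = \<bar>u p * ft p\<bar> + \<bar>\<Delta> p * fx p\<bar> + \<bar>(P \<eta> c - fst p) * \<phi> p\<bar> + (\<bar>Yt p\<bar> + Lf * \<bar>Yx p\<bar>) * \<bar>\<phi> p\<bar>" for p
  have hc: "continuous_on ?B h" unfolding h_def by (intro continuous_intros conts)
  have mult_le: "\<bar>\<sigma> n w * v * k\<bar> \<le> \<bar>v * k\<bar>" for n w v k
    using mult_right_mono[OF \<sigma>_le, of "\<bar>v * k\<bar>" n w] by (simp add: abs_mult mult.assoc)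
  have J_le: "norm (J n p) \<le> h p" if p: "p \<in> ?B" for n p
  proof -
    have "\<bar>r n p * \<phi> p\<bar> \<le> (\<bar>Yt p\<bar> + Lf * \<bar>Yx p\<bar>) * \<bar>\<phi> p\<bar>"
    proof -
      have "\<bar>r n p\<bar> \<le> 1 * (\<bar>Yt p\<bar> + Lf * \<bar>Yx p\<bar>)"
        using r_le[OF p, of n] \<sigma>'_le[of n "u p"] Lf
        by (intro order.trans[OF r_le[OF p]] mult_right_mono) (auto intro!: add_nonneg_nonneg mult_nonneg_nonneg)
      then show ?thesis by (simp add: abs_mult mult_right_mono)
    qed
    note last = this
    have tri: "\<bar>w1 + w2 - w3 + w4\<bar> \<le> W1 + W2 + W3 + W4"
      if "\<bar>w1\<bar> \<le> W1" "\<bar>w2\<bar> \<le> W2" "\<bar>w3\<bar> \<le> W3" "\<bar>w4\<bar> \<le> W4" for w1 w2 w3 w4 W1 W2 W3 W4 :: real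
      using that by linarith
    show ?thesis
      unfolding J_eq h_def real_norm_def by (rule tri[OF mult_le mult_le mult_le last])
  qed
  have \<sigma>_lim: "(\<lambda>n. \<sigma> n w) \<longlonglongrightarrow> sgn w" for w unfolding \<sigma>_def by (rule tendsto_arctan_sgn)
  have r_lim: "(\<lambda>n. r n p) \<longlonglongrightarrow> 0" if p: "p \<in> ?B" for p
  proof (rule Lim_null_comparison)
    show "\<forall>\<^sub>F n in sequentially. norm (r n p) \<le> \<bar>\<sigma>' n (u p) * u p\<bar> * (\<bar>Yt p\<bar> + Lf * \<bar>Yx p\<bar>)"
      using r_le[OF p] by simp
    have "(\<lambda>n. \<bar>\<sigma>' n (u p) * u p\<bar> * (\<bar>Yt p\<bar> + Lf * \<bar>Yx p\<bar>)) \<longlonglongrightarrow> \<bar>0\<bar> * (\<bar>Yt p\<bar> + Lf * \<bar>Yx p\<bar>)"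
      unfolding \<sigma>'_def by (intro tendsto_intros smoothing_deriv_tendsto)
    then show "(\<lambda>n. \<bar>\<sigma>' n (u p) * u p\<bar> * (\<bar>Yt p\<bar> + Lf * \<bar>Yx p\<bar>)) \<longlonglongrightarrow> 0" by simp
  qed
  have J_lim: "(\<lambda>n. J n p) \<longlonglongrightarrow> kruzhkov c \<phi> fx ft p" if p: "p \<in> ?B" for p
  proof -
    have "(\<lambda>n. J n p) \<longlonglongrightarrow> sgn (u p) * u p * ft p + sgn (u p) * \<Delta> p * fx p
      - sgn (u p) * (P \<eta> c - fst p) * \<phi> p + 0 * \<phi> p"
      unfolding J_eq by (intro tendsto_intros \<sigma>_lim r_lim p)
    moreover have "sgn (u p) * u p = \<bar>u p\<bar>" by (metis abs_sgn mult.commute)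
    ultimately show ?thesis
      unfolding kruzhkov_def Let_def u_def \<Delta>_def by simp
  qed
  note dc = dominated_convergence[of J ?B h "kruzhkov c \<phi> fx ft", OF integrable_continuous[OF Jc] integrable_continuous[OF hc] J_le J_lim]
  show "kruzhkov c \<phi> fx ft integrable_on ?B" by (rule dc(1))
  have slice: "continuous_on {a..b} (\<lambda>t. g (x, t))" if g: "continuous_on ?B g" and x: "\<alpha> \<le> x" "x \<le> \<beta>"
    for g :: "real \<times> real \<Rightarrow> real" and x
    by (rule continuous_on_compose2[OF g]) (use x in \<open>auto intro!: continuous_intros\<close>)
  define h' where "h' t = \<bar>\<Delta> (\<beta>, t) * \<phi> (\<beta>, t)\<bar> + \<bar>\<Delta> (\<alpha>, t) * \<phi> (\<alpha>, t)\<bar>" for t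
  have qc: "continuous_on {a..b} (\<lambda>t. q n x t)" if "\<alpha> \<le> x" "x \<le> \<beta>" for n x
    unfolding q_def by (intro continuous_intros slice[OF \<sigma>c that] slice[OF \<Delta>c that] slice[OF cs(1) that])
  have h'c: "continuous_on {a..b} h'"
    unfolding h'_def using ab by (intro continuous_intros slice[OF \<Delta>c] slice[OF cs(1)]) auto
  have q_le: "norm (q n \<beta> t - q n \<alpha> t) \<le> h' t" for n t
    unfolding q_def h'_def real_norm_def
    by (intro order.trans[OF abs_triangle_ineq4] add_mono mult_le)
  have q_lim: "(\<lambda>n. q n \<beta> t - q n \<alpha> t) \<longlonglongrightarrow> Q \<beta> t - Q \<alpha> t" for t
  proof -
    have "(\<lambda>n. q n x t) \<longlonglongrightarrow> sgn (u (x, t)) * \<Delta> (x, t) * \<phi> (x, t)" for x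
      unfolding q_def by (intro tendsto_intros \<sigma>_lim)
    then have "(\<lambda>n. q n x t) \<longlonglongrightarrow> Q x t" for x
      by (simp add: Q_def u_def \<Delta>_def)
    then show ?thesis by (intro tendsto_diff)
  qed
  have qd: "(\<lambda>t. q n \<beta> t - q n \<alpha> t) integrable_on {a..b}" for n
    using ab by (intro integrable_continuous_real continuous_on_diff qc) auto
  note dc' = dominated_convergence[of "\<lambda>n t. q n \<beta> t - q n \<alpha> t" "{a..b}" h' "\<lambda>t. Q \<beta> t - Q \<alpha> t",
      OF qd integrable_continuous_real[OF h'c] q_le q_lim]
  show "(\<lambda>t. Q \<beta> t - Q \<alpha> t) integrable_on {a..b}" by (rule dc'(1))
  have "(\<lambda>n. integral ?B (J n)) \<longlonglongrightarrow> integral {a..b} (\<lambda>t. Q \<beta> t - Q \<alpha> t)"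
    unfolding J_int by (rule dc'(2))
  from LIMSEQ_unique[OF dc(2) this]
  show "integral ?B (kruzhkov c \<phi> fx ft) = integral {a..b} (\<lambda>t. Q \<beta> t - Q \<alpha> t)" .
qed


section \<open>Measurability and the initial datum\<close>

text \<open>Off the line \<open>x = 0\<close> the function is continuous at all times, and on that
  line it is 0, so the closed strip with the line removed carries the whole function.\<close>

lemma Y_fun_measurable:
  "(\<lambda>p. indicator ({-1..1} \<times> {0..}) p *\<^sub>R Y (fst p) (snd p)) \<in> borel_measurable borel"
proof -
  define S :: "(real \<times> real) set" where "S = {-1..1} \<times> {0..} - {0} \<times> UNIV"
  have "S \<in> sets borel"
    unfolding S_def by (intro sets.Diff borel_closed closed_Times) auto
  moreover have "continuous_on S (\<lambda>p. Y (fst p) (snd p))"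
    using continuous_on_subset[OF Y_cont, of S] by (force simp: case_prod_unfold S_def Dom_def)
  ultimately have "(\<lambda>p. indicator S p *\<^sub>R Y (fst p) (snd p)) \<in> borel_measurable borel"
    by (rule borel_measurable_continuous_on_indicator)
  moreover have "(\<lambda>p. indicator S p *\<^sub>R Y (fst p) (snd p))
      = (\<lambda>p. indicator ({-1..1} \<times> {0..}) p *\<^sub>R Y (fst p) (snd p))"
    by (auto simp: S_def indicator_def Y_fun_at_0 fun_eq_iff)
  ultimately show ?thesis by (simp only:)
qed

lemma Y_fun_tendsto_0:
  assumes x: "\<bar>x\<bar> \<le> 1"
  shows "((\<lambda>t. Y x t) \<longlongrightarrow> 0) (at_right 0)"
proof (cases "x = 0")
  case True
  have "\<forall>\<^sub>F t in at_right 0. 0 = Y x t"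
    using eventually_at_right_less[of "0::real"] by eventually_elim (simp add: True Y_fun_at_0)
  then show ?thesis by (rule Lim_transform_eventually[OF tendsto_const])
next
  case False
  then have "(x, 0) \<in> Dom" using x by (auto simp: Dom_def abs_le_iff)
  from DERIV_continuous[OF Y_deriv_t[OF this False]]
  show ?thesis using x by (simp add: continuous_within Y_fun_0 at_within_Ici_at_right)
qed

text \<open>Pointwise attainment of the datum and the uniform bound 2 give convergence in the mean
  by dominated convergence along sequences.\<close>

lemma Y_fun_L1: "((\<lambda>t. LBINT x:{-1..1}. \<bar>Y x t - 0\<bar>) \<longlongrightarrow> 0) (at_right 0)"
proof (rule tendsto_at_right_sequentially[where b = 1])
  fix S :: "nat \<Rightarrow> real"
  assume S: "\<And>n. 0 < S n" "S \<longlonglongrightarrow> 0"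
  have "(\<lambda>n. \<integral>x. indicator {-1..1} x *\<^sub>R \<bar>Y x (S n) - 0\<bar> \<partial>lborel) \<longlonglongrightarrow> (\<integral>x. 0 \<partial>(lborel :: real measure))"
  proof (rule integral_dominated_convergence[where w = "\<lambda>x. indicator {-1..1} x * 2"])
    fix n
    have "(\<lambda>x. (x, S n)) \<in> borel_measurable (lborel :: real measure)" by measurable
    from measurable_compose[OF this Y_fun_measurable]
    have "(\<lambda>x. \<bar>indicator ({-1..1} \<times> {0..}) (x, S n) *\<^sub>R Y x (S n)\<bar>) \<in> borel_measurable (lborel :: real measure)"
      by (intro borel_measurable_abs) simp
    moreover have "\<bar>indicator ({-1..1} \<times> {0..}) (x, S n) *\<^sub>R Y x (S n)\<bar>
        = indicator {-1..1} x *\<^sub>R \<bar>Y x (S n) - 0\<bar>" for x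
      using S(1)[of n] by (auto simp: indicator_def)
    ultimately show "(\<lambda>x. indicator {-1..1} x *\<^sub>R \<bar>Y x (S n) - 0\<bar>) \<in> borel_measurable lborel"
      by simp
    show "AE x in lborel. norm (indicator {-1..1} x *\<^sub>R \<bar>Y x (S n) - 0\<bar>) \<le> indicator {-1..1} x * 2"
      using Y_fun_abs_le S(1)[of n] by (intro AE_I2) (auto simp: indicator_def abs_le_iff)
  next
    show "integrable lborel (\<lambda>x :: real. indicator {-1..1} x * 2 :: real)"
      by (intro integrable_mult_left integrable_real_indicator) auto
    have "(\<lambda>n. indicator {-1..1} x *\<^sub>R \<bar>Y x (S n) - 0\<bar>) \<longlonglongrightarrow> 0" for x :: real
    proof (cases "x \<in> {-1..1}")
      case True
      then have "(\<lambda>n. Y x (S n)) \<longlonglongrightarrow> 0"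
        using S by (intro filterlim_compose[OF Y_fun_tendsto_0])
          (auto simp: filterlim_at abs_le_iff less_imp_neq[OF S(1), symmetric])
      then have "(\<lambda>n. \<bar>Y x (S n) - 0\<bar>) \<longlonglongrightarrow> \<bar>0 - 0\<bar>" by (intro tendsto_intros)
      then show ?thesis using True by simp
    qed simp
    then show "AE x in lborel. (\<lambda>n. indicator {-1..1} x *\<^sub>R \<bar>Y x (S n) - 0\<bar>) \<longlonglongrightarrow> 0"
      by (intro AE_I2)
  qed simp
  then show "(\<lambda>n. LBINT x:{-1..1}. \<bar>Y x (S n) - 0\<bar>) \<longlonglongrightarrow> 0"
    by (simp add: set_lebesgue_integral_def)
qed simp

section \<open>Entropy flux across the shock and passage to the limit\<close>

text \<open>The traces of \<open>Y\<close> at \<open>x = d\<close> and \<open>x = -d\<close> are opposite and the flux is even, so up to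
  \<open>O(d)\<close> the entropy flux through the strip is \<open>(sgn (w - c) + sgn (w + c)) * (w^2 - c^2) / 2 \<ge> 0\<close>.\<close>

lemma strip_flux_bound:
  assumes w: "0 \<le> w" "w \<le> 2" and d: "0 \<le> d"
    and f: "0 \<le> f0" "\<bar>f1 - f0\<bar> \<le> M * d" "\<bar>f2 - f0\<bar> \<le> M * d" "\<bar>f1\<bar> \<le> N" "\<bar>f2\<bar> \<le> N"
  shows "- (d * ((4 + c\<^sup>2) * M + 2 * (P \<eta> 2 + \<bar>P \<eta> c\<bar>) * N))
    \<le> sgn (- w - c) * dflux c (- d) (- w) * f1 - sgn (w - c) * dflux c d w * f2"
proof -
  define k where "k = (w\<^sup>2 - c\<^sup>2) / 2"
  define B where "B = P \<eta> 2 + \<bar>P \<eta> c\<bar>"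
  define s1 s2 where "s1 = sgn (- w - c)" and "s2 = sgn (w - c)"
  have s: "\<bar>s1\<bar> \<le> 1" "\<bar>s2\<bar> \<le> 1" by (auto simp: s1_def s2_def sgn_if)
  have Pw: "0 \<le> P \<eta> w" "P \<eta> w \<le> P \<eta> 2"
    using P_nonneg[OF w(1)] mult_mono[OF w(2) w(2)] mult_left_mono[OF w(2) eta(1)] w by (auto simp: P_def)
  have B0: "0 \<le> B" using Pw by (simp add: B_def)
  have e: "\<bar>\<sigma> * (d * q) * g\<bar> \<le> d * B * N" if "\<bar>\<sigma>\<bar> \<le> 1" "\<bar>q\<bar> \<le> B" "\<bar>g\<bar> \<le> N" for \<sigma> q g
  proof -
    have "\<bar>\<sigma>\<bar> * (d * \<bar>q\<bar>) \<le> 1 * (d * B)" using that d by (intro mult_mono mult_left_mono) auto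
    then have "\<bar>\<sigma>\<bar> * (d * \<bar>q\<bar>) * \<bar>g\<bar> \<le> (1 * (d * B)) * N"
      by (rule mult_mono[OF _ that(3)]) (simp_all add: B0 d)
    then show ?thesis using d by (simp add: abs_mult)
  qed
  have PB: "\<bar>P \<eta> w + P \<eta> c\<bar> \<le> B" "\<bar>P \<eta> w - P \<eta> c\<bar> \<le> B"
    using Pw by (simp_all add: B_def)
  have e1: "\<bar>s1 * (d * (P \<eta> w + P \<eta> c)) * f1\<bar> \<le> d * B * N"
    and e2: "\<bar>s2 * (d * (P \<eta> w - P \<eta> c)) * f2\<bar> \<le> d * B * N"
    by (intro e s f PB)+
  have k: "\<bar>k\<bar> \<le> (4 + c\<^sup>2) / 2"
  proof -
    have "w\<^sup>2 \<le> 4" using power_mono[OF w(2,1), of 2] by simp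
    moreover have "\<bar>(p - q) / 2\<bar> \<le> (4 + q) / 2" if "p \<le> 4" "0 \<le> q" "0 \<le> p" for p q :: real
      using that by (auto simp: abs_if field_simps)
    ultimately show ?thesis by (simp only: k_def zero_le_power2)
  qed
  have e': "\<bar>\<sigma> * k * g\<bar> \<le> (4 + c\<^sup>2) / 2 * (M * d)" if "\<bar>\<sigma>\<bar> \<le> 1" "\<bar>g\<bar> \<le> M * d" for \<sigma> g
  proof -
    have "\<bar>\<sigma> * k\<bar> \<le> 1 * ((4 + c\<^sup>2) / 2)" unfolding abs_mult using that k by (intro mult_mono) auto
    then have "\<bar>\<sigma> * k\<bar> * \<bar>g\<bar> \<le> (4 + c\<^sup>2) / 2 * (M * d)" using that by (intro mult_mono) auto
    then show ?thesis by (simp add: abs_mult)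
  qed
  note e3 = e'[OF s(1) f(2)] and e4 = e'[OF s(2) f(3)]
  \<comment> \<open>For \<open>\<bar>c\<bar> \<le> w\<close> both \<open>k\<close> and
    \<open>s2 - s1\<close> are nonnegative; otherwise \<open>c\<close> lies outside the jump, the
    two signs agree and the product is 0.\<close>
  have main: "0 \<le> (s2 - s1) * k * f0"
  proof -
    consider "\<bar>c\<bar> \<le> w" | "w < c" | "c < - w" by linarith
    then have "0 \<le> (s2 - s1) * k"
    proof cases
      case 1
      then have "c\<^sup>2 \<le> w\<^sup>2" using w by (simp add: abs_le_square_iff[symmetric])
      then have "0 \<le> k" by (simp add: k_def)
      moreover have "0 \<le> s2 - s1" using 1 by (auto simp: s1_def s2_def sgn_if)
      ultimately show ?thesis by simp
    qed (use w in \<open>auto simp: s1_def s2_def sgn_if\<close>)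
    then show ?thesis using f by simp
  qed
  have dk: "dflux c (- d) (- w) = d * (P \<eta> w + P \<eta> c) - k" "dflux c d w = d * (P \<eta> w - P \<eta> c) - k"
    by (simp_all add: dflux_eq k_def algebra_simps)
  have "s1 * dflux c (- d) (- w) * f1 - s2 * dflux c d w * f2
     = (s2 - s1) * k * f0 + s1 * (d * (P \<eta> w + P \<eta> c)) * f1 - s2 * (d * (P \<eta> w - P \<eta> c)) * f2
       - s1 * k * (f1 - f0) + s2 * k * (f2 - f0)"
    unfolding dk by (simp add: algebra_simps)
  moreover have "d * ((4 + c\<^sup>2) * M + 2 * (P \<eta> 2 + \<bar>P \<eta> c\<bar>) * N)
      = 2 * (d * B * N) + 2 * ((4 + c\<^sup>2) / 2 * (M * d))"
    by (simp add: B_def algebra_simps)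
  ultimately show ?thesis
    using main abs_ge_minus_self[of "s1 * (d * (P \<eta> w + P \<eta> c)) * f1"] e1
      abs_ge_self[of "s2 * (d * (P \<eta> w - P \<eta> c)) * f2"] e2
      abs_ge_self[of "s1 * k * (f1 - f0)"] e3 abs_ge_minus_self[of "s2 * k * (f2 - f0)"] e4
    unfolding s1_def[symmetric] s2_def[symmetric] by linarith
qed

lemma kruzhkov_integral_nonneg:
  fixes \<phi> fx ft :: "real \<times> real \<Rightarrow> real" and c :: real
  assumes r: "0 < r" "r \<le> 1" and ab: "0 < a" "a \<le> b"
    and c\<phi>: "continuous_on UNIV \<phi>" "continuous_on UNIV fx" "continuous_on UNIV ft"
    and dx: "\<And>x t. ((\<lambda>\<xi>. \<phi> (\<xi>, t)) has_real_derivative fx (x, t)) (at x)"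
    and dt: "\<And>x t. ((\<lambda>s. \<phi> (x, s)) has_real_derivative ft (x, t)) (at t)"
    and zero: "\<And>x. \<phi> (x, a) = 0" "\<And>x. \<phi> (x, b) = 0" "\<And>t. \<phi> (r, t) = 0" "\<And>t. \<phi> (- r, t) = 0"
    and nonneg: "\<And>p. 0 \<le> \<phi> p"
  shows "0 \<le> integral (cbox (- r, a) (r, b)) (kruzhkov c \<phi> fx ft)"
proof -
  let ?B = "cbox (- r, a) (r, b)" and ?k = "kruzhkov c \<phi> fx ft"
  have "compact ?B" by (rule compact_cbox)
  then have bdd: "\<exists>N. \<forall>p\<in>?B. \<bar>g p\<bar> \<le> N" if "continuous_on UNIV g" for g :: "real \<times> real \<Rightarrow> real"
    using compact_imp_bounded[OF compact_continuous_image[OF continuous_on_subset[OF that]], of ?B]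
    unfolding bounded_iff by auto
  obtain N1 where N1: "\<And>p. p \<in> ?B \<Longrightarrow> \<bar>\<phi> p\<bar> \<le> N1" using bdd[OF c\<phi>(1)] by blast
  obtain N2 where N2: "\<And>p. p \<in> ?B \<Longrightarrow> \<bar>fx p\<bar> \<le> N2" using bdd[OF c\<phi>(2)] by blast
  obtain N3 where N3: "\<And>p. p \<in> ?B \<Longrightarrow> \<bar>ft p\<bar> \<le> N3" using bdd[OF c\<phi>(3)] by blast
  \<comment> \<open>The offset 2 keeps the half-width strictly below \<open>r\<close> for every
    \<open>n\<close>, so both side boxes are nondegenerate in \<open>x\<close>.\<close>
  define d where "d n = r / (real n + 2)" for n
  have d: "0 < d n" "d n < r" for n
    using r by (auto simp: d_def divide_simps)
  have d_lim: "d \<longlonglongrightarrow> 0"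
    unfolding d_def
    by (rule tendsto_divide_0[OF tendsto_const])
       (auto intro!: filterlim_at_top_imp_at_infinity filterlim_tendsto_add_at_top[of "\<lambda>_. 2" 2, simplified add.commute] filterlim_real_sequentially)
  let ?R = "\<lambda>n. cbox (d n, a) (r, b)" and ?L = "\<lambda>n. cbox (- r, a) (- d n, b)"
  define Q where "Q x t = sgn (Y x t - c) * dflux c x (Y x t) * \<phi> (x, t)" for x t
  have boxR: "\<bar>x\<bar> \<le> 1 \<and> x \<noteq> 0" if "d n \<le> x" "x \<le> r" for n x
    using that d(1)[of n] r by auto
  have boxL: "\<bar>x\<bar> \<le> 1 \<and> x \<noteq> 0" if "- r \<le> x" "x \<le> - d n" for n x
    using that d(1)[of n] r by auto
  note R = kruzhkov_box[OF less_imp_le[OF d(2)] ab(2,1) boxR c\<phi> dx dt zero(1,2), where c = c, folded Q_def]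
  have "- r \<le> - d n" for n using d(2)[of n] by simp
  note L = kruzhkov_box[OF this ab(2,1) boxL c\<phi> dx dt zero(1,2), where c = c, folded Q_def]
  have Q0: "Q r t = 0" "Q (- r) t = 0" for t by (simp_all add: Q_def zero)
  define K where "K = (4 + c\<^sup>2) * N2 + 2 * (P \<eta> 2 + \<bar>P \<eta> c\<bar>) * N1"
  have flux_ge: "- (d n * K) \<le> Q (- d n) t - Q (d n) t" if t: "t \<in> {a..b}" for n t
  proof -
    have inB: "(x, t) \<in> ?B" if "\<bar>x\<bar> \<le> r" for x using that t by (auto simp: abs_le_iff)
    have diff: "\<bar>\<phi> (x, t) - \<phi> (0, t)\<bar> \<le> N2 * \<bar>x\<bar>" if x: "\<bar>x\<bar> \<le> r" for x
    proof -
      have "norm (\<phi> (x, t) - \<phi> (0, t)) \<le> N2 * norm (x - 0)"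
      proof (rule field_differentiable_bound[of "{-r..r}" "\<lambda>\<xi>. \<phi> (\<xi>, t)" "\<lambda>\<xi>. fx (\<xi>, t)"])
        show "((\<lambda>\<xi>. \<phi> (\<xi>, t)) has_real_derivative fx (z, t)) (at z within {-r..r})" for z
          by (rule has_field_derivative_at_within[OF dx])
        show "norm (fx (z, t)) \<le> N2" if "z \<in> {-r..r}" for z
          using N2[of "(z, t)"] inB[of z] that by (simp add: abs_le_iff)
      qed (use x r in \<open>auto simp: abs_le_iff\<close>)
      then show ?thesis by simp
    qed
    have dn: "\<bar>d n\<bar> \<le> r" "\<bar>- d n\<bar> \<le> r" "0 \<le> d n" "d n \<le> 1" using d[of n] r by auto
    have t0: "0 \<le> t" using t ab by simp
    have Yw: "Y (- d n) t = - Y (d n) t" using dn t0 by (intro Y_fun_odd) auto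
    have w: "0 \<le> Y (d n) t" "Y (d n) t \<le> 2"
      using Y_fun_bounds(1)[of "d n" t] Y_fun_abs_le[of "d n" t] dn t0 by auto
    \<comment> \<open>Here \<open>f0\<close>, \<open>f1\<close> and \<open>f2\<close> are the values
      of \<open>\<phi>\<close> at \<open>0\<close>, \<open>- d n\<close> and \<open>d n\<close>;
      \<open>N2\<close> bounds the \<open>x\<close>-derivative and thus serves as Lipschitz constant
      \<open>M\<close>, and \<open>N1\<close> bounds \<open>\<phi>\<close>.\<close>
    show ?thesis
      unfolding Q_def Yw K_def
      by (rule strip_flux_bound[OF w dn(3) nonneg[of "(0, t)"]])
         (use diff[OF dn(1)] diff[OF dn(2)] N1[OF inB[OF dn(1)]] N1[OF inB[OF dn(2)]] dn(3) in auto)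
  qed
  define f where "f n p = (if p \<in> ?R n then ?k p else 0) + (if p \<in> ?L n then ?k p else 0)" for n p
  have subR: "?R n \<subseteq> ?B" and subL: "?L n \<subseteq> ?B" for n
    using d[of n] by (auto simp: subset_iff)
  have fR: "((\<lambda>p. if p \<in> ?R n then ?k p else 0) has_integral integral (?R n) ?k) ?B" for n
    using R(1)[of n] subR by (simp add: has_integral_restrict has_integral_integral)
  have fL: "((\<lambda>p. if p \<in> ?L n then ?k p else 0) has_integral integral (?L n) ?k) ?B" for n
    using L(1)[of n] subL by (simp add: has_integral_restrict has_integral_integral)
  have f_int: "(f n has_integral (integral (?R n) ?k + integral (?L n) ?k)) ?B" for n
    unfolding f_def by (intro has_integral_add fR fL)
  have f_ge: "- (d n * K) * (b - a) \<le> integral ?B (f n)" for n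
  proof -
    have "integral ?B (f n) = integral {a..b} (\<lambda>t. Q r t - Q (d n) t) + integral {a..b} (\<lambda>t. Q (- d n) t - Q (- r) t)"
      using f_int[of n] R(3)[of n] L(3)[of n] by (simp add: integral_unique)
    also have "\<dots> = integral {a..b} (\<lambda>t. (Q r t - Q (d n) t) + (Q (- d n) t - Q (- r) t))"
      by (rule integral_add[OF R(2)[of n] L(2)[of n], symmetric])
    finally have "integral ?B (f n) = integral {a..b} (\<lambda>t. (Q r t - Q (d n) t) + (Q (- d n) t - Q (- r) t))" .
    moreover have "integral {a..b} (\<lambda>t. - (d n * K)) \<le> integral {a..b} (\<lambda>t. (Q r t - Q (d n) t) + (Q (- d n) t - Q (- r) t))"
    proof (rule integral_le)
      show "(\<lambda>t. (Q r t - Q (d n) t) + (Q (- d n) t - Q (- r) t)) integrable_on {a..b}"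
        by (rule integrable_add[OF R(2) L(2)])
    qed (use flux_ge[of _ n] Q0 in auto)
    ultimately show ?thesis using ab by (simp add: mult_ac)
  qed
  define W where "W = (2 + \<bar>c\<bar>) * N3 + (2 * max 2 \<bar>c\<bar> + 2 * \<eta>) * (2 + \<bar>c\<bar>) * N2 + (\<bar>P \<eta> c\<bar> + 1) * N1"
  have k_le: "\<bar>?k p\<bar> \<le> W" if p: "p \<in> ?B" for p
  proof -
    obtain x t where xt: "p = (x, t)" by (cases p)
    have x: "\<bar>x\<bar> \<le> 1" "0 \<le> t" using p r ab by (auto simp: xt abs_le_iff)
    define u where "u = Y x t"
    have u: "\<bar>u\<bar> \<le> 2" using Y_fun_abs_le[OF x] by (simp add: u_def)
    have uc: "\<bar>u - c\<bar> \<le> 2 + \<bar>c\<bar>" using u by linarith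
    have "\<bar>dflux c x u\<bar> \<le> (2 * max 2 \<bar>c\<bar> + 2 * \<eta>) * \<bar>u - c\<bar>"
      using u x by (intro dflux_lip) auto
    also have "\<dots> \<le> (2 * max 2 \<bar>c\<bar> + 2 * \<eta>) * (2 + \<bar>c\<bar>)"
      using uc eta by (intro mult_left_mono) auto
    finally have df: "\<bar>dflux c x u\<bar> \<le> (2 * max 2 \<bar>c\<bar> + 2 * \<eta>) * (2 + \<bar>c\<bar>)" .
    have s: "\<bar>sgn (u - c) * v\<bar> \<le> \<bar>v\<bar>" for v by (simp add: abs_mult sgn_if)
    have "\<bar>\<bar>u - c\<bar> * ft p\<bar> \<le> (2 + \<bar>c\<bar>) * N3"
      unfolding abs_mult using uc N3[OF p] by (intro mult_mono) auto
    moreover have "\<bar>sgn (u - c) * dflux c x u * fx p\<bar> \<le> (2 * max 2 \<bar>c\<bar> + 2 * \<eta>) * (2 + \<bar>c\<bar>) * N2"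
      unfolding abs_mult[of _ "fx p"] using N2[OF p] eta
      by (intro mult_mono order.trans[OF s df]) auto
    moreover have "\<bar>sgn (u - c) * (P \<eta> c - x) * \<phi> p\<bar> \<le> (\<bar>P \<eta> c\<bar> + 1) * N1"
      unfolding abs_mult[of _ "\<phi> p"] using N1[OF p] x
      by (intro mult_mono order.trans[OF s]) auto
    moreover have "?k p = \<bar>u - c\<bar> * ft p + sgn (u - c) * dflux c x u * fx p - sgn (u - c) * (P \<eta> c - x) * \<phi> p"
      by (simp add: kruzhkov_def Let_def xt u_def)
    moreover have "\<bar>w1 + w2 - w3\<bar> \<le> W1 + W2 + W3" if "\<bar>w1\<bar> \<le> W1" "\<bar>w2\<bar> \<le> W2" "\<bar>w3\<bar> \<le> W3"
      for w1 w2 w3 W1 W2 W3 :: real using that by linarith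
    ultimately show ?thesis unfolding W_def by metis
  qed
  \<comment> \<open>The limit of the truncated integrands omits the line \<open>x = 0\<close>, where
    \<open>Y\<close> has the value 0 instead of a trace; this line is a null set.\<close>
  define g where "g p = (if fst p = 0 then 0 else ?k p)" for p
  have f_cases: "f n p = (if d n \<le> \<bar>fst p\<bar> then ?k p else 0)" if "p \<in> ?B" for n p
    using that d(1)[of n] by (cases p) (auto simp: f_def abs_if)
  have conv: "(\<lambda>n. integral ?B (f n)) \<longlonglongrightarrow> integral ?B g"
  proof (rule dominated_convergence(2)[where h = "\<lambda>_. W"])
    show "f n integrable_on ?B" for n using f_int by blast
    show "norm (f n p) \<le> W" if "p \<in> ?B" for n p
      using k_le[OF that] by (auto simp: f_cases[OF that])
    show "(\<lambda>n. f n p) \<longlonglongrightarrow> g p" if p: "p \<in> ?B" for p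
    proof (cases "fst p = 0")
      case True
      then show ?thesis by (simp add: f_cases[OF p] g_def linorder_not_le[THEN iffD2, OF d(1)])
    next
      case False
      have "\<forall>\<^sub>F n in sequentially. d n < \<bar>fst p\<bar>"
        by (rule order_tendstoD(2)[OF d_lim]) (use False in simp)
      then have "\<forall>\<^sub>F n in sequentially. g p = f n p"
        by eventually_elim (simp add: f_cases[OF p] g_def False)
      then show ?thesis by (rule Lim_transform_eventually[OF tendsto_const])
    qed
  qed (rule integrable_const)
  have "(\<lambda>n. - (d n * K) * (b - a)) \<longlonglongrightarrow> - (0 * K) * (b - a)"
    by (intro tendsto_intros d_lim)
  then have "0 \<le> integral ?B g"
    using f_ge by (intro LIMSEQ_le[OF _ conv]) auto
  also have "integral ?B g = integral ?B ?k"
  proof (rule integral_spike[where S = "{p. p \<bullet> (1, 0) = 0}"])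
    show "negligible {p :: real \<times> real. p \<bullet> (1, 0) = 0}"
      by (rule negligible_standard_hyperplane) (simp add: Basis_prod_def)
    show "?k p = g p" if "p \<in> ?B - {p. p \<bullet> (1, 0) = 0}" for p
      using that by (cases p) (auto simp: g_def)
  qed
  finally show ?thesis .
qed

lemma entropy_inequality:
  assumes \<phi>: "test_function ({-1<..<1} \<times> {0<..}) \<phi>" and nonneg: "\<And>p. 0 \<le> \<phi> p"
  shows "0 \<le> (LINT p:{-1<..<1} \<times> {0<..}|lborel.
               (case p of (x, t) \<Rightarrow>
                  \<bar>Y x t - c\<bar> * deriv (\<lambda>s. \<phi> (x, s)) t
                  + sgn (Y x t - c) * (flux \<eta> x (Y x t) - flux \<eta> x c) * deriv (\<lambda>\<xi>. \<phi> (\<xi>, t)) x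
                  - sgn (Y x t - c) * deriv (\<lambda>\<xi>. flux \<eta> \<xi> c) x * \<phi> (x, t)))"
    (is "0 \<le> (LINT p:?S|lborel. ?I p)")
proof -
  let ?K = "closure {p. \<phi> p \<noteq> 0}"
  have K: "compact ?K" "?K \<subseteq> ?S" using \<phi> by (auto simp: test_function_def)
  have "C_diff 1 \<phi>" using \<phi> unfolding test_function_def by blast
  then obtain fx ft where c\<phi>: "continuous_on UNIV \<phi>" "continuous_on UNIV fx" "continuous_on UNIV ft"
    and D: "\<And>p. (\<phi> has_derivative (\<lambda>(h, s). fx p * h + ft p * s)) (at p)"
    using C_diff_1D by blast
  note dx = partial_derivs(1)[OF D] and dt = partial_derivs(2)[OF D]
  have I_eq: "?I p = kruzhkov c \<phi> fx ft p" for p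
    using DERIV_imp_deriv[OF dx] DERIV_imp_deriv[OF dt] DERIV_imp_deriv[OF flux_deriv_x]
    by (cases p) (simp add: kruzhkov_def Let_def dflux_def)
  have off: "\<phi> p = 0" "fx p = 0" "ft p = 0" if "p \<notin> ?K" for p
    using has_derivative_zero_off_support[OF D that] by auto
  \<comment> \<open>Compactness leaves a margin between the support and the boundary of the open
    strip, so \<open>\<phi>\<close> vanishes on all four sides of a rectangle inside it.\<close>
  obtain r a b where r: "0 < r" "r \<le> 1" and ab: "0 < a" "a \<le> b"
    and box: "\<And>x t. (x, t) \<in> ?K \<Longrightarrow> \<bar>x\<bar> < r \<and> a < t \<and> t < b" and r1: "r < 1"
  proof (cases "?K = {}")
    case True
    show thesis
    proof (rule that[of "1/2" 1 1])
      fix x t assume "(x, t) \<in> ?K"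
      then show "\<bar>x\<bar> < 1/2 \<and> 1 < t \<and> t < 1" by (simp only: True empty_iff)
    qed auto
  next
    case False
    obtain p1 where p1: "p1 \<in> ?K" "\<And>p. p \<in> ?K \<Longrightarrow> \<bar>fst p\<bar> \<le> \<bar>fst p1\<bar>"
      using continuous_attains_sup[OF K(1) False continuous_on_rabs[OF continuous_on_fst[OF continuous_on_id]]]
      by metis
    obtain p2 where p2: "p2 \<in> ?K" "\<And>p. p \<in> ?K \<Longrightarrow> snd p2 \<le> snd p"
      using continuous_attains_inf[OF K(1) False continuous_on_snd[OF continuous_on_id]] by metis
    obtain p3 where p3: "p3 \<in> ?K" "\<And>p. p \<in> ?K \<Longrightarrow> snd p \<le> snd p3"
      using continuous_attains_sup[OF K(1) False continuous_on_snd[OF continuous_on_id]] by metis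
    have f1: "\<bar>fst p1\<bar> < 1" and s2: "0 < snd p2" using p1(1) p2(1) K(2) by (auto simp: abs_less_iff)
    show thesis
    proof (rule that[of "(\<bar>fst p1\<bar> + 1) / 2" "snd p2 / 2" "snd p3 + 1"])
      show "snd p2 / 2 \<le> snd p3 + 1" using p2(2)[OF p3(1)] s2 by simp
      fix x t assume "(x, t) \<in> ?K"
      then show "\<bar>x\<bar> < (\<bar>fst p1\<bar> + 1) / 2 \<and> snd p2 / 2 < t \<and> t < snd p3 + 1"
        using p1(2)[of "(x, t)"] p2(2)[of "(x, t)"] p3(2)[of "(x, t)"] f1 s2 by auto
    qed (use f1 s2 in auto)
  qed
  let ?B = "cbox (- r, a) (r, b)"
  have zero: "\<phi> (x, a) = 0" "\<phi> (x, b) = 0" "\<phi> (r, t) = 0" "\<phi> (- r, t) = 0" for x t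
    by (rule off(1), rule notI, drule box, use r in simp)+
  have k0: "kruzhkov c \<phi> fx ft p = 0" if "p \<notin> ?B" for p
  proof -
    have "p \<notin> ?K"
    proof
      assume "p \<in> ?K"
      then have "\<bar>fst p\<bar> < r \<and> a < snd p \<and> snd p < b" by (intro box) (simp only: prod.collapse)
      then have "p \<in> ?B" by (cases p) (simp add: abs_less_iff)
      then show False using that by contradiction
    qed
    from off[OF this] show ?thesis by (simp add: kruzhkov_def)
  qed
  have nn: "0 \<le> integral ?B (kruzhkov c \<phi> fx ft)"
    by (rule kruzhkov_integral_nonneg[OF r ab c\<phi> dx dt zero nonneg])
  have sub: "?B \<subseteq> ?S" using r1 ab by auto
  \<comment> \<open>If the integrand is Lebesgue integrable, its integral agrees with the gauge
    integral over the rectangle; in the other case the Bochner integral has the default value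
    0.\<close>
  show ?thesis
  proof (cases "set_integrable lborel ?S (kruzhkov c \<phi> fx ft)")
    case True
    have "(LINT p:?S|lborel. kruzhkov c \<phi> fx ft p) = integral ?S (kruzhkov c \<phi> fx ft)"
      by (rule set_borel_integral_eq_integral(2)[OF True])
    also have "\<dots> = integral ?S (\<lambda>p. if p \<in> ?B then kruzhkov c \<phi> fx ft p else 0)"
      by (rule integral_cong) (simp add: k0)
    also have "\<dots> = integral ?B (kruzhkov c \<phi> fx ft)"
      by (simp add: integral_restrict_Int Int_absorb2[OF sub] Int_absorb1[OF sub])
    finally show ?thesis using nn by (simp add: I_eq)
  next
    case False
    then show ?thesis
      by (simp add: I_eq set_lebesgue_integral_def set_integrable_def not_integrable_integral_eq)
  qed
qed

lemma entropy: "entropy_solution (flux \<eta>) (\<lambda>x. 0) (Y)"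
  unfolding entropy_solution_def
proof (intro conjI allI impI ballI)
  show "set_borel_measurable borel ({-1..1} \<times> {0..}) (\<lambda>(x, t). Y x t)"
    using Y_fun_measurable by (simp add: set_borel_measurable_def case_prod_unfold)
  fix K :: "(real \<times> real) set" assume "compact K \<and> K \<subseteq> {-1..1} \<times> {0..}"
  then show "bounded ((\<lambda>(x, t). Y x t) ` K)"
    unfolding bounded_iff real_norm_def
    by (intro exI[of _ 2]) (force intro!: Y_fun_abs_le intro: abs_leI)
next
  fix x :: real assume "x \<in> {-1..1}"
  then show "Y x 0 = 0" by (intro Y_fun_0) (auto simp: abs_le_iff)
next
  show "((\<lambda>t. LBINT x:{-1..1}. \<bar>Y x t - 0\<bar>) \<longlongrightarrow> 0) (at_right 0)"
    by (rule Y_fun_L1)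
qed (use entropy_inequality in blast)

end

theorem proposition4p1:
  fixes \<eta> :: real
  assumes "0 \<le> \<eta>" and "\<eta> < 1/2"
  shows "entropy_solution (flux \<eta>) (\<lambda>x. 0) (Y_fun \<eta>) \<and>
         has_shock_curve (flux \<eta>) (Y_fun \<eta>) (\<lambda>t. 0) (T1_0plus \<eta>)"
proof -
  \<comment> \<open>The conclusion does not mention the truncation, so any admissible level serves;
    2 is the smallest.\<close>
  interpret trunc \<eta> 2 using assms by unfold_locales auto
  show ?thesis using entropy shock_curve by blast
qed

end
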